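(* Let $(\mathcal A,\varphi,\psi)$ be a (not necessarily unital) 2-algebraic probability space, $\widehat{\mathcal A}=\mathbb C\oplus\mathcal A$ the unitization, $\widehat\varphi,\widehat\psi$ the unital extensions of $\varphi,\psi$, and $\delta$ the delta functional on $\widehat{\mathcal A}$, $\delta(\lambda+a)=\lambda$. For a triplet of unital linear functionals $(\varphi',\psi',\theta')$ on $\widehat{\mathcal A}$ let $K_n^{\alpha(\varphi',\psi',\theta')}$ denote the $n$-th $\alpha$-free cumulant of $(\widehat{\mathcal A},\varphi',\psi',\theta')$. (1) The multilinear functionals $K_n^{\mathrm{CM}(\varphi,\psi)}:=K_n^{\alpha(\widehat\varphi,\widehat\psi,\delta)}|_{\mathcal A^n}$ and $K_n^{\mathrm M(\psi)}:=K_n^{\alpha(\widehat\psi,\widehat\psi,\delta)}|_{\mathcal A^n}$ coincide with the $n$-th c-monotone cumulants and the $n$-th monotone cumulants, respectively, and for all $a_1,\dots,a_n\in\mathcal A$ $$\varphi(a_1\cdots a_n)=\sum_{\pi\in\mathcal M(n)}\frac1{|\pi|!}\Big[\prod_{P\in\mathscr O(\pi)}K_{|P|}^{\mathrm{CM}(\varphi,\psi)}(a_P)\Big]\Big[\prod_{P\in\mathscr I(\pi)}K_{|P|}^{\mathrm M(\psi)}(a_P)\Big],\qquad \psi(a_1\cdots a_n)=\sum_{\pi\in\mathcal M(n)}\frac1{|\pi|!}\prod_{P\in\pi}K_{|P|}^{\mathrm M(\psi)}(a_P).$$ (2) $K_n^{\mathrm{CAM}(\varphi,\psi)}:=K_n^{\alpha(\widehat\varphi,\delta,\widehat\psi)}|_{\mathcal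 A^n}$ and $K_n^{\mathrm{AM}(\psi)}:=K_n^{\alpha(\widehat\psi,\delta,\widehat\psi)}|_{\mathcal A^n}$ are the $n$-th c-antimonotone cumulant and the $n$-th antimonotone cumulant, respectively, and for all $a_1,\dots,a_n\in\mathcal A$ $$\varphi(a_1\cdots a_n)=\sum_{\pi\in\mathcal{AM}(n)}\frac1{|\pi|!}\Big[\prod_{P\in\mathscr O(\pi)}K_{|P|}^{\mathrm{CAM}(\varphi,\psi)}(a_P)\Big]\Big[\prod_{P\in\mathscr I(\pi)}K_{|P|}^{\mathrm{AM}(\psi)}(a_P)\Big],\qquad \psi(a_1\cdots a_n)=\sum_{\pi\in\mathcal{AM}(n)}\frac1{|\pi|!}\prod_{P\in\pi}K_{|P|}^{\mathrm{AM}(\psi)}(a_P).$$ (3) $K_n^{\mathrm B(\varphi)}:=K_n^{\alpha(\widehat\varphi,\delta,\delta)}|_{\mathcal A^n}$ is the $n$-th Boolean cumulant, and for all $a_1,\dots,a_n\in\mathcal A$ $$\varphi(a_1\cdots a_n)=\sum_{\pi\in\mathcal I(n)}\prod_{P\in\pi}K_{|P|}^{\mathrm B(\varphi)}(a_P).$$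
   Context: Algebras are over $\mathbb C$. An $m$-algebraic probability space is an algebra with $m$ linear functionals; it is unital if the algebra and the functionals are unital. **Partitions.** An ordered set partition of $[n]$ is a sequence $\pi=(P_1,\dots,P_p)$ whose entries form a set partition of $[n]$; $|\pi|=p$; $P_i$ precedes $P_j$ if $i<j$. It is noncrossing if the underlying set partition is. A block $P'$ covers $P$ if there are $i,j\in P'$ with $i<k<j$ for all $k\in P$; blocks covered by another block are inner (set $\mathscr I(\pi)$), the others outer (set $\mathscr O(\pi)$). $\mathcal M(n)$ (monotone partitions): noncrossing ordered set partitions in which every inner block is preceded by its covers. $\mathcal{AM}(n)$ (antimonotone partitions): noncrossing ordered set partitions in which every inner block precedes its covers. $\mathcal I(n)$: (unordered) set partitions of $[n]$ all of whose blocks are intervals. For $P=\{p_1<\cdots<p_k\}$, $M_k(a_P):=M_k(a_{p_1},\dots,a_{p_k})$. **$\alpha$-free product and cumulants.** For a totally ordered set $I$, $I^\ast$ is the set of finite sequences $\mathbf i=(i_1,\dots,i_n)$, $n\ge1$, in $I$ with $i_k\ne i_{k+1}$. $\mathrm{Peak}(\mathbf i)=\{k\in\{2,\dots,n-1\}: i_{k-1}<i_k>i_{k+1}\}$, $\mathrm{Bot}(\mathbf i)=\{k\in\{2,\dots,n-1\}: i_{k-1}>i_k<i_{k+1}\}$. Given unital 3-algebraic probability spaces $(\mathcal B_i,\varphi_i,\psi_i,\theta_i)$, put $\alpha_{\mathbf i,1}=\varphi_{i_1}$, $\alpha_{\mathbf i,k}=\psi_{i_k}$ if $k\in\mathrm{Peak}(\mathbf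 i)$, $\theta_{i_k}$ if $k\in\mathrm{Bot}(\mathbf i)$, $0$ otherwise; $\beta_{\mathbf i,k}$ (resp. $\gamma_{\mathbf i,k}$) is the same with $\varphi_{i_1}$ replaced by $\psi_{i_1}$ (resp. $\theta_{i_1}$). The $\alpha$-free product is the unital free product $\mathcal U=\ast_{i\in I}\mathcal B_i$ with the unique unital linear functionals $\widetilde\varphi,\widetilde\psi,\widetilde\theta$ such that for every $\mathbf i\in I^\ast$, $a_k\in\mathcal B_{i_k}$: $\widetilde\varphi(a_1\cdots a_n)=0$ if all $a_k\in\ker\alpha_{\mathbf i,k}$; $\widetilde\psi(a_1\cdots a_n)=0$ if all $a_k\in\ker\beta_{\mathbf i,k}$; $\widetilde\theta(a_1\cdots a_n)=0$ if all $a_k\in\ker\gamma_{\mathbf i,k}$. For a unital 3-algebraic probability space $(\mathcal B,\varphi,\psi,\theta)$, take the $\alpha$-free product over $\mathbb N=\{1,2,\dots\}$ of copies of it, let $a^{(j)}$ be the $j$-th copy of $a\in\mathcal B$ and $N.a=a^{(1)}+\cdots+a^{(N)}$; then $K_n^{\alpha(\varphi,\psi,\theta)}(a_1,\dots,a_n)$ is the coefficient of $N$ in the polynomial $\widetilde\varphi((N.a_1)\cdots(N.a_n))$. **The other products.** Let $\{(\mathcal A_i,\varphi_i,\psi_i)\}_{i\in I}$ be 2-algebraic probability spaces, $I$ totally ordered, and let $\mathcal U_0$ be the nonunital free product (coproduct of algebras) of $\{\mathcal A_i\}$. For $\mathbf i\in I^\ast$, $p$ is a local maximum if $i_{p-1}<i_p>i_{p+1}$,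 where nonexistent neighbours ($p=1$ or $p=n$) impose no condition. Below $a_k\in\mathcal A_{i_k}$, $\mathbf i\in I^\ast$. Monotone product: the functional $\psi$ on $\mathcal U_0$ with $\psi|_{\mathcal A_i}=\psi_i$ and $\psi(a_1\cdots a_n)=\psi(a_p)\psi(a_1\cdots a_{p-1}a_{p+1}\cdots a_n)$ for $n\ge2$ and every local maximum $p$. C-monotone product: $(\mathcal U_0,\varphi,\psi)$ with $\psi$ the monotone product of $(\psi_i)$ and $\varphi$ determined by $\varphi|_{\mathcal A_i}=\varphi_i$ and, for $n\ge2$ and every local maximum $p$, $\varphi(a_1\cdots a_n)=\varphi(a_1\cdots a_{p-1})[\varphi(a_p)-\psi(a_p)]\varphi(a_{p+1}\cdots a_n)+\psi(a_p)\varphi(a_1\cdots a_{p-1}a_{p+1}\cdots a_n)$, where $\varphi$ of an empty word is $1$. Antimonotone and c-antimonotone products: the monotone and c-monotone products with respect to the reversed order on $I$. Boolean product: $\varphi(a_1\cdots a_n)=\prod_k\varphi_{i_k}(a_k)$ on $\mathcal U_0$. **Cumulants for these products.** For each of these notions, take the corresponding product over $\mathbb N$ of copies of the given space, $N.a=a^{(1)}+\cdots+a^{(N)}$; the $n$-th cumulant evaluated at $(a_1,\dots,a_n)$ is the coefficient of $N$ in the polynomial in $N$ given by the value at $(N.a_1)\cdots(N.a_n)$ of the product functional: the first functional $\varphi$ for c-monotone and c-antimonotone cumulants (of $(\varphi,\psi)$), the functional $\psi$ for monotone and antimonotone cumulants (of $\psi$), and the functional $\varphi$ for Boolean cumulants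 (of $\varphi$). *)

theory Defs
  imports
    Complex_Main
    "HOL-Library.Poly_Mapping"
    "HOL-Library.Disjoint_Sets"
    "HOL-Computational_Algebra.Polynomial"
begin

section \<open>Complex algebras and linear functionals\<close>

text \<open>Algebras are whole types; they are associative and need not be unital.\<close>

class complex_algebra = ring +
  fixes cscale :: "complex \<Rightarrow> 'a \<Rightarrow> 'a" (infixr "*\<^sub>C" 75)
  assumes cscale_add_right: "c *\<^sub>C (x + y) = c *\<^sub>C x + c *\<^sub>C y"
    and cscale_add_left: "(c + d) *\<^sub>C x = c *\<^sub>C x + d *\<^sub>C x"
    and cscale_cscale: "c *\<^sub>C (d *\<^sub>C x) = (c * d) *\<^sub>C x"
    and cscale_one: "1 *\<^sub>C x = x"
    and cscale_mult_left: "(c *\<^sub>C x) * y = c *\<^sub>C (x * y)"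
    and cscale_mult_right: "x * (c *\<^sub>C y) = c *\<^sub>C (x * y)"

text \<open>The zero algebra is not excluded here, so that free products need no nontriviality proof to
  be instances of this class.\<close>

class complex_algebra_1 = complex_algebra + monoid_mult

lemma vector_space_cscale:
  "vector_space (cscale :: complex \<Rightarrow> 'a \<Rightarrow> 'a::complex_algebra)"
  by unfold_locales (simp_all add: cscale_add_right cscale_add_left cscale_cscale cscale_one)

abbreviation clinear :: "('a::complex_algebra \<Rightarrow> complex) \<Rightarrow> bool" where
  "clinear \<equiv> Vector_Spaces.linear cscale (*)"

definition unital_functional :: "('a::complex_algebra_1 \<Rightarrow> complex) \<Rightarrow> bool" where
  "unital_functional \<phi> \<longleftrightarrow> clinear \<phi> \<and> \<phi> 1 = 1"

definition multilinear_functionals :: "('a::complex_algebra list \<Rightarrow> complex) \<Rightarrow> bool" where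
  "multilinear_functionals K \<longleftrightarrow> (\<forall>as k. k < length as \<longrightarrow> clinear (\<lambda>x. K (as[k := x])))"

text \<open>Product of a nonempty list, for algebras without unit; it is left unspecified on the empty
  list.\<close>

fun list_mult :: "'a::times list \<Rightarrow> 'a" where
  "list_mult [a] = a"
| "list_mult (a # b # as) = a * list_mult (b # as)"


section \<open>Unitization\<close>

datatype 'a unitization = Unitization (scalar_part: complex) (algebra_part: 'a)

instantiation unitization :: (complex_algebra) complex_algebra_1
begin

definition "0 = Unitization 0 0"
definition "1 = Unitization 1 0"
definition "x + y =
  Unitization (scalar_part x + scalar_part y) (algebra_part x + algebra_part y)"
definition "x - y =
  Unitization (scalar_part x - scalar_part y) (algebra_part x - algebra_part y)"
definition "- x = Unitization (- scalar_part x) (- algebra_part x)"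
definition "x * y = Unitization (scalar_part x * scalar_part y)
  (scalar_part x *\<^sub>C algebra_part y + scalar_part y *\<^sub>C algebra_part x
    + algebra_part x * algebra_part y)"
definition "c *\<^sub>C x = Unitization (c * scalar_part x) (c *\<^sub>C algebra_part x)"

instance
proof -
  interpret vector_space "cscale :: complex \<Rightarrow> 'a \<Rightarrow> 'a" by (rule vector_space_cscale)
  show "OFCLASS('a unitization, complex_algebra_1_class)"
    by standard
      (auto simp: zero_unitization_def one_unitization_def plus_unitization_def
        minus_unitization_def uminus_unitization_def times_unitization_def
        cscale_unitization_def algebra_simps cscale_mult_left cscale_mult_right
        cscale_one mult.commute mult.left_commute)
qed

end

instance unitization :: (complex_algebra) ring_1
  by standard (simp add: zero_unitization_def one_unitization_def)

definition in_unitization :: "'a::complex_algebra \<Rightarrow> 'a unitization" where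
  "in_unitization a = Unitization 0 a"

definition unital_extension ::
  "('a::complex_algebra \<Rightarrow> complex) \<Rightarrow> 'a unitization \<Rightarrow> complex" where
  "unital_extension \<phi> x = scalar_part x + \<phi> (algebra_part x)"

definition delta_functional :: "'a::complex_algebra unitization \<Rightarrow> complex" where
  "delta_functional x = scalar_part x"


section \<open>Free products\<close>

text \<open>Words form the free monoid under concatenation, so that finitely supported functions on words
  with the convolution product of \<^theory>\<open>HOL-Library.Poly_Mapping\<close> form the free unital
  algebra.\<close>

instantiation list :: (type) monoid_add
begin
definition "(0 :: 'a list) = []"
definition "(xs :: 'a list) + ys = xs @ ys"
instance by standard (simp_all add: zero_list_def plus_list_def)
end

type_synonym 'g free_algebra = "'g list \<Rightarrow>\<^sub>0 complex"

definition generator :: "'g \<Rightarrow> 'g free_algebra" where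
  "generator g = Poly_Mapping.single [g] 1"

definition free_scalar :: "complex \<Rightarrow> 'g free_algebra" where
  "free_scalar c = Poly_Mapping.single [] c"

inductive_set generated_ideal :: "'r::ring_1 set \<Rightarrow> 'r set" for S where
  zero: "0 \<in> generated_ideal S"
| generator: "s \<in> S \<Longrightarrow> u * s * v \<in> generated_ideal S"
| add: "x \<in> generated_ideal S \<Longrightarrow> y \<in> generated_ideal S \<Longrightarrow> x + y \<in> generated_ideal S"

text \<open>The generators are pairs \<open>(i, a)\<close>, standing for the element \<open>a\<close> of the \<open>i\<close>-th copy of one
  algebra.  Only free products of copies are formed; the copies will carry possibly different
  functionals.\<close>

inductive_set free_product_relations :: "('i \<times> 'a::complex_algebra) free_algebra set" where
  "generator (i, a + b) - (generator (i, a) + generator (i, b)) \<in> free_product_relations"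
| "generator (i, c *\<^sub>C a) - free_scalar c * generator (i, a) \<in> free_product_relations"
| "generator (i, a * b) - generator (i, a) * generator (i, b) \<in> free_product_relations"

definition unital_free_product_relations :: "('i \<times> 'b::complex_algebra_1) free_algebra set" where
  "unital_free_product_relations = free_product_relations \<union> {generator (i, 1) - 1 | i. True}"

definition nonunital_free_algebra :: "'g free_algebra set" where
  "nonunital_free_algebra = {x. Poly_Mapping.lookup x [] = 0}"

definition free_product_rel ::
  "('i \<times> 'a::complex_algebra) free_algebra \<Rightarrow> ('i \<times> 'a) free_algebra \<Rightarrow> bool" where
  "free_product_rel x y \<longleftrightarrow> x \<in> nonunital_free_algebra \<and> y \<in> nonunital_free_algebra \<and>
     x - y \<in> generated_ideal free_product_relations"

definition unital_free_product_rel ::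
  "('i \<times> 'b::complex_algebra_1) free_algebra \<Rightarrow> ('i \<times> 'b) free_algebra \<Rightarrow> bool" where
  "unital_free_product_rel x y \<longleftrightarrow> x - y \<in> generated_ideal unital_free_product_relations"

lemma generated_ideal_mult_left: "x \<in> generated_ideal S \<Longrightarrow> u * x \<in> generated_ideal S"
proof (induction rule: generated_ideal.induct)
  case (generator s v w)
  then show ?case using generated_ideal.generator[of s S "u * v" w] by (simp add: mult.assoc)
qed (auto simp: distrib_left intro: generated_ideal.intros)

lemma generated_ideal_mult_right: "x \<in> generated_ideal S \<Longrightarrow> x * u \<in> generated_ideal S"
proof (induction rule: generated_ideal.induct)
  case (generator s v w)
  then show ?case using generated_ideal.generator[of s S v "w * u"] by (simp add: mult.assoc)
qed (auto simp: distrib_right intro: generated_ideal.intros)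

lemma generated_ideal_uminus: "x \<in> generated_ideal S \<Longrightarrow> - x \<in> generated_ideal S"
  using generated_ideal_mult_left[of x S "- 1"] by simp

lemma generated_ideal_diff:
  "x \<in> generated_ideal S \<Longrightarrow> y \<in> generated_ideal S \<Longrightarrow> x - y \<in> generated_ideal S"
  using generated_ideal.add[of x S "- y"] generated_ideal_uminus[of y S] by simp

lemma generated_ideal_cong_plus:
  assumes "x - x' \<in> generated_ideal S" "y - y' \<in> generated_ideal S"
  shows "(x + y) - (x' + y') \<in> generated_ideal S"
  using generated_ideal.add[OF assms] by (simp add: algebra_simps)

lemma generated_ideal_cong_minus:
  assumes "x - x' \<in> generated_ideal S" "y - y' \<in> generated_ideal S"
  shows "(x - y) - (x' - y') \<in> generated_ideal S"
  using generated_ideal_diff[OF assms] by (simp add: algebra_simps)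

lemma generated_ideal_cong_uminus:
  assumes "x - x' \<in> generated_ideal S"
  shows "(- x) - (- x') \<in> generated_ideal S"
  using generated_ideal_uminus[OF assms] by (simp add: algebra_simps)

lemma generated_ideal_cong_mult:
  assumes "x - x' \<in> generated_ideal S" "y - y' \<in> generated_ideal S"
  shows "x * y - x' * y' \<in> generated_ideal S"
proof -
  have "x * y - x' * y' = (x - x') * y + x' * (y - y')"
    by (simp add: algebra_simps)
  then show ?thesis
    using assms generated_ideal.add generated_ideal_mult_left generated_ideal_mult_right by metis
qed

lemma equivp_ideal: "equivp (\<lambda>x y. x - y \<in> generated_ideal S)"
proof (rule equivpI)
  show "reflp (\<lambda>x y. x - y \<in> generated_ideal S)"
    by (rule reflpI) (simp add: generated_ideal.zero)
  show "symp (\<lambda>x y. x - y \<in> generated_ideal S)"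
    by (rule sympI) (metis generated_ideal_uminus minus_diff_eq)
  show "transp (\<lambda>x y. x - y \<in> generated_ideal S)"
    by (rule transpI) (metis generated_ideal.add diff_add_cancel add_diff_eq)
qed

lemma free_scalar_commute: "x * free_scalar c = free_scalar c * x"
proof (induction x rule: update_induct)
  case const
  then show ?case by simp
next
  case (update f a b)
  have upd: "Poly_Mapping.update a b f = f + Poly_Mapping.single a b"
    using update(1) by (intro poly_mapping_eqI)
      (auto simp: lookup_update lookup_add lookup_single when_def in_keys_iff)
  have "Poly_Mapping.single a b * free_scalar c = free_scalar c * Poly_Mapping.single a b"
    by (simp add: free_scalar_def mult_single plus_list_def mult.commute)
  with update show ?case by (simp add: upd distrib_left distrib_right)
qed

lemma free_scalar_simps:
  "free_scalar (c + d) = free_scalar c + free_scalar d"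
  "free_scalar (c * d) = free_scalar c * free_scalar d"
  "free_scalar 1 = 1"
  by (simp_all add: free_scalar_def single_add mult_single plus_list_def flip: single_one)
     (simp add: zero_list_def)

lemma nonunital_free_algebra_zero: "0 \<in> nonunital_free_algebra"
  and nonunital_free_algebra_add: "x \<in> nonunital_free_algebra \<Longrightarrow>
    y \<in> nonunital_free_algebra \<Longrightarrow> x + y \<in> nonunital_free_algebra"
  and nonunital_free_algebra_uminus: "x \<in> nonunital_free_algebra \<Longrightarrow> - x \<in> nonunital_free_algebra"
  by (simp_all add: nonunital_free_algebra_def lookup_add)

lemma nonunital_free_algebra_mult_left:
  assumes "y \<in> nonunital_free_algebra" shows "x * y \<in> nonunital_free_algebra"
proof -
  have "Poly_Mapping.lookup (x * y) [] = 0"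
  proof (induction x rule: update_induct)
    case const
    then show ?case by simp
  next
    case (update f a b)
    have upd: "Poly_Mapping.update a b f = f + Poly_Mapping.single a b"
      using update(1) by (intro poly_mapping_eqI)
        (auto simp: lookup_update lookup_add lookup_single when_def in_keys_iff)
    have "Poly_Mapping.lookup (Poly_Mapping.single a b * y) [] = 0"
      using assms
    proof (induction y rule: update_induct)
      case const
      then show ?case by simp
    next
      case (update g u v)
      have "Poly_Mapping.update u v g = g + Poly_Mapping.single u v"
        using update(1) by (intro poly_mapping_eqI)
          (auto simp: lookup_update lookup_add lookup_single when_def in_keys_iff)
      moreover have "Poly_Mapping.lookup g [] = 0" "u \<noteq> [] \<or> v = 0"
        using update(1,4)
        by (auto simp: nonunital_free_algebra_def lookup_update in_keys_iff split: if_splits)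
      ultimately show ?case
        using update(3) by (auto simp: nonunital_free_algebra_def distrib_left lookup_add mult_single
            lookup_single when_def plus_list_def)
    qed
    then show ?case
      using update by (simp add: upd distrib_right lookup_add)
  qed
  then show ?thesis by (simp add: nonunital_free_algebra_def)
qed

quotient_type (overloaded) ('i, 'b) unital_free_product =
  "('i \<times> 'b::complex_algebra_1) free_algebra" / unital_free_product_rel
  unfolding unital_free_product_rel_def by (rule equivp_ideal)

quotient_type (overloaded) ('i, 'a) free_product =
  "('i \<times> 'a::complex_algebra) free_algebra" / partial: free_product_rel
proof (rule part_equivpI)
  show "\<exists>x :: ('i \<times> 'a) free_algebra. free_product_rel x x"
    by (intro exI[of _ 0])
      (simp add: free_product_rel_def nonunital_free_algebra_def generated_ideal.zero)
  show "symp (free_product_rel :: ('i \<times> 'a) free_algebra \<Rightarrow> _)"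
    using equivp_symp[OF equivp_ideal] unfolding free_product_rel_def symp_def by blast
  show "transp (free_product_rel :: ('i \<times> 'a) free_algebra \<Rightarrow> _)"
    using equivp_transp[OF equivp_ideal] unfolding free_product_rel_def transp_def by blast
qed

instantiation unital_free_product :: (type, complex_algebra_1) complex_algebra_1
begin

lift_definition zero_unital_free_product :: "('a, 'b) unital_free_product" is 0 .
lift_definition one_unital_free_product :: "('a, 'b) unital_free_product" is 1 .
lift_definition plus_unital_free_product ::
  "('a, 'b) unital_free_product \<Rightarrow> ('a, 'b) unital_free_product \<Rightarrow> ('a, 'b) unital_free_product"
  is "(+)" unfolding unital_free_product_rel_def by (rule generated_ideal_cong_plus)
lift_definition minus_unital_free_product ::
  "('a, 'b) unital_free_product \<Rightarrow> ('a, 'b) unital_free_product \<Rightarrow> ('a, 'b) unital_free_product"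
  is "(-)" unfolding unital_free_product_rel_def by (rule generated_ideal_cong_minus)
lift_definition uminus_unital_free_product ::
  "('a, 'b) unital_free_product \<Rightarrow> ('a, 'b) unital_free_product"
  is "uminus" unfolding unital_free_product_rel_def by (rule generated_ideal_cong_uminus)
lift_definition times_unital_free_product ::
  "('a, 'b) unital_free_product \<Rightarrow> ('a, 'b) unital_free_product \<Rightarrow> ('a, 'b) unital_free_product"
  is "(*)" unfolding unital_free_product_rel_def by (rule generated_ideal_cong_mult)
lift_definition cscale_unital_free_product ::
  "complex \<Rightarrow> ('a, 'b) unital_free_product \<Rightarrow> ('a, 'b) unital_free_product"
  is "\<lambda>c x. free_scalar c * x" unfolding unital_free_product_rel_def
  by (simp add: generated_ideal_mult_left flip: right_diff_distrib)

instance
proof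
  have eq: "unital_free_product_rel x y" if "x = y" for x y :: "('a \<times> 'b) free_algebra"
    using that by (simp add: unital_free_product_rel_def generated_ideal.zero)
  fix x y z :: "('a, 'b) unital_free_product" and c d :: complex
  show "x + y + z = x + (y + z)" by (transfer, rule eq, rule add.assoc)
  show "x + y = y + x" by (transfer, rule eq, rule add.commute)
  show "0 + x = x" by (transfer, rule eq, simp)
  show "- x + x = 0" by (transfer, rule eq, simp)
  show "x - y = x + - y" by (transfer, rule eq, simp)
  show "x * y * z = x * (y * z)" by (transfer, rule eq, rule mult.assoc)
  show "(x + y) * z = x * z + y * z" by (transfer, rule eq, rule distrib_right)
  show "x * (y + z) = x * y + x * z" by (transfer, rule eq, rule distrib_left)
  show "1 * x = x" by (transfer, rule eq, simp)
  show "x * 1 = x" by (transfer, rule eq, simp)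
  show "c *\<^sub>C (x + y) = c *\<^sub>C x + c *\<^sub>C y" by (transfer, rule eq, rule distrib_left)
  show "(c + d) *\<^sub>C x = c *\<^sub>C x + d *\<^sub>C x"
    by (transfer, rule eq, simp add: free_scalar_simps distrib_right)
  show "c *\<^sub>C d *\<^sub>C x = (c * d) *\<^sub>C x"
    by (transfer, rule eq, simp add: free_scalar_simps mult.assoc)
  show "1 *\<^sub>C x = x" by (transfer, rule eq, simp add: free_scalar_simps)
  show "(c *\<^sub>C x) * y = c *\<^sub>C (x * y)" by (transfer, rule eq, rule mult.assoc)
  show "x * (c *\<^sub>C y) = c *\<^sub>C (x * y)"
    by (transfer, rule eq, metis free_scalar_commute mult.assoc)
qed

end

instantiation free_product :: (type, complex_algebra) complex_algebra
begin

lift_definition zero_free_product :: "('a, 'b) free_product" is 0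
  by (simp add: free_product_rel_def nonunital_free_algebra_def generated_ideal.zero)
lift_definition plus_free_product ::
  "('a, 'b) free_product \<Rightarrow> ('a, 'b) free_product \<Rightarrow> ('a, 'b) free_product" is "(+)"
  unfolding free_product_rel_def
  by (auto intro: generated_ideal_cong_plus simp: nonunital_free_algebra_def lookup_add)
lift_definition minus_free_product ::
  "('a, 'b) free_product \<Rightarrow> ('a, 'b) free_product \<Rightarrow> ('a, 'b) free_product" is "(-)"
  unfolding free_product_rel_def
  by (auto intro: generated_ideal_cong_minus simp: nonunital_free_algebra_def lookup_minus)
lift_definition uminus_free_product ::
  "('a, 'b) free_product \<Rightarrow> ('a, 'b) free_product" is "uminus"
  unfolding free_product_rel_def
  by (blast intro: generated_ideal_cong_uminus nonunital_free_algebra_uminus)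
lift_definition times_free_product ::
  "('a, 'b) free_product \<Rightarrow> ('a, 'b) free_product \<Rightarrow> ('a, 'b) free_product" is "(*)"
  unfolding free_product_rel_def
  by (auto intro: generated_ideal_cong_mult nonunital_free_algebra_mult_left)
lift_definition cscale_free_product ::
  "complex \<Rightarrow> ('a, 'b) free_product \<Rightarrow> ('a, 'b) free_product" is "\<lambda>c x. free_scalar c * x"
  unfolding free_product_rel_def
  by (simp add: nonunital_free_algebra_mult_left generated_ideal_mult_left flip: right_diff_distrib)

instance
proof
  have eq: "free_product_rel x y" if "x = y" "y \<in> nonunital_free_algebra"
    for x y :: "('a \<times> 'b) free_algebra"
    using that by (simp add: free_product_rel_def generated_ideal.zero)
  note closed = free_product_rel_def nonunital_free_algebra_mult_left nonunital_free_algebra_add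
    nonunital_free_algebra_zero nonunital_free_algebra_uminus
  fix x y z :: "('a, 'b) free_product" and c d :: complex
  show "x + y + z = x + (y + z)" by (transfer, rule eq, rule add.assoc, simp add: closed)
  show "x + y = y + x" by (transfer, rule eq, rule add.commute, simp add: closed)
  show "0 + x = x" by (transfer, rule eq, simp, simp add: closed)
  show "- x + x = 0" by (transfer, rule eq, simp, simp add: closed)
  show "x - y = x + - y" by (transfer, rule eq, simp, simp add: closed del: add_uminus_conv_diff)
  show "x * y * z = x * (y * z)" by (transfer, rule eq, rule mult.assoc, simp add: closed)
  show "(x + y) * z = x * z + y * z" by (transfer, rule eq, rule distrib_right, simp add: closed)
  show "x * (y + z) = x * y + x * z" by (transfer, rule eq, rule distrib_left, simp add: closed)
  show "c *\<^sub>C (x + y) = c *\<^sub>C x + c *\<^sub>C y"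
    by (transfer, rule eq, rule distrib_left, simp add: closed)
  show "(c + d) *\<^sub>C x = c *\<^sub>C x + d *\<^sub>C x"
    by (transfer, rule eq, simp add: free_scalar_simps distrib_right, simp add: closed)
  show "c *\<^sub>C d *\<^sub>C x = (c * d) *\<^sub>C x"
    by (transfer, rule eq, simp add: free_scalar_simps mult.assoc, simp add: closed)
  show "1 *\<^sub>C x = x" by (transfer, rule eq, simp add: free_scalar_simps, simp add: closed)
  show "(c *\<^sub>C x) * y = c *\<^sub>C (x * y)" by (transfer, rule eq, rule mult.assoc, simp add: closed)
  show "x * (c *\<^sub>C y) = c *\<^sub>C (x * y)"
    by (transfer, rule eq, metis free_scalar_commute mult.assoc, simp add: closed)
qed

end

lift_definition unital_embed :: "'i \<Rightarrow> 'b::complex_algebra_1 \<Rightarrow> ('i, 'b) unital_free_product"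
  is "\<lambda>i a. generator (i, a)" .

lift_definition embed :: "'i \<Rightarrow> 'a::complex_algebra \<Rightarrow> ('i, 'a) free_product"
  is "\<lambda>i a. generator (i, a)"
  by (simp add: free_product_rel_def nonunital_free_algebra_def generator_def lookup_single
      generated_ideal.zero)

text \<open>A product \<open>a\<^sub>1 \<cdots> a\<^sub>n\<close> with \<open>a\<^sub>k\<close> in the \<open>i\<^sub>k\<close>-th copy is given by the list of the pairs
  \<open>(i\<^sub>k, a\<^sub>k)\<close>; it is alternating if neighbouring indices are distinct.\<close>

definition alternating :: "('i \<times> 'a) list \<Rightarrow> bool" where
  "alternating w \<longleftrightarrow> w \<noteq> [] \<and> distinct_adj (map fst w)"

definition unital_word :: "('i \<times> 'b::complex_algebra_1) list \<Rightarrow> ('i, 'b) unital_free_product" where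
  "unital_word w = prod_list (map (\<lambda>(i, a). unital_embed i a) w)"

definition word :: "('i \<times> 'a::complex_algebra) list \<Rightarrow> ('i, 'a) free_product" where
  "word w = list_mult (map (\<lambda>(i, a). embed i a) w)"


section \<open>Cumulants as linear coefficients\<close>

definition linear_coefficient :: "(nat \<Rightarrow> complex) \<Rightarrow> complex" where
  "linear_coefficient f = coeff (THE p. \<forall>N\<ge>1. poly p (of_nat N) = f N) 1"


section \<open>The \<open>\<alpha>\<close>-free product and its cumulants\<close>

text \<open>Positions in sequences are counted from 0.\<close>

definition Peak :: "'i::linorder list \<Rightarrow> nat set" where
  "Peak is = {k. 0 < k \<and> Suc k < length is \<and> is ! (k - 1) < is ! k \<and> is ! k > is ! Suc k}"

definition Bot :: "'i::linorder list \<Rightarrow> nat set" where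
  "Bot is = {k. 0 < k \<and> Suc k < length is \<and> is ! (k - 1) > is ! k \<and> is ! k < is ! Suc k}"

text \<open>With \<open>\<chi> = \<phi>, \<psi>, \<theta>\<close> this is \<open>\<alpha>\<close>, \<open>\<beta>\<close> and \<open>\<gamma>\<close>, respectively.\<close>

definition position_functional ::
  "('i::linorder \<Rightarrow> 'b \<Rightarrow> complex) \<Rightarrow> ('i \<Rightarrow> 'b \<Rightarrow> complex) \<Rightarrow> ('i \<Rightarrow> 'b \<Rightarrow> complex) \<Rightarrow>
    'i list \<Rightarrow> nat \<Rightarrow> 'b \<Rightarrow> complex" where
  "position_functional \<chi> \<psi> \<theta> is k =
    (if k = 0 then \<chi> (is ! k)
     else if k \<in> Peak is then \<psi> (is ! k)
     else if k \<in> Bot is then \<theta> (is ! k)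
     else (\<lambda>_. 0))"

definition alpha_free_functional ::
  "('i::linorder \<Rightarrow> 'b::complex_algebra_1 \<Rightarrow> complex) \<Rightarrow> ('i \<Rightarrow> 'b \<Rightarrow> complex) \<Rightarrow>
    ('i \<Rightarrow> 'b \<Rightarrow> complex) \<Rightarrow> ('i, 'b) unital_free_product \<Rightarrow> complex" where
  "alpha_free_functional \<chi> \<psi> \<theta> = (THE \<Phi>. unital_functional \<Phi> \<and>
     (\<forall>w. alternating w \<and>
          (\<forall>k<length w. position_functional \<chi> \<psi> \<theta> (map fst w) k (snd (w ! k)) = 0) \<longrightarrow>
        \<Phi> (unital_word w) = 0))"

definition alpha_free_product ::
  "('i::linorder \<Rightarrow> 'b::complex_algebra_1 \<Rightarrow> complex) \<Rightarrow> ('i \<Rightarrow> 'b \<Rightarrow> complex) \<Rightarrow>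
    ('i \<Rightarrow> 'b \<Rightarrow> complex) \<Rightarrow> (('i, 'b) unital_free_product \<Rightarrow> complex) \<times>
    (('i, 'b) unital_free_product \<Rightarrow> complex) \<times> (('i, 'b) unital_free_product \<Rightarrow> complex)" where
  "alpha_free_product \<phi> \<psi> \<theta> =
    (alpha_free_functional \<phi> \<psi> \<theta>, alpha_free_functional \<psi> \<psi> \<theta>, alpha_free_functional \<theta> \<psi> \<theta>)"

text \<open>The copies indexed by \<open>1, 2, \<dots>\<close> are numbered \<open>0, 1, \<dots>\<close>, so \<open>N.a\<close> is the sum of the copies
  below \<open>N\<close>.\<close>

definition unital_dilation :: "nat \<Rightarrow> 'b::complex_algebra_1 \<Rightarrow> (nat, 'b) unital_free_product" where
  "unital_dilation N a = (\<Sum>j<N. unital_embed j a)"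

definition alpha_cumulant ::
  "('b::complex_algebra_1 \<Rightarrow> complex) \<Rightarrow> ('b \<Rightarrow> complex) \<Rightarrow> ('b \<Rightarrow> complex) \<Rightarrow>
    'b list \<Rightarrow> complex" where
  "alpha_cumulant \<phi> \<psi> \<theta> as = linear_coefficient (\<lambda>N.
     fst (alpha_free_product (\<lambda>_. \<phi>) (\<lambda>_. \<psi>) (\<lambda>_. \<theta>)) (prod_list (map (unital_dilation N) as)))"


section \<open>Monotone, c-monotone, antimonotone, c-antimonotone and Boolean products\<close>

text \<open>The parameter \<open>lt\<close> is the strict order on the index set.\<close>

definition local_max :: "('i \<Rightarrow> 'i \<Rightarrow> bool) \<Rightarrow> ('i \<times> 'a) list \<Rightarrow> nat \<Rightarrow> bool" where
  "local_max lt w p \<longleftrightarrow> p < length w \<and>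
     (0 < p \<longrightarrow> lt (fst (w ! (p - 1))) (fst (w ! p))) \<and>
     (Suc p < length w \<longrightarrow> lt (fst (w ! Suc p)) (fst (w ! p)))"

definition monotone_product_wrt ::
  "('i \<Rightarrow> 'i \<Rightarrow> bool) \<Rightarrow> ('i \<Rightarrow> 'a::complex_algebra \<Rightarrow> complex) \<Rightarrow>
    ('i, 'a) free_product \<Rightarrow> complex" where
  "monotone_product_wrt lt \<psi> = (THE \<Psi>. clinear \<Psi> \<and>
     (\<forall>i a. \<Psi> (embed i a) = \<psi> i a) \<and>
     (\<forall>w p. alternating w \<and> 2 \<le> length w \<and> local_max lt w p \<longrightarrow>
        \<Psi> (word w) = \<psi> (fst (w ! p)) (snd (w ! p)) * \<Psi> (word (take p w @ drop (Suc p) w))))"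

definition value_or_one ::
  "(('i, 'a::complex_algebra) free_product \<Rightarrow> complex) \<Rightarrow> ('i \<times> 'a) list \<Rightarrow> complex" where
  "value_or_one \<Phi> w = (if w = [] then 1 else \<Phi> (word w))"

definition c_monotone_product_wrt ::
  "('i \<Rightarrow> 'i \<Rightarrow> bool) \<Rightarrow> ('i \<Rightarrow> 'a::complex_algebra \<Rightarrow> complex) \<Rightarrow> ('i \<Rightarrow> 'a \<Rightarrow> complex) \<Rightarrow>
    (('i, 'a) free_product \<Rightarrow> complex) \<times> (('i, 'a) free_product \<Rightarrow> complex)" where
  "c_monotone_product_wrt lt \<phi> \<psi> =
    (THE \<Phi>. clinear \<Phi> \<and>
      (\<forall>i a. \<Phi> (embed i a) = \<phi> i a) \<and>
      (\<forall>w p. alternating w \<and> 2 \<le> length w \<and> local_max lt w p \<longrightarrow>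
        \<Phi> (word w) =
          value_or_one \<Phi> (take p w)
            * (\<phi> (fst (w ! p)) (snd (w ! p)) - \<psi> (fst (w ! p)) (snd (w ! p)))
            * value_or_one \<Phi> (drop (Suc p) w)
          + \<psi> (fst (w ! p)) (snd (w ! p)) * \<Phi> (word (take p w @ drop (Suc p) w))),
     monotone_product_wrt lt \<psi>)"

definition monotone_product ::
  "('i::linorder \<Rightarrow> 'a::complex_algebra \<Rightarrow> complex) \<Rightarrow> ('i, 'a) free_product \<Rightarrow> complex" where
  "monotone_product = monotone_product_wrt (<)"

definition antimonotone_product ::
  "('i::linorder \<Rightarrow> 'a::complex_algebra \<Rightarrow> complex) \<Rightarrow> ('i, 'a) free_product \<Rightarrow> complex" where
  "antimonotone_product = monotone_product_wrt (>)"

definition c_monotone_product ::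
  "('i::linorder \<Rightarrow> 'a::complex_algebra \<Rightarrow> complex) \<Rightarrow> ('i \<Rightarrow> 'a \<Rightarrow> complex) \<Rightarrow>
    (('i, 'a) free_product \<Rightarrow> complex) \<times> (('i, 'a) free_product \<Rightarrow> complex)" where
  "c_monotone_product = c_monotone_product_wrt (<)"

definition c_antimonotone_product ::
  "('i::linorder \<Rightarrow> 'a::complex_algebra \<Rightarrow> complex) \<Rightarrow> ('i \<Rightarrow> 'a \<Rightarrow> complex) \<Rightarrow>
    (('i, 'a) free_product \<Rightarrow> complex) \<times> (('i, 'a) free_product \<Rightarrow> complex)" where
  "c_antimonotone_product = c_monotone_product_wrt (>)"

definition boolean_product ::
  "('i \<Rightarrow> 'a::complex_algebra \<Rightarrow> complex) \<Rightarrow> ('i, 'a) free_product \<Rightarrow> complex" where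
  "boolean_product \<phi> = (THE \<Phi>. clinear \<Phi> \<and>
     (\<forall>w. alternating w \<longrightarrow> \<Phi> (word w) = (\<Prod>(i, a)\<leftarrow>w. \<phi> i a)))"

definition dilation :: "nat \<Rightarrow> 'a::complex_algebra \<Rightarrow> (nat, 'a) free_product" where
  "dilation N a = (\<Sum>j<N. embed j a)"

definition product_cumulant ::
  "((nat, 'a::complex_algebra) free_product \<Rightarrow> complex) \<Rightarrow> 'a list \<Rightarrow> complex" where
  "product_cumulant \<Phi> as =
    linear_coefficient (\<lambda>N. \<Phi> (list_mult (map (dilation N) as)))"

definition c_monotone_cumulant ::
  "('a::complex_algebra \<Rightarrow> complex) \<Rightarrow> ('a \<Rightarrow> complex) \<Rightarrow> 'a list \<Rightarrow> complex" where
  "c_monotone_cumulant \<phi> \<psi> = product_cumulant (fst (c_monotone_product (\<lambda>_. \<phi>) (\<lambda>_. \<psi>)))"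

definition monotone_cumulant :: "('a::complex_algebra \<Rightarrow> complex) \<Rightarrow> 'a list \<Rightarrow> complex" where
  "monotone_cumulant \<psi> = product_cumulant (monotone_product (\<lambda>_. \<psi>))"

definition c_antimonotone_cumulant ::
  "('a::complex_algebra \<Rightarrow> complex) \<Rightarrow> ('a \<Rightarrow> complex) \<Rightarrow> 'a list \<Rightarrow> complex" where
  "c_antimonotone_cumulant \<phi> \<psi> =
    product_cumulant (fst (c_antimonotone_product (\<lambda>_. \<phi>) (\<lambda>_. \<psi>)))"

definition antimonotone_cumulant :: "('a::complex_algebra \<Rightarrow> complex) \<Rightarrow> 'a list \<Rightarrow> complex" where
  "antimonotone_cumulant \<psi> = product_cumulant (antimonotone_product (\<lambda>_. \<psi>))"

definition boolean_cumulant :: "('a::complex_algebra \<Rightarrow> complex) \<Rightarrow> 'a list \<Rightarrow> complex" where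
  "boolean_cumulant \<phi> = product_cumulant (boolean_product (\<lambda>_. \<phi>))"


section \<open>The restricted \<open>\<alpha>\<close>-free cumulants\<close>

definition K_CM :: "('a::complex_algebra \<Rightarrow> complex) \<Rightarrow> ('a \<Rightarrow> complex) \<Rightarrow> 'a list \<Rightarrow> complex" where
  "K_CM \<phi> \<psi> as = alpha_cumulant (unital_extension \<phi>) (unital_extension \<psi>) delta_functional
     (map in_unitization as)"

definition K_M :: "('a::complex_algebra \<Rightarrow> complex) \<Rightarrow> 'a list \<Rightarrow> complex" where
  "K_M \<psi> as = alpha_cumulant (unital_extension \<psi>) (unital_extension \<psi>) delta_functional
     (map in_unitization as)"

definition K_CAM :: "('a::complex_algebra \<Rightarrow> complex) \<Rightarrow> ('a \<Rightarrow> complex) \<Rightarrow> 'a list \<Rightarrow> complex" where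
  "K_CAM \<phi> \<psi> as = alpha_cumulant (unital_extension \<phi>) delta_functional (unital_extension \<psi>)
     (map in_unitization as)"

definition K_AM :: "('a::complex_algebra \<Rightarrow> complex) \<Rightarrow> 'a list \<Rightarrow> complex" where
  "K_AM \<psi> as = alpha_cumulant (unital_extension \<psi>) delta_functional (unital_extension \<psi>)
     (map in_unitization as)"

definition K_B :: "('a::complex_algebra \<Rightarrow> complex) \<Rightarrow> 'a list \<Rightarrow> complex" where
  "K_B \<phi> as = alpha_cumulant (unital_extension \<phi>) delta_functional delta_functional
     (map in_unitization as)"


section \<open>Partitions\<close>

text \<open>The set \<open>[n]\<close> is represented by \<open>{..<n}\<close>, matching list positions, so that the tuple \<open>a\<^sub>P\<close> is
  \<^term>\<open>nths as P\<close>.  An ordered set partition is the list of its blocks, and the number of blocks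
  is the length of this list.\<close>

definition ordered_set_partition :: "nat \<Rightarrow> nat set list \<Rightarrow> bool" where
  "ordered_set_partition n \<pi> \<longleftrightarrow> distinct \<pi> \<and> partition_on {..<n} (set \<pi>)"

definition noncrossing :: "nat set set \<Rightarrow> bool" where
  "noncrossing \<sigma> \<longleftrightarrow> \<not> (\<exists>P\<in>\<sigma>. \<exists>Q\<in>\<sigma>. P \<noteq> Q \<and>
     (\<exists>i j k l. i < j \<and> j < k \<and> k < l \<and> i \<in> P \<and> k \<in> P \<and> j \<in> Q \<and> l \<in> Q))"

definition covers :: "nat set \<Rightarrow> nat set \<Rightarrow> bool" where
  "covers P' P \<longleftrightarrow> (\<exists>i\<in>P'. \<exists>j\<in>P'. \<forall>k\<in>P. i < k \<and> k < j)"

definition inner_blocks :: "nat set set \<Rightarrow> nat set set" where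
  "inner_blocks \<sigma> = {P \<in> \<sigma>. \<exists>P'\<in>\<sigma>. covers P' P}"

definition outer_blocks :: "nat set set \<Rightarrow> nat set set" where
  "outer_blocks \<sigma> = \<sigma> - inner_blocks \<sigma>"

definition monotone_partitions :: "nat \<Rightarrow> nat set list set" where
  "monotone_partitions n = {\<pi>. ordered_set_partition n \<pi> \<and> noncrossing (set \<pi>) \<and>
     (\<forall>i<length \<pi>. \<forall>j<length \<pi>. covers (\<pi> ! i) (\<pi> ! j) \<longrightarrow> i < j)}"

definition antimonotone_partitions :: "nat \<Rightarrow> nat set list set" where
  "antimonotone_partitions n = {\<pi>. ordered_set_partition n \<pi> \<and> noncrossing (set \<pi>) \<and>
     (\<forall>i<length \<pi>. \<forall>j<length \<pi>. covers (\<pi> ! i) (\<pi> ! j) \<longrightarrow> j < i)}"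

definition interval_partitions :: "nat \<Rightarrow> nat set set set" where
  "interval_partitions n = {\<sigma>. partition_on {..<n} \<sigma> \<and> (\<forall>P\<in>\<sigma>. \<exists>a b. P = {a..b})}"

end

(* All functionals are computed on words of labelled letters.  Reading a word of an alpha-free product
   from the left and centering every letter as soon as the next label shows whether it is a peak, a
   bottom or neither gives an explicit evaluation that respects the relations of the free product;
   this proves existence, and centering also proves uniqueness.  With the delta functional in the
   third place, the evaluation satisfies the c-monotone rule for letters of A, hence for whole blocks
   of larger labels.  Since all copies are identical, reversing the labels turns antimonotone into
   monotone, and psi = 0 turns c-monotone into Boolean, so only the c-monotone case is needed.

   Let X_N(a) be the c-monotone moment of the N-fold sums.  Splitting N + M labels into the lower N
   and the upper M and applying the block rule shows that X_N is polynomial in N; the terms linear in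
   M give the differential equation
     X'(a) = sum over a = u p x, p nonempty, of k(p) X(u) X(x) + kappa(p) (X(u x) - X(u) X(x)),
   where k and kappa are the c-monotone and monotone cumulants.  The sum over monotone partitions,
   weighted by t^|pi| / |pi|!, satisfies the same equation in t: its last block is an interval, which
   is outer if and only if no other block straddles it, and then the blocks on its two sides are
   arbitrarily shuffled.  At t = 1 this is the moment formula. *)

theory Submission
  imports Defs "HOL-Combinatorics.Multiset_Permutations"
begin

section \<open>An evaluation of words in the free product\<close>

text \<open>The products are given by definite descriptions on quotient algebras, so nothing can be
  computed before a model on words exists. The delicate relation is the one identifying the units of
  the copies.

  The delta functional produces the c-monotone rule because it is multiplicative and kills the
  original algebra: a bottom is never corrected, and once such a letter is pushed on a larger label,
  the evaluation is 0.

  Polynomiality has to precede the differential equation, since the cumulants are coefficients of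
  the polynomials. It comes from adding a single label: the difference of consecutive moments
  involves shorter tuples only. In the equation itself, every maximal run of upper labels carries a
  factor that vanishes at M = 0, so the linear term sees exactly one run. On the side of partitions,
  differentiation deletes the last block, and the number of shuffles of r and s blocks turns 1/(r +
  s)! into 1/(r! s!).\<close>

interpretation cscale: vector_space "cscale :: complex \<Rightarrow> 'a \<Rightarrow> 'a::complex_algebra"
  by (rule vector_space_cscale)

lemma vector_space_complex: "vector_space ((*) :: complex \<Rightarrow> complex \<Rightarrow> complex)"
  by unfold_locales (simp_all add: algebra_simps)

lemma clinearI:
  assumes "\<And>x c y. f (x + c *\<^sub>C y) = f x + c * f y"
  shows "clinear f"
proof -
  have add: "f (x + y) = f x + f y" for x y
    using assms[of x 1 y] by simp
  from add[of 0 0] have "f 0 = 0" by simp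
  then have "f (c *\<^sub>C x) = c * f x" for c x
    using assms[of 0 c x] by simp
  with add show ?thesis
    by (simp add: Vector_Spaces.linear_def module_hom_def module_hom_axioms_def vector_space_cscale
        vector_space_complex module_iff_vector_space)
qed

lemma
  assumes "clinear f"
  shows clinear_add: "f (x + y) = f x + f y"
    and clinear_scale: "f (c *\<^sub>C x) = c * f x"
    and clinear_zero: "f 0 = 0"
    and clinear_diff: "f (x - y) = f x - f y"
    and clinear_sum: "f (sum h A) = (\<Sum>i\<in>A. f (h i))"
proof -
  interpret Vector_Spaces.linear cscale "(*)" f by fact
  show "f (x + y) = f x + f y" by (rule add)
  show "f (c *\<^sub>C x) = c * f x" by (rule scale)
  show "f 0 = 0" by (rule zero)
  show "f (x - y) = f x - f y" by (rule diff)
  show "f (sum h A) = (\<Sum>i\<in>A. f (h i))" by (rule sum)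
qed

lemma clinear_comb: "clinear f \<Longrightarrow> f (x + c *\<^sub>C y) = f x + c * f y"
  by (simp add: clinear_add clinear_scale)

text \<open>A word is evaluated letter by letter.  The state is the part already read, its last letter
  first, with all its other letters centered.  When the label \<open>i\<close> arrives after \<open>j\<close>, the type of the
  letter labelled \<open>j\<close> is known: \<open>corrector\<close> is the functional with respect to which it has to be
  centered.\<close>

definition corrector ::
  "('i \<Rightarrow> 'i \<Rightarrow> bool) \<Rightarrow> ('b \<Rightarrow> complex) \<Rightarrow> ('b \<Rightarrow> complex) \<Rightarrow> ('b \<Rightarrow> complex) \<Rightarrow>
    ('i \<times> 'b) list \<Rightarrow> 'i \<Rightarrow> 'i \<Rightarrow> 'b \<Rightarrow> complex" where
  "corrector lt \<phi> \<psi> \<theta> st j i = (case st of [] \<Rightarrow> \<phi> | (k, _) # _ \<Rightarrow>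
     if lt k j \<and> lt i j then \<psi> else if lt j k \<and> lt j i then \<theta> else (\<lambda>_. 0))"

fun alpha_eval ::
  "('i \<Rightarrow> 'i \<Rightarrow> bool) \<Rightarrow> ('b::complex_algebra_1 \<Rightarrow> complex) \<Rightarrow> ('b \<Rightarrow> complex) \<Rightarrow> ('b \<Rightarrow> complex) \<Rightarrow>
    ('i \<times> 'b) list \<Rightarrow> ('i \<times> 'b) list \<Rightarrow> complex" where
  "alpha_eval lt \<phi> \<psi> \<theta> [] [] = 1"
| "alpha_eval lt \<phi> \<psi> \<theta> [(j, y)] [] = \<phi> y"
| "alpha_eval lt \<phi> \<psi> \<theta> (s # t # st) [] = 0"
| "alpha_eval lt \<phi> \<psi> \<theta> [] ((i, c) # w) = alpha_eval lt \<phi> \<psi> \<theta> [(i, c)] w"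
| "alpha_eval lt \<phi> \<psi> \<theta> ((j, y) # st) ((i, c) # w) =
    (if i = j then alpha_eval lt \<phi> \<psi> \<theta> ((j, y * c) # st) w
     else alpha_eval lt \<phi> \<psi> \<theta> ((i, c) # (j, y - corrector lt \<phi> \<psi> \<theta> st j i y *\<^sub>C 1) # st) w
       + corrector lt \<phi> \<psi> \<theta> st j i y * alpha_eval lt \<phi> \<psi> \<theta> st ((i, c) # w))"

text \<open>An invariant of the states reached from the empty one: neighbouring labels differ, and
  every letter below the top is centered for its type. The top letter is free because its right
  neighbour is still unknown.\<close>

fun good_state ::
  "('i \<Rightarrow> 'i \<Rightarrow> bool) \<Rightarrow> ('b::complex_algebra_1 \<Rightarrow> complex) \<Rightarrow> ('b \<Rightarrow> complex) \<Rightarrow> ('b \<Rightarrow> complex) \<Rightarrow>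
    ('i \<times> 'b) list \<Rightarrow> bool" where
  "good_state lt \<phi> \<psi> \<theta> ((i, c) # (j, y) # st) \<longleftrightarrow>
     i \<noteq> j \<and> corrector lt \<phi> \<psi> \<theta> st j i y = 0 \<and> good_state lt \<phi> \<psi> \<theta> ((j, y) # st)"
| "good_state lt \<phi> \<psi> \<theta> _ \<longleftrightarrow> True"

lemma corrector_cong:
  "map fst st = map fst st' \<Longrightarrow> corrector lt \<phi> \<psi> \<theta> st = corrector lt \<phi> \<psi> \<theta> st'"
  by (cases st; cases st') (auto simp: corrector_def fun_eq_iff)

locale alpha_data =
  fixes lt :: "'i \<Rightarrow> 'i \<Rightarrow> bool" and \<phi> \<psi> \<theta> :: "'b::complex_algebra_1 \<Rightarrow> complex"
  assumes lt_irrefl: "\<not> lt i i" and lt_trans: "lt i j \<Longrightarrow> lt j k \<Longrightarrow> lt i k"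
    and lt_total: "i \<noteq> j \<Longrightarrow> lt i j \<or> lt j i"
    and unital: "unital_functional \<phi>" "unital_functional \<psi>" "unital_functional \<theta>"
begin

abbreviation "ev \<equiv> alpha_eval lt \<phi> \<psi> \<theta>"
abbreviation "cor \<equiv> corrector lt \<phi> \<psi> \<theta>"
abbreviation "good \<equiv> good_state lt \<phi> \<psi> \<theta>"

lemma linear: "clinear \<phi>" "clinear \<psi>" "clinear \<theta>" and one: "\<phi> 1 = 1" "\<psi> 1 = 1" "\<theta> 1 = 1"
  using unital by (simp_all add: unital_functional_def)

lemma clinear_cor: "clinear (cor st j i)"
proof -
  have "clinear (\<lambda>_::'b. 0)" by (rule clinearI) simp
  then show ?thesis using linear by (auto simp: corrector_def split: list.split)
qed

lemma cor_centered: "cor st j i (y - cor st j i y *\<^sub>C 1) = 0"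
  by (subst clinear_diff[OF clinear_cor], subst clinear_scale[OF clinear_cor])
    (auto simp: corrector_def one split: list.split)

text \<open>The induction is lexicographic, because the correction term of \<open>alpha_eval\<close>
  shortens the state but keeps the word. Correctors depend only on the labels of the state, so a
  letter below the top does not enter the coefficients, and the top letter enters them
  linearly.\<close>

lemma ev_linear_state:
  "ev (s1 @ (j, x + c *\<^sub>C y) # s2) w = ev (s1 @ (j, x) # s2) w + c * ev (s1 @ (j, y) # s2) w"
proof (induction "(w, s1)" arbitrary: w s1 s2 x y j
    rule: wf_induct_rule[OF wf_lex_prod[OF wf_measure[of length] wf_measure[of length]]])
  case (1 w s1)
  note IH = 1[rule_format]
  show ?case
  proof (cases w)
    case Nil
    show ?thesis
    proof (cases s1)
      case Nil then show ?thesis using \<open>w = []\<close>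
        by (cases s2) (auto simp: clinear_comb[OF linear(1)])
    next
      case (Cons a s1')
      then show ?thesis using \<open>w = []\<close> by (cases s1'; cases a) auto
    qed
  next
    case (Cons ic w')
    obtain i d where ic: "ic = (i, d)" by (cases ic)
    show ?thesis
    proof (cases s1)
      case Nil
      have eq: "(x + c *\<^sub>C y) - cor s2 j i (x + c *\<^sub>C y) *\<^sub>C 1 =
          (x - cor s2 j i x *\<^sub>C 1) + c *\<^sub>C (y - cor s2 j i y *\<^sub>C 1)"
        by (simp add: clinear_comb[OF clinear_cor] cscale.scale_left_distrib
            cscale.scale_right_diff_distrib)
      have "ev ([(i,d)] @ (j, (x - cor s2 j i x *\<^sub>C 1) + c *\<^sub>C (y - cor s2 j i y *\<^sub>C 1)) # s2) w' =
          ev ([(i,d)] @ (j, x - cor s2 j i x *\<^sub>C 1) # s2) w'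
          + c * ev ([(i,d)] @ (j, y - cor s2 j i y *\<^sub>C 1) # s2) w'"
        by (rule IH) (simp add: Cons)
      moreover have "ev ([] @ (j, x * d + c *\<^sub>C (y * d)) # s2) w' =
          ev ([] @ (j, x * d) # s2) w' + c * ev ([] @ (j, y * d) # s2) w'"
        by (rule IH) (simp add: Cons)
      ultimately show ?thesis using Nil Cons ic
        by (simp add: eq clinear_comb[OF clinear_cor] distrib_right cscale_mult_left algebra_simps)
    next
      case (Cons kz s1')
      obtain k z where kz: "kz = (k, z)" by (cases kz)
      have c: "cor (s1' @ (j, x + c *\<^sub>C y) # s2) k i = cor (s1' @ (j, x) # s2) k i"
        "cor (s1' @ (j, y) # s2) k i = cor (s1' @ (j, x) # s2) k i"
        by (simp_all add: corrector_cong[THEN fun_cong, THEN fun_cong])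
      let ?z = "z - cor (s1' @ (j, x) # s2) k i z *\<^sub>C 1"
      have "ev (((i,d) # (k, ?z) # s1') @ (j, x + c *\<^sub>C y) # s2) w' =
          ev (((i,d) # (k, ?z) # s1') @ (j, x) # s2) w'
          + c * ev (((i,d) # (k, ?z) # s1') @ (j, y) # s2) w'"
        by (rule IH) (simp add: \<open>w = ic # w'\<close>)
      moreover have "ev (((k, z * d) # s1') @ (j, x + c *\<^sub>C y) # s2) w' =
          ev (((k, z * d) # s1') @ (j, x) # s2) w' + c * ev (((k, z * d) # s1') @ (j, y) # s2) w'"
        by (rule IH) (simp add: \<open>w = ic # w'\<close>)
      moreover have "ev (s1' @ (j, x + c *\<^sub>C y) # s2) w =
          ev (s1' @ (j, x) # s2) w + c * ev (s1' @ (j, y) # s2) w"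
        by (rule IH) (simp add: Cons)
      ultimately show ?thesis using Cons \<open>w = ic # w'\<close> ic kz
        by (simp add: c algebra_simps)
    qed
  qed
qed

lemma ev_linear_top:
  "ev ((j, x + c *\<^sub>C y) # s) w = ev ((j, x) # s) w + c * ev ((j, y) # s) w"
  using ev_linear_state[of "[]"] by simp

lemma ev_zero_state: "ev (s1 @ (j, 0) # s2) w = 0"
  using ev_linear_state[of s1 j 0 1 0 s2 w] by simp

lemma ev_linear_word:
  "ev st (w1 @ (i, x + c *\<^sub>C y) # w2) = ev st (w1 @ (i, x) # w2) + c * ev st (w1 @ (i, y) # w2)"
proof (induction "(w1, st)" arbitrary: w1 st
    rule: wf_induct_rule[OF wf_lex_prod[OF wf_measure[of length] wf_measure[of length]]])
  case (1 w1 st)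
  note IH = 1[rule_format]
  show ?case
  proof (cases st)
    case Nil
    show ?thesis
    proof (cases w1)
      case Nil
      then show ?thesis using \<open>st = []\<close> by (simp add: ev_linear_top)
    next
      case (Cons a w1')
      then show ?thesis using \<open>st = []\<close> IH[of w1' "[a]"] by (cases a) simp
    qed
  next
    case (Cons jz st')
    obtain j z where jz: "jz = (j, z)" by (cases jz)
    have IH2: "ev st' (w1 @ (i, x + c *\<^sub>C y) # w2) =
        ev st' (w1 @ (i, x) # w2) + c * ev st' (w1 @ (i, y) # w2)"
      by (rule IH) (simp add: Cons)
    show ?thesis
    proof (cases w1)
      case Nil
      then show ?thesis using Cons jz IH2
        by (simp add: ev_linear_top distrib_left cscale_mult_right algebra_simps)
    next
      case (Cons a w1')
      obtain k d where a: "a = (k, d)" by (cases a)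
      have IH3: "ev s (w1' @ (i, x + c *\<^sub>C y) # w2) =
        ev s (w1' @ (i, x) # w2) + c * ev s (w1' @ (i, y) # w2)" for s
        by (rule IH) (simp add: Cons)
      show ?thesis using Cons \<open>st = jz # st'\<close> jz a IH2
        by (simp add: IH3 algebra_simps)
    qed
  qed
qed

text \<open>Evaluation reads from the left and stays within good states, so tails that agree from
  every good state may be exchanged behind any prefix. Each relation of the free product then needs
  checking only at the front of a word.\<close>

lemma ev_context:
  assumes "\<And>st. good st \<Longrightarrow> ev st v = ev st v'" and "good st"
  shows "ev st (w @ v) = ev st (w @ v')"
  using assms(2)
proof (induction "(w, st)" arbitrary: w st
    rule: wf_induct_rule[OF wf_lex_prod[OF wf_measure[of length] wf_measure[of length]]])
  case (1 w st)
  note IH = 1(1)[rule_format]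
  show ?case
  proof (cases w)
    case Nil
    then show ?thesis using assms(1) 1(2) by simp
  next
    case (Cons a w')
    obtain k d where a: "a = (k, d)" by (cases a)
    show ?thesis
    proof (cases st)
      case Nil
      then show ?thesis using IH[of w' "[a]"] Cons a by simp
    next
      case (Cons jz st')
      obtain j z where jz: "jz = (j, z)" by (cases jz)
      have "good st'" and "good ((j, y) # st')" for y
        using 1(2) Cons jz by (cases st'; auto)+
      then have "ev ((j, z * d) # st') (w' @ v) = ev ((j, z * d) # st') (w' @ v')"
        and "k \<noteq> j \<Longrightarrow> ev ((k, d) # (j, z - cor st' j k z *\<^sub>C 1) # st') (w' @ v) =
          ev ((k, d) # (j, z - cor st' j k z *\<^sub>C 1) # st') (w' @ v')"
        using Cons \<open>w = a # w'\<close> by (auto intro!: IH simp: cor_centered)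
      moreover have "ev st' (w @ v) = ev st' (w @ v')"
        using Cons \<open>good st'\<close> by (intro IH) simp_all
      ultimately show ?thesis using Cons \<open>w = a # w'\<close> a jz by simp
    qed
  qed
qed

lemma ev_mult:
  assumes "good st"
  shows "ev st (w1 @ (i, a) # (i, b) # w2) = ev st (w1 @ (i, a * b) # w2)"
proof (rule ev_context[OF _ assms])
  fix st
  show "ev st ((i, a) # (i, b) # w2) = ev st ((i, a * b) # w2)"
    by (induction st) (auto simp: mult.assoc)
qed

text \<open>If \<open>j\<close> lies strictly between \<open>k\<close> and \<open>i\<close>, then
  \<open>k\<close> and \<open>i\<close> see each other on the same side as they see
  \<open>j\<close>; dropping \<open>j\<close> changes the type of neither.\<close>

lemma cor_slope:
  assumes "lt k j \<and> lt j i \<or> lt j k \<and> lt i j"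
  shows "cor st k i = cor st k j" and "cor ((j, x) # st) i m = cor ((k, y) # st') i m"
proof -
  have "lt k i = lt k j" "lt i k = lt j k" "lt i j = lt i k" "lt j i = lt k i"
    using assms lt_irrefl lt_trans by blast+
  then show "cor st k i = cor st k j" "cor ((j, x) # st) i m = cor ((k, y) # st') i m"
    by (auto simp: corrector_def split: list.splits)
qed

text \<open>A letter \<open>1\<close> may be deleted from the top of a state, and also below the top if its label lies
  strictly between the neighbouring ones, since then the deletion changes no other letter's type.\<close>

lemma ev_one_state:
  assumes "good (A @ (j, 1) # B)"
    and "A \<noteq> [] \<Longrightarrow> B \<noteq> [] \<and> (let i = fst (last A); k = fst (hd B) in
      lt k j \<and> lt j i \<or> lt j k \<and> lt i j)"
  shows "ev (A @ (j, 1) # B) w = ev (A @ B) w"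
  using assms
proof (induction "(w, A)" arbitrary: w A B j
    rule: wf_induct_rule[OF wf_lex_prod[OF wf_measure[of length] wf_measure[of length]]])
  case (1 w A B j)
  note IH = 1(1)[rule_format] and good = 1(2) and slope = 1(3)
  show ?case
  proof (cases A)
    case A: Nil
    show ?thesis
    proof (cases B)
      case Nil
      then show ?thesis using A
      proof (cases w)
        case (Cons a w')
        then show ?thesis using Nil A ev_zero_state[of "[a]" j "[]"] one
          by (cases a) (simp add: corrector_def)
      qed (simp add: one)
    next
      case (Cons kz B')
      obtain k z where kz: "kz = (k, z)" by (cases kz)
      have g: "k \<noteq> j" "cor B' k j z = 0" "good ((k, z) # B')"
        using good A Cons kz by auto
      show ?thesis
      proof (cases w)
        case Nil
        \<comment> \<open>Both sides are 0: for empty \<open>B'\<close> the invariant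
          \<open>good\<close> says that \<open>z\<close> is centered for \<phi>.\<close>
        then show ?thesis using A Cons kz g by (cases B') (auto simp: corrector_def)
      next
        case (Cons a w')
        obtain i c where a: "a = (i, c)" by (cases a)
        show ?thesis
        proof (cases "i = j")
          case True
          then show ?thesis using Cons a A \<open>B = kz # B'\<close> kz g by simp
        next
          case False
          show ?thesis
          proof (cases "lt k j \<and> lt j i \<or> lt j k \<and> lt i j")
            case True
            \<comment> \<open>On a slope the letter 1 is not centered; it stays below the new top,
              where the induction hypothesis removes it.\<close>
            have "cor B' k i = cor B' k j" by (rule cor_slope(1)[OF True])
            then have "cor B' k i z = 0" using g by simp
            moreover have "i \<noteq> k" using True lt_irrefl lt_trans by blast
            moreover have "cor ((k, z) # B') j i = (\<lambda>_. 0)"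
              using True lt_irrefl lt_trans by (auto simp: corrector_def fun_eq_iff)
            moreover have "ev ([(i, c)] @ (j, 1) # (k, z) # B') w' = ev ([(i, c)] @ (k, z) # B') w'"
              using True g False calculation by (intro IH) (auto simp: Cons Let_def)
            ultimately show ?thesis using Cons a A \<open>B = kz # B'\<close> kz False by simp
          next
            case F2: False
            then have "lt k j \<and> lt i j \<or> lt j k \<and> lt j i"
              using lt_total g(1) False by blast
            \<comment> \<open>At a peak or a bottom the corrector is unital: the centered letter is
              0, and the correction term has coefficient 1.\<close>
            then have "cor ((k, z) # B') j i 1 = 1"
              using one by (auto simp: corrector_def)
            then show ?thesis using Cons a A \<open>B = kz # B'\<close> kz False
              ev_zero_state[of "[(i,c)]" j "(k,z) # B'" w'] by simp
          qed
        qed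
      qed
    qed
  next
    case (Cons iz A')
    obtain i z where iz: "iz = (i, z)" by (cases iz)
    have B: "B \<noteq> []" using slope Cons by simp
    obtain k y B' where B': "B = (k, y) # B'" using B by (cases B) auto
    have sl: "A' = [] \<Longrightarrow> lt k j \<and> lt j i \<or> lt j k \<and> lt i j" using slope Cons iz B' by simp
    have g: "good ((i, x) # A' @ (j, 1) # B)" for x using good Cons iz by (cases A') auto
    have g': "good (A' @ (j, 1) # B)" using good Cons iz by (cases A') auto
    show ?thesis
    proof (cases w)
      case Nil
      then show ?thesis using Cons iz B' by (cases A') auto
    next
      case (Cons a w')
      obtain m c where a: "a = (m, c)" by (cases a)
      have "cor (A' @ (j, 1) # B) i m = cor (A' @ B) i m"
      proof (cases A')
        case Nil
        then show ?thesis using cor_slope(2)[OF sl] B' by simp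
      next
        case (Cons b A'')
        then show ?thesis by (cases b) (simp add: corrector_def)
      qed
      then have cor: "cor (A' @ (j, 1) # B) i m z = cor (A' @ B) i m z" by simp
      let ?z = "z - cor (A' @ (j, 1) # B) i m z *\<^sub>C 1"
      \<comment> \<open>Pushing letters on the top or merging into it keeps the label of the last
        letter of \<open>A\<close>, hence the slope condition.\<close>
      have *: "B \<noteq> [] \<and> (let l = fst (last (s @ (i, x) # A')); k = fst (hd B)
          in lt k j \<and> lt j l \<or> lt j k \<and> lt l j)" for s x
        using slope \<open>A = iz # A'\<close> iz B' by (cases A') (auto simp: Let_def)
      have "ev (((i, z * c) # A') @ (j, 1) # B) w' = ev (((i, z * c) # A') @ B) w'"
        using *[of "[]"] g by (intro IH) (auto simp: Cons)
      moreover have "ev (((m, c) # (i, ?z) # A') @ (j, 1) # B) w' = ev (((m, c) # (i, ?z) # A') @ B) w'"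
        if "m \<noteq> i"
        using *[of "[(m,c)]"] g that cor_centered[of "A' @ (j, 1) # B"] by (intro IH) (auto simp: Cons)
      moreover have "ev (A' @ (j, 1) # B) w = ev (A' @ B) w"
        using *[of "[]"] g' by (intro IH) (auto simp: \<open>A = iz # A'\<close> split: if_splits)
      ultimately show ?thesis using Cons a iz \<open>A = iz # A'\<close> cor by simp
    qed
  qed
qed

lemma ev_one:
  assumes "good st"
  shows "ev st (w1 @ (i, 1) # w2) = ev st (w1 @ w2)"
proof (rule ev_context[OF _ assms])
  fix st assume "good st"
  then show "ev st ((i, 1) # w2) = ev st w2"
  proof (induction st)
    case Nil
    then show ?case using ev_one_state[of "[]" i "[]"] by simp
  next
    case (Cons jy st)
    obtain j y where jy: "jy = (j, y)" by (cases jy)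
    show ?case
    proof (cases "i = j")
      case False
      let ?y = "y - cor st j i y *\<^sub>C 1"
      have g: "good st" "\<And>x. good ((j, x) # st)" using Cons jy by (cases st; auto)+
      \<comment> \<open>Splitting the top letter into its centered part and a multiple of 1
        reproduces the two terms of \<open>alpha_eval\<close> for the label
        \<open>i\<close>.\<close>
      have "ev ((j, y) # st) w2 = ev ((j, ?y + cor st j i y *\<^sub>C 1) # st) w2" by simp
      also have "\<dots> = ev ((j, ?y) # st) w2 + cor st j i y * ev ((j, 1) # st) w2"
        by (rule ev_linear_top)
      also have "ev ((j, 1) # st) w2 = ev st w2"
        using ev_one_state[of "[]" j st] g by simp
      also have "ev ((j, ?y) # st) w2 = ev ((i, 1) # (j, ?y) # st) w2"
        using ev_one_state[of "[]" i "(j, ?y) # st"] g False by (simp add: cor_centered)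
      finally show ?thesis using Cons.IH g False jy by simp
    qed (simp add: jy)
  qed
qed

end

section \<open>Functionals on free products\<close>

text \<open>A type depends on both neighbours, so the induction keeps the letters already read:
  \<open>rev st @ w\<close> is the whole word, and the position functional of the top of the state
  is its corrector. As all corrections vanish, the letters merely pile up; a final state of two or
  more letters has value 0, and a single letter is centered for \<phi>.\<close>

lemma alpha_eval_centered:
  fixes \<phi> \<psi> \<theta> :: "'b::complex_algebra_1 \<Rightarrow> complex" and st w :: "('i::linorder \<times> 'b) list"
  assumes "distinct_adj (map fst (rev st @ w))" and "st \<noteq> [] \<or> w \<noteq> []"
    and "\<forall>k<length (rev st @ w). position_functional (\<lambda>_. \<phi>) (\<lambda>_. \<psi>) (\<lambda>_. \<theta>) (map fst (rev st @ w)) k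
      (snd ((rev st @ w) ! k)) = 0"
  shows "alpha_eval (<) \<phi> \<psi> \<theta> st w = 0"
  using assms
proof (induction w arbitrary: st)
  case Nil
  show ?case
  proof (cases st)
    case (Cons a st')
    then show ?thesis using Nil
      by (cases a; cases st') (auto simp: position_functional_def)
  qed (use Nil in auto)
next
  case (Cons ic w)
  obtain i c where ic: "ic = (i, c)" by (cases ic)
  show ?case
  proof (cases st)
    case Nil
    then show ?thesis using Cons.IH[of "[ic]"] Cons.prems ic by simp
  next
    case st: (Cons jy st')
    obtain j y where jy: "jy = (j, y)" by (cases jy)
    let ?L = "rev st @ ic # w"
    have "i \<noteq> j" using Cons.prems(1) st jy ic by (auto simp: distinct_adj_append_iff distinct_adj_Cons)
    have "position_functional (\<lambda>_. \<phi>) (\<lambda>_. \<psi>) (\<lambda>_. \<theta>) (map fst ?L) (length st')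
      (snd (?L ! length st')) = 0"
      using Cons.prems(3) st by auto
    moreover have "?L ! length st' = (j, y)" by (simp add: st jy nth_append)
    moreover have "position_functional (\<lambda>_. \<phi>) (\<lambda>_. \<psi>) (\<lambda>_. \<theta>) (map fst ?L) (length st') =
      corrector (<) \<phi> \<psi> \<theta> st' j i"
    proof (cases st')
      case Nil
      then show ?thesis by (simp add: corrector_def position_functional_def)
    next
      case (Cons kz st'')
      obtain k z where "kz = (k, z)" by (cases kz)
      then show ?thesis using st Cons jy ic
        by (auto simp: corrector_def position_functional_def Peak_def Bot_def nth_append)
    qed
    ultimately have c: "corrector (<) \<phi> \<psi> \<theta> st' j i y = 0" by simp
    have "alpha_eval (<) \<phi> \<psi> \<theta> (ic # st) w = 0"
      using Cons.prems by (intro Cons.IH) simp_all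
    then show ?thesis using st jy ic c \<open>i \<noteq> j\<close> by simp
  qed
qed

section \<open>Linear functionals on the free algebra and its unital quotient\<close>

definition free_linear :: "('g list \<Rightarrow> complex) \<Rightarrow> 'g free_algebra \<Rightarrow> complex" where
  "free_linear f x = (\<Sum>w\<in>Poly_Mapping.keys x. Poly_Mapping.lookup x w * f w)"

lemma free_linear_superset:
  "finite K \<Longrightarrow> Poly_Mapping.keys x \<subseteq> K \<Longrightarrow>
    free_linear f x = (\<Sum>w\<in>K. Poly_Mapping.lookup x w * f w)"
  unfolding free_linear_def by (rule sum.mono_neutral_left) (auto simp: in_keys_iff)

lemma free_linear_add: "free_linear f (x + y) = free_linear f x + free_linear f y"
proof -
  let ?K = "Poly_Mapping.keys x \<union> Poly_Mapping.keys y"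
  have "Poly_Mapping.keys (x + y) \<subseteq> ?K" by (rule Poly_Mapping.keys_add)
  then show ?thesis
    by (simp add: free_linear_superset[where K = ?K] lookup_add distrib_right sum.distrib)
qed

lemma free_linear_single: "free_linear f (Poly_Mapping.single w c) = c * f w"
  by (simp add: free_linear_def)

lemma free_linear_uminus: "free_linear f (- x) = - free_linear f x"
  by (simp add: free_linear_def sum_negf)

lemma free_linear_zero: "free_linear f 0 = 0"
  by (simp add: free_linear_def)

lemma free_linear_diff: "free_linear f (x - y) = free_linear f x - free_linear f y"
  using free_linear_add[of f x "- y"] by (simp add: free_linear_uminus)

lemma free_algebra_sum:
  "(x :: 'g free_algebra) = (\<Sum>w\<in>Poly_Mapping.keys x. Poly_Mapping.single w (Poly_Mapping.lookup x w))"
  by (rule poly_mapping_eqI) (auto simp: lookup_sum lookup_single when_def in_keys_iff)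

lemma free_algebra_induct [case_names zero single add]:
  fixes x :: "'g free_algebra"
  assumes "P 0" "\<And>w c. P (Poly_Mapping.single w c)" "\<And>x y. P x \<Longrightarrow> P y \<Longrightarrow> P (x + y)"
  shows "P x"
proof -
  have "P (\<Sum>w\<in>K. Poly_Mapping.single w (Poly_Mapping.lookup x w))" if "finite K" for K
    using that by (induction K rule: finite_induct) (auto intro: assms)
  then show ?thesis by (subst free_algebra_sum) simp
qed

lemma free_linear_mult_single:
  "free_linear f (Poly_Mapping.single p c * x) = c * free_linear (\<lambda>w. f (p @ w)) x"
  "free_linear f (x * Poly_Mapping.single p c) = c * free_linear (\<lambda>w. f (w @ p)) x"
  by (induction x rule: free_algebra_induct)
    (simp_all add: free_linear_zero free_linear_single free_linear_add mult_single distrib_left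
      distrib_right plus_list_def)

text \<open>By linearity the outer factors of \<open>u * s * v\<close> may be taken to be words, so
  it suffices that every generator is annihilated inside every word.\<close>

lemma free_linear_ideal:
  assumes "\<And>s p q. s \<in> S \<Longrightarrow> free_linear (\<lambda>w. f (p @ w @ q)) s = 0"
    and "x \<in> generated_ideal S"
  shows "free_linear f x = 0"
proof -
  have "free_linear (\<lambda>w. f (p @ w @ q)) (u * s * v) = 0" if "s \<in> S" for s u v p q
  proof (induction u arbitrary: p rule: free_algebra_induct)
    case (single w c)
    show ?case
    proof (induction v arbitrary: q rule: free_algebra_induct)
      case (single w' c')
      have "free_linear (\<lambda>x. f ((p @ w) @ x @ (w' @ q))) s = 0" using assms(1)[OF that] .
      then show ?case by (simp add: free_linear_mult_single mult.assoc)
    qed (simp_all add: free_linear_zero free_linear_add distrib_left)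
  qed (simp_all add: free_linear_zero free_linear_add distrib_right)
  from this[of _ "[]" "[]"] have "free_linear f (u * s * v) = 0" if "s \<in> S" for s u v
    using that by simp
  with assms(2) show ?thesis
    by (induction rule: generated_ideal.induct) (auto simp: free_linear_zero free_linear_add)
qed

text \<open>The relations of the nonunital free product, read inside words: the linear extensions of
  such functions descend to the quotient. For the unital quotient, letters 1 must in addition be
  deletable.\<close>

definition compatible :: "(('i \<times> 'a::complex_algebra) list \<Rightarrow> complex) \<Rightarrow> bool" where
  "compatible f \<longleftrightarrow>
    (\<forall>p q i x c y. f (p @ (i, x + c *\<^sub>C y) # q) = f (p @ (i, x) # q) + c * f (p @ (i, y) # q)) \<and>
    (\<forall>p q i a b. f (p @ (i, a) # (i, b) # q) = f (p @ (i, a * b) # q))"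

lemma compatible_relations:
  assumes "compatible f" "s \<in> free_product_relations"
  shows "free_linear (\<lambda>w. f (p @ w @ q)) s = 0"
  using assms(2)
proof cases
  case (1 i a b)
  have "f (p @ (i, a + 1 *\<^sub>C b) # q) = f (p @ (i, a) # q) + 1 * f (p @ (i, b) # q)"
    using assms(1) unfolding compatible_def by blast
  then show ?thesis using 1
    by (simp add: free_linear_diff free_linear_add generator_def free_linear_single)
next
  case (2 i c a)
  \<comment> \<open>The instance with only zeros shows that a zero letter gives 0; this extracts
    homogeneity from the combined linearity rule.\<close>
  have "f (p @ (i, 0 + 1 *\<^sub>C 0) # q) = f (p @ (i, 0) # q) + 1 * f (p @ (i, 0) # q)"
    "f (p @ (i, 0 + c *\<^sub>C a) # q) = f (p @ (i, 0) # q) + c * f (p @ (i, a) # q)"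
    using assms(1) unfolding compatible_def by blast+
  then show ?thesis using 2
    by (simp add: free_linear_diff generator_def free_scalar_def mult_single plus_list_def
        free_linear_single)
next
  case (3 i a b)
  then show ?thesis using assms(1)
    by (simp add: free_linear_diff generator_def mult_single plus_list_def
        free_linear_single compatible_def)
qed

lemma unital_word_simps:
  "unital_word [] = 1" "unital_word ((i, a) # w) = unital_embed i a * unital_word w"
  "unital_word (u @ v) = unital_word u * unital_word v"
  by (simp_all add: unital_word_def)

lemma unital_word_abs: "unital_word w = abs_unital_free_product (Poly_Mapping.single w 1)"
proof (induction w)
  case Nil
  then show ?case
    by (simp add: unital_word_simps one_unital_free_product.abs_eq flip: single_one)
      (simp add: zero_list_def)
next
  case (Cons ia w)
  then show ?case by (cases ia)
    (simp add: unital_word_simps unital_embed.abs_eq times_unital_free_product.abs_eq generator_def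
      mult_single plus_list_def)
qed

lemma abs_unital_scalar:
  "abs_unital_free_product (Poly_Mapping.single w c) = c *\<^sub>C unital_word w"
  by (simp add: unital_word_abs cscale_unital_free_product.abs_eq free_scalar_def mult_single
      plus_list_def)

lemma unital_free_product_cases:
  obtains y where "(x :: ('i, 'b::complex_algebra_1) unital_free_product) = abs_unital_free_product y"
  by (metis Quotient_unital_free_product Quotient_abs_rep)

lemma unital_free_product_eqI:
  fixes \<Phi> \<Psi> :: "('i, 'b::complex_algebra_1) unital_free_product \<Rightarrow> complex"
  assumes "clinear \<Phi>" "clinear \<Psi>" "\<And>w. \<Phi> (unital_word w) = \<Psi> (unital_word w)"
  shows "\<Phi> = \<Psi>"
proof
  fix x :: "('i, 'b) unital_free_product"
  obtain y where x: "x = abs_unital_free_product y" by (rule unital_free_product_cases)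
  show "\<Phi> x = \<Psi> x" unfolding x
  proof (induction y rule: free_algebra_induct)
    case zero
    then show ?case using assms(1,2)
      by (simp add: clinear_zero flip: zero_unital_free_product.abs_eq)
  next
    case (single w c)
    then show ?case using assms by (simp add: abs_unital_scalar clinear_scale)
  next
    case (add x y)
    then show ?case using assms
      by (simp add: clinear_add flip: plus_unital_free_product.abs_eq)
  qed
qed

definition unital_extend ::
  "(('i \<times> 'b) list \<Rightarrow> complex) \<Rightarrow> ('i, 'b::complex_algebra_1) unital_free_product \<Rightarrow> complex" where
  "unital_extend f x = free_linear f (rep_unital_free_product x)"

lemma
  fixes f :: "('i \<times> 'b::complex_algebra_1) list \<Rightarrow> complex"
  assumes "compatible f" "\<And>p i q. f (p @ (i, 1) # q) = f (p @ q)"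
  shows unital_extend_word: "unital_extend f (unital_word w) = f w"
    and clinear_unital_extend: "clinear (unital_extend f)"
proof -
  have rel: "free_linear f x = free_linear f y" if "unital_free_product_rel x y" for x y
  proof -
    have "free_linear f (x - y) = 0"
    proof (rule free_linear_ideal)
      show "x - y \<in> generated_ideal unital_free_product_relations"
        using that by (simp add: unital_free_product_rel_def)
      show "free_linear (\<lambda>w. f (p @ w @ q)) s = 0" if "s \<in> unital_free_product_relations" for s p q
        using that compatible_relations[OF assms(1)]
        by (auto simp: unital_free_product_relations_def free_linear_diff generator_def
            free_linear_single assms(2) simp flip: single_one)
          (simp add: zero_list_def)
    qed
    then show ?thesis by (simp add: free_linear_diff)
  qed
  have abs: "unital_extend f (abs_unital_free_product x) = free_linear f x" for x
    unfolding unital_extend_def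
    by (rule rel) (metis Quotient_unital_free_product Quotient_abs_rep
        Quotient_rel_rep Quotient_rep_abs rep_abs_rsp_left unital_free_product.abs_eq_iff)
  show "unital_extend f (unital_word w) = f w"
    by (simp add: unital_word_abs abs free_linear_single)
  show "clinear (unital_extend f)"
  proof (rule clinearI)
    fix c and x y :: "('i, 'b) unital_free_product"
    obtain x' y' where "x = abs_unital_free_product x'" "y = abs_unital_free_product y'"
      by (metis unital_free_product_cases)
    then show "unital_extend f (x + c *\<^sub>C y) = unital_extend f x + c * unital_extend f y"
      by (simp add: cscale_unital_free_product.abs_eq plus_unital_free_product.abs_eq abs
          free_linear_add free_scalar_def free_linear_mult_single)
  qed
qed

lemma unital_embed_linear:
  fixes i :: 'i and x y :: "'b::complex_algebra_1"
  shows "unital_embed i (x + y) = unital_embed i x + unital_embed i y"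
  "unital_embed i (c *\<^sub>C x) = c *\<^sub>C unital_embed i x"
  "unital_embed i (x * y) = unital_embed i x * unital_embed i y"
  "unital_embed i (1 :: 'b) = 1"
proof -
  have gen: "unital_free_product_rel x y" if "x - y \<in> unital_free_product_relations"
    for x y :: "('i \<times> 'b) free_algebra"
    using generated_ideal.generator[OF that, of 1 1] by (simp add: unital_free_product_rel_def)
  show "unital_embed i (x + y) = unital_embed i x + unital_embed i y"
    by (transfer, rule gen) (auto simp: unital_free_product_relations_def intro: free_product_relations.intros)
  show "unital_embed i (c *\<^sub>C x) = c *\<^sub>C unital_embed i x"
    by (transfer, rule gen) (auto simp: unital_free_product_relations_def intro: free_product_relations.intros)
  show "unital_embed i (x * y) = unital_embed i x * unital_embed i y"
    by (transfer, rule gen) (auto simp: unital_free_product_relations_def intro: free_product_relations.intros)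
  show "unital_embed i (1 :: 'b) = 1"
    unfolding unital_embed.abs_eq one_unital_free_product.abs_eq unital_free_product.abs_eq_iff
    by (rule gen) (auto simp: unital_free_product_relations_def)
qed

lemma unital_embed_diff: "unital_embed i (x - y) = unital_embed i x - unital_embed i y"
  using unital_embed_linear(1)[of i "x - y" y] by (simp add: algebra_simps)

section \<open>Uniqueness and existence of the \<alpha>-free functional\<close>

lemma not_distinct_adjE:
  assumes "\<not> distinct_adj (map fst w)"
  obtains p i a b q where "w = p @ (i, a) # (i, b) # q"
proof -
  have "\<exists>p i a b q. w = p @ (i, a) # (i, b) # q"
    using assms
  proof (induction w)
    case (Cons x w)
    show ?case
    proof (cases "distinct_adj (map fst w)")
      case True
      then obtain y v where "w = y # v" "fst x = fst y"
        using Cons.prems by (cases w) (auto simp: distinct_adj_Cons)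
      then show ?thesis by (intro exI[of _ "[]"] exI[of _ "fst x"]) (auto simp: prod_eq_iff)
    next
      case False
      then obtain p i a b q where "w = p @ (i, a) # (i, b) # q" using Cons.IH by blast
      then show ?thesis by (metis append_Cons)
    qed
  qed simp
  then show thesis using that by blast
qed

text \<open>The difference of two candidates vanishes on words, by induction on the length:
  centering one letter changes a word by a multiple of a shorter word, and on fully centered
  alternating words both candidates vanish.\<close>

lemma alpha_functional_unique:
  fixes \<Phi> \<Phi>' :: "('i::linorder, 'b::complex_algebra_1) unital_free_product \<Rightarrow> complex"
  assumes "unital_functional \<Phi>" "unital_functional \<Phi>'"
    and unital: "\<And>i. \<chi> i 1 = 1" "\<And>i. \<psi> i 1 = 1" "\<And>i. \<theta> i 1 = 1"
    and linear: "\<And>i. clinear (\<chi> i)" "\<And>i. clinear (\<psi> i)" "\<And>i. clinear (\<theta> i)"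
    and centered: "\<And>w. alternating w \<Longrightarrow>
      \<forall>k<length w. position_functional \<chi> \<psi> \<theta> (map fst w) k (snd (w ! k)) = 0 \<Longrightarrow>
      \<Phi> (unital_word w) = 0 \<and> \<Phi>' (unital_word w) = 0"
  shows "\<Phi> = \<Phi>'"
proof -
  have lin: "clinear \<Phi>" "clinear \<Phi>'" and one: "\<Phi> 1 = 1" "\<Phi>' 1 = 1"
    using assms(1,2) by (auto simp: unital_functional_def)
  define D where "D x = \<Phi> x - \<Phi>' x" for x
  have "clinear D" unfolding D_def
    by (rule clinearI) (simp add: clinear_comb[OF lin(1)] clinear_comb[OF lin(2)] algebra_simps)
  note D = clinear_add[OF this] clinear_scale[OF this] clinear_diff[OF this]
  let ?pf = "position_functional \<chi> \<psi> \<theta>"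
  have pf: "?pf is k (a - ?pf is k a *\<^sub>C 1) = 0" for "is" k a
    using linear unital
    by (auto simp: position_functional_def clinear_diff clinear_scale)
  have "D (unital_word w) = 0" for w
  proof (induction "length w" arbitrary: w rule: less_induct)
    case less
    show ?case
    proof (cases "distinct_adj (map fst w) \<and> w \<noteq> []")
      case True
      \<comment> \<open>The first \<open>n\<close> letters are centered one by one; the labels, and
        with them the position functionals, stay those of \<open>w\<close>.\<close>
      have "\<exists>w'. map fst w' = map fst w \<and> D (unital_word w') = D (unital_word w) \<and>
          (\<forall>k<n. ?pf (map fst w) k (snd (w' ! k)) = 0)" if "n \<le> length w" for n
        using that
      proof (induction n)
        case (Suc n)
        then obtain w' where w': "map fst w' = map fst w" "D (unital_word w') = D (unital_word w)"
          "\<forall>k<n. ?pf (map fst w) k (snd (w' ! k)) = 0" by auto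
        have len: "length w' = length w" using w'(1) by (metis length_map)
        obtain i a where ia: "w' ! n = (i, a)" by (cases "w' ! n")
        define c where "c = ?pf (map fst w) n a"
        define w'' where "w'' = w'[n := (i, a - c *\<^sub>C 1)]"
        have n: "n < length w'" using Suc.prems len by simp
        have split: "w' = take n w' @ (i, a) # drop (Suc n) w'"
          using id_take_nth_drop[OF n] ia by simp
        have split': "w'' = take n w' @ (i, a - c *\<^sub>C 1) # drop (Suc n) w'"
          unfolding w''_def by (rule upd_conv_take_nth_drop[OF n])
        have "unital_word w'' = unital_word w' - c *\<^sub>C unital_word (take n w' @ drop (Suc n) w')"
          unfolding split' by (subst (3) split)
            (simp add: unital_word_simps unital_embed_diff unital_embed_linear left_diff_distrib
              right_diff_distrib cscale_mult_left cscale_mult_right)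
        moreover have "D (unital_word (take n w' @ drop (Suc n) w')) = 0"
          using n len by (intro less) simp
        ultimately have "D (unital_word w'') = D (unital_word w)" using w'(2) by (simp add: D)
        moreover have "map fst w'' = map fst w'" 
          unfolding split' by (subst (3) split) simp
        moreover have "?pf (map fst w) k (snd (w'' ! k)) = 0" if "k < Suc n" for k
          using that w'(3) n by (cases "k = n") (auto simp: w''_def c_def pf)
        ultimately show ?case using w'(1) by metis
      qed auto
      then obtain w' where w': "map fst w' = map fst w" "D (unital_word w') = D (unital_word w)"
          "\<forall>k<length w. ?pf (map fst w) k (snd (w' ! k)) = 0" by blast
      have "length w' = length w" using w'(1) by (metis length_map)
      moreover from this have "w' \<noteq> []" using True by auto
      ultimately show ?thesis using centered[of w'] w' True by (auto simp: alternating_def D_def)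
    next
      case False
      then consider "w = []" | "\<not> distinct_adj (map fst w)" by auto
      then show ?thesis
      proof cases
        case 1
        then show ?thesis using one by (simp add: D_def unital_word_simps)
      next
        case 2
        then obtain p i a b q where w: "w = p @ (i, a) # (i, b) # q" by (rule not_distinct_adjE)
        have "unital_word w = unital_word (p @ (i, a * b) # q)"
          by (simp add: w unital_word_simps unital_embed_linear mult.assoc)
        then show ?thesis using less[of "p @ (i, a * b) # q"] w by simp
      qed
    qed
  qed
  then show ?thesis by (intro unital_free_product_eqI lin) (simp add: D_def)
qed

lemma alpha_data_less:
  assumes "unital_functional \<phi>" "unital_functional \<psi>" "unital_functional \<theta>"
  shows "alpha_data ((<) :: 'i::linorder \<Rightarrow> _) \<phi> \<psi> \<theta>"
  using assms by unfold_locales auto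

lemma (in alpha_data) compatible_ev: "compatible (ev [])"
  unfolding compatible_def by (auto simp: ev_linear_word ev_mult)

theorem alpha_free_functional_word:
  fixes w :: "('i::linorder \<times> 'b::complex_algebra_1) list"
  assumes "unital_functional \<phi>" "unital_functional \<psi>" "unital_functional \<theta>"
  shows "alpha_free_functional (\<lambda>_. \<phi>) (\<lambda>_. \<psi>) (\<lambda>_. \<theta>) (unital_word w) =
      alpha_eval (<) \<phi> \<psi> \<theta> [] w"
    and "clinear (alpha_free_functional (\<lambda>_::'i. \<phi>) (\<lambda>_. \<psi>) (\<lambda>_. \<theta>))"
proof -
  interpret alpha_data "(<) :: 'i \<Rightarrow> _" \<phi> \<psi> \<theta> by (rule alpha_data_less[OF assms])
  let ?F = "unital_extend (ev [])"
  have one': "ev [] (p @ (i, 1) # q) = ev [] (p @ q)" for p i q by (rule ev_one) simp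
  note F = unital_extend_word[OF compatible_ev one'] clinear_unital_extend[OF compatible_ev one']
  have "?F 1 = 1" using F(1)[of "[]"] by (simp add: unital_word_simps)
  then have unital_F: "unital_functional ?F" using F(2) by (simp add: unital_functional_def)
  have cent: "?F (unital_word w) = 0"
    if "alternating w"
      "\<forall>k<length w. position_functional (\<lambda>_. \<phi>) (\<lambda>_. \<psi>) (\<lambda>_. \<theta>) (map fst w) k (snd (w ! k)) = 0" for w
    using that alpha_eval_centered[of "[]" w] by (simp add: F alternating_def)
  have "alpha_free_functional (\<lambda>_. \<phi>) (\<lambda>_. \<psi>) (\<lambda>_. \<theta>) = ?F"
    unfolding alpha_free_functional_def
  proof (rule the_equality)
    show "\<Phi> = ?F"
      if "unital_functional \<Phi> \<and> (\<forall>w. alternating w \<and> (\<forall>k<length w. position_functional (\<lambda>_. \<phi>)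
        (\<lambda>_. \<psi>) (\<lambda>_. \<theta>) (map fst w) k (snd (w ! k)) = 0) \<longrightarrow> \<Phi> (unital_word w) = 0)" for \<Phi>
      by (rule alpha_functional_unique[where \<chi> = "\<lambda>_. \<phi>" and \<psi> = "\<lambda>_. \<psi>" and \<theta> = "\<lambda>_. \<theta>"])
        (use that cent unital_F linear one in blast)+
  qed (use cent unital_F in blast)
  then show "alpha_free_functional (\<lambda>_. \<phi>) (\<lambda>_. \<psi>) (\<lambda>_. \<theta>) (unital_word w) = ev [] w"
    and "clinear (alpha_free_functional (\<lambda>_::'i. \<phi>) (\<lambda>_. \<psi>) (\<lambda>_. \<theta>))"
    using F by simp_all
qed

section \<open>Sums over all labellings by copies\<close>

fun label_sum :: "nat set \<Rightarrow> ((nat \<times> 'a) list \<Rightarrow> complex) \<Rightarrow> 'a list \<Rightarrow> complex" where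
  "label_sum S f [] = f []"
| "label_sum S f (a # as) = (\<Sum>j\<in>S. label_sum S (\<lambda>w. f ((j, a) # w)) as)"

lemma unital_dilation_expand:
  assumes "clinear \<Phi>"
  shows "\<Phi> (prod_list (map (unital_dilation N) as)) = label_sum {..<N} (\<lambda>w. \<Phi> (unital_word w)) as"
  using assms
proof (induction as arbitrary: \<Phi>)
  case (Cons a as)
  have "clinear (\<lambda>x. \<Phi> (unital_embed j a * x))" for j
    by (rule clinearI) (simp add: distrib_left cscale_mult_right clinear_comb[OF Cons.prems])
  from Cons.IH[OF this] show ?case
    by (simp add: unital_dilation_def sum_distrib_right clinear_sum[OF Cons.prems] unital_word_simps)
qed (simp add: unital_word_simps)

lemma alpha_cumulant_label_sum:
  assumes "unital_functional \<phi>" "unital_functional \<psi>" "unital_functional \<theta>"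
  shows "alpha_cumulant \<phi> \<psi> \<theta> as =
    linear_coefficient (\<lambda>N. label_sum {..<N} (alpha_eval (<) \<phi> \<psi> \<theta> []) as)"
  by (simp add: alpha_cumulant_def alpha_free_product_def unital_dilation_expand
      alpha_free_functional_word[OF assms])

lemma word_Cons: "w \<noteq> [] \<Longrightarrow> word ((i, a) # w) = embed i a * word w"
  by (cases w) (auto simp: word_def)

lemma word_append: "u \<noteq> [] \<Longrightarrow> v \<noteq> [] \<Longrightarrow> word (u @ v) = word u * word v"
proof (induction u)
  case (Cons a u)
  then show ?case by (cases a; cases "u = []") (auto simp: word_Cons mult.assoc word_def[of "[_]"])
qed simp

lemma dilation_expand:
  assumes "clinear \<Phi>" "as \<noteq> []"
  shows "\<Phi> (list_mult (map (dilation N) as)) = label_sum {..<N} (\<lambda>w. \<Phi> (word w)) as"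
  using assms
proof (induction as arbitrary: \<Phi>)
  case (Cons a as)
  show ?case
  proof (cases as)
    case Nil
    then show ?thesis by (simp add: dilation_def clinear_sum[OF Cons.prems(1)] word_def)
  next
    case (Cons b bs)
    have "clinear (\<lambda>x. \<Phi> (embed j a * x))" for j
      by (rule clinearI) (simp add: distrib_left cscale_mult_right clinear_comb[OF Cons.prems(1)])
    note IH = Cons.IH[OF this]
    have "(\<lambda>w. \<Phi> (embed j a * word ((i, b) # w))) = (\<lambda>w. \<Phi> (word ((j, a) # (i, b) # w)))" for i j
      by (simp add: word_Cons)
    then show ?thesis using IH Cons
      by (simp add: dilation_def sum_distrib_right clinear_sum[OF Cons.prems(1)])
  qed
qed simp

section \<open>The c-monotone rule\<close>

lemma free_product_word_abs:
  fixes w :: "('i \<times> 'a::complex_algebra) list"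
  shows "w \<noteq> [] \<Longrightarrow> word w = abs_free_product (Poly_Mapping.single w 1)"
proof (induction w)
  case (Cons ia w)
  obtain i a where ia: "ia = (i, a)" by (cases ia)
  have rel: "free_product_rel (Poly_Mapping.single v c) (Poly_Mapping.single v c)" if "v \<noteq> []"
    for v :: "('i \<times> 'a) list" and c
    using that
    by (simp add: free_product_rel_def nonunital_free_algebra_def lookup_single generated_ideal.zero)
  show ?case
  proof (cases "w = []")
    case True
    then show ?thesis by (simp add: ia word_def embed.abs_eq generator_def)
  next
    case False
    then show ?thesis using Cons.IH rel
      by (simp add: ia word_Cons embed.abs_eq generator_def times_free_product.abs_eq mult_single
          plus_list_def)
  qed
qed simp

lemma free_product_cases:
  obtains y where "y \<in> nonunital_free_algebra"
    "(x :: ('i, 'a::complex_algebra) free_product) = abs_free_product y"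
  using Quotient_free_product[THEN Quotient_rep_reflp, of x]
    Quotient_free_product[THEN Quotient_abs_rep, of x]
  by (metis free_product_rel_def)

text \<open>The quotient is partial and respects sums only of elements without constant term, so the
  induction over sets of nonempty words carries membership along with the equation.\<close>

lemma abs_free_product_sum:
  assumes "y \<in> nonunital_free_algebra"
  shows "abs_free_product y =
    (\<Sum>w\<in>Poly_Mapping.keys y. Poly_Mapping.lookup y w *\<^sub>C word w)"
proof -
  have refl: "free_product_rel x x" if "x \<in> nonunital_free_algebra"
    for x :: "('a \<times> 'b) free_algebra"
    using that by (simp add: free_product_rel_def generated_ideal.zero)
  have mem: "Poly_Mapping.single w c \<in> nonunital_free_algebra" if "w \<noteq> []"
    for w :: "('a \<times> 'b) list" and c
    using that by (simp add: nonunital_free_algebra_def lookup_single)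
  have sums: "(\<Sum>w\<in>K. Poly_Mapping.single w (c w)) \<in> nonunital_free_algebra \<and>
      abs_free_product (\<Sum>w\<in>K. Poly_Mapping.single w (c w)) = (\<Sum>w\<in>K. c w *\<^sub>C word w)"
    if "finite K" "[] \<notin> K" for K :: "('a \<times> 'b) list set" and c
    using that
  proof (induction K rule: finite_induct)
    case empty
    then show ?case by (simp add: nonunital_free_algebra_zero zero_free_product_def)
  next
    case (insert w K)
    then have "w \<noteq> []" by auto
    then have "abs_free_product (Poly_Mapping.single w (c w)) = c w *\<^sub>C word w"
      by (simp add: free_product_word_abs cscale_free_product.abs_eq refl mem
          free_scalar_def mult_single plus_list_def)
    then show ?case using insert refl mem[OF \<open>w \<noteq> []\<close>]
      by (auto simp: nonunital_free_algebra_add simp flip: plus_free_product.abs_eq)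
  qed
  have "[] \<notin> Poly_Mapping.keys y"
    using assms by (simp add: nonunital_free_algebra_def in_keys_iff)
  then have *: "abs_free_product (\<Sum>w\<in>Poly_Mapping.keys y. Poly_Mapping.single w (Poly_Mapping.lookup y w)) =
      (\<Sum>w\<in>Poly_Mapping.keys y. Poly_Mapping.lookup y w *\<^sub>C word w)"
    by (intro sums[THEN conjunct2]) simp_all
  show ?thesis by (rule trans[OF arg_cong[where f = abs_free_product, OF free_algebra_sum[of y]] *])
qed

lemma free_product_eqI:
  fixes \<Phi> \<Psi> :: "('i, 'a::complex_algebra) free_product \<Rightarrow> complex"
  assumes "clinear \<Phi>" "clinear \<Psi>" "\<And>w. w \<noteq> [] \<Longrightarrow> \<Phi> (word w) = \<Psi> (word w)"
  shows "\<Phi> = \<Psi>"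
proof
  fix x :: "('i, 'a) free_product"
  obtain y where y: "y \<in> nonunital_free_algebra" "x = abs_free_product y"
    by (rule free_product_cases)
  then have "w \<in> Poly_Mapping.keys y \<Longrightarrow> w \<noteq> []" for w
    by (auto simp: nonunital_free_algebra_def in_keys_iff)
  then show "\<Phi> x = \<Psi> x" using assms(3)
    by (simp add: y abs_free_product_sum clinear_sum[OF assms(1)] clinear_sum[OF assms(2)]
        clinear_scale[OF assms(1)] clinear_scale[OF assms(2)])
qed

lemma embed_mult:
  fixes i :: 'i and x y :: "'a::complex_algebra"
  shows "embed i (x * y) = embed i x * embed i y"
proof transfer
  fix i :: 'i and x y :: 'a
  have "1 * (generator (i, x * y) - generator (i, x) * generator (i, y)) * 1
      \<in> generated_ideal free_product_relations"
    by (intro generated_ideal.generator free_product_relations.intros)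
  then show "free_product_rel (generator (i, x * y)) (generator (i, x) * generator (i, y))"
    by (simp add: free_product_rel_def nonunital_free_algebra_def)
      (simp add: generator_def mult_single plus_list_def lookup_single)
qed

definition nonunital_extend ::
  "(('i \<times> 'a) list \<Rightarrow> complex) \<Rightarrow> ('i, 'a::complex_algebra) free_product \<Rightarrow> complex" where
  "nonunital_extend f x = free_linear f (rep_free_product x)"

lemma
  fixes f :: "('i \<times> 'a::complex_algebra) list \<Rightarrow> complex"
  assumes "compatible f"
  shows nonunital_extend_word: "w \<noteq> [] \<Longrightarrow> nonunital_extend f (word w) = f w"
    and clinear_nonunital_extend: "clinear (nonunital_extend f)"
proof -
  have rel: "free_linear f x = free_linear f y" if "free_product_rel x y" for x y
    using free_linear_ideal[OF compatible_relations[OF assms], of _ "x - y"] that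
    by (simp add: free_product_rel_def free_linear_diff)
  have refl: "free_product_rel x x" if "x \<in> nonunital_free_algebra" for x :: "('i \<times> 'a) free_algebra"
    using that by (simp add: free_product_rel_def generated_ideal.zero)
  have abs: "nonunital_extend f (abs_free_product x) = free_linear f x"
    if "x \<in> nonunital_free_algebra" for x
    unfolding nonunital_extend_def
    by (rule rel, rule Quotient_rep_abs[OF Quotient_free_product refl[OF that]])
  show "nonunital_extend f (word w) = f w" if "w \<noteq> []"
    using that by (simp add: free_product_word_abs abs free_linear_single nonunital_free_algebra_def
        lookup_single)
  show "clinear (nonunital_extend f)"
  proof (rule clinearI)
    fix c and x y :: "('i, 'a) free_product"
    obtain x' y' where mem: "x' \<in> nonunital_free_algebra" "y' \<in> nonunital_free_algebra"
      and eq: "x = abs_free_product x'" "y = abs_free_product y'"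
      by (metis free_product_cases)
    have mem': "free_scalar c * y' \<in> nonunital_free_algebra"
      using mem by (simp add: nonunital_free_algebra_mult_left)
    show "nonunital_extend f (x + c *\<^sub>C y) = nonunital_extend f x + c * nonunital_extend f y"
      using mem mem' by (simp add: eq cscale_free_product.abs_eq plus_free_product.abs_eq abs refl
          nonunital_free_algebra_add free_linear_add)
        (simp add: free_scalar_def free_linear_mult_single)
  qed
qed

section \<open>Local maxima in the evaluation with the delta functional\<close>

lemma unital_extension_unital:
  assumes "clinear \<phi>" shows "unital_functional (unital_extension \<phi>)"
  unfolding unital_functional_def
proof
  show "clinear (unital_extension \<phi>)"
    by (rule clinearI) (simp add: unital_extension_def plus_unitization_def cscale_unitization_def
        clinear_add[OF assms] clinear_scale[OF assms] distrib_left)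
  show "unital_extension \<phi> 1 = 1"
    by (simp add: unital_extension_def one_unitization_def clinear_zero[OF assms])
qed

lemma clinear_0: "clinear (\<lambda>_. 0)"
  by (rule clinearI) simp

lemma delta_functional_eq: "delta_functional = unital_extension (\<lambda>_. 0)"
  by (simp add: fun_eq_iff delta_functional_def unital_extension_def)

lemma delta_unital: "unital_functional delta_functional"
  unfolding delta_functional_eq by (rule unital_extension_unital[OF clinear_0])

lemma in_unitization_simps:
  "unital_extension \<phi> (in_unitization a) = \<phi> a" "delta_functional (in_unitization a) = 0"
  "in_unitization (a * b) = in_unitization a * in_unitization b"
  "in_unitization (a + c *\<^sub>C b) = in_unitization a + c *\<^sub>C in_unitization b"
  "delta_functional (x * y) = delta_functional x * delta_functional y"
  by (simp_all add: unital_extension_def in_unitization_def delta_functional_def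
      times_unitization_def plus_unitization_def cscale_unitization_def)

definition c_monotone_eval ::
  "('i \<Rightarrow> 'i \<Rightarrow> bool) \<Rightarrow> ('a::complex_algebra \<Rightarrow> complex) \<Rightarrow> ('a \<Rightarrow> complex) \<Rightarrow>
    ('i \<times> 'a) list \<Rightarrow> complex" where
  "c_monotone_eval lt \<phi> \<psi> w = alpha_eval lt (unital_extension \<phi>) (unital_extension \<psi>)
     delta_functional [] (map (apsnd in_unitization) w)"

lemma compatible_merge:
  assumes "compatible f" "q \<noteq> []" "\<forall>z\<in>set q. fst z = m"
  shows "f (u @ q @ x) = f (u @ (m, list_mult (map snd q)) # x)"
  using assms(2,3)
proof (induction q arbitrary: u)
  case (Cons b q)
  note IH = Cons.IH
  obtain b' where b: "b = (m, b')" using Cons.prems by (cases b) auto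
  show ?case
  proof (cases q)
    case (Cons c q')
    have "f ((u @ [b]) @ q @ x) = f ((u @ [b]) @ (m, list_mult (map snd q)) # x)"
      using \<open>\<forall>z\<in>set (b # q). fst z = m\<close> Cons by (intro IH) auto
    also have "\<dots> = f (u @ (m, b' * list_mult (map snd q)) # x)"
      using assms(1) by (simp add: compatible_def b)
    finally show ?thesis using b Cons by simp
  qed (simp add: b)
qed simp

locale c_monotone_data =
  fixes lt :: "'i \<Rightarrow> 'i \<Rightarrow> bool" and \<phi> \<psi> :: "'a::complex_algebra \<Rightarrow> complex"
  assumes lt_irrefl: "\<not> lt i i" and lt_trans: "lt i j \<Longrightarrow> lt j k \<Longrightarrow> lt i k"
    and lt_total: "i \<noteq> j \<Longrightarrow> lt i j \<or> lt j i"
    and clinear: "clinear \<phi>" and clinear': "clinear \<psi>"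
begin

sublocale alpha: alpha_data lt "unital_extension \<phi>" "unital_extension \<psi>" delta_functional
  by unfold_locales
    (fact lt_irrefl, erule (1) lt_trans, erule lt_total, rule unital_extension_unital,
      fact clinear, rule unital_extension_unital, fact clinear', rule delta_unital)

abbreviation "ev \<equiv> alpha.ev"
abbreviation "cor \<equiv> alpha.cor"
abbreviation "g \<equiv> c_monotone_eval lt \<phi> \<psi>"

lemma compatible_g: "compatible g"
  unfolding compatible_def c_monotone_eval_def
  by (auto simp: in_unitization_simps alpha.ev_linear_word alpha.ev_mult)

lemma g_Nil: "g [] = 1"
  by (simp add: c_monotone_eval_def)

text \<open>A letter of \<open>\<A>\<close> above a larger label can never be absorbed again, because every correction
  that would remove it is a multiple of its value under the delta functional.\<close>

lemma ev_peak_zero: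
  assumes "lt m i" "delta_functional c = 0" "\<forall>z\<in>set x. delta_functional (snd z) = 0"
  shows "ev (s1 @ (m, c) # (i, b) # s2) x = 0"
  using assms(2,3)
proof (induction "(x, s1)" arbitrary: x s1 c
    rule: wf_induct_rule[OF wf_lex_prod[OF wf_measure[of length] wf_measure[of length]]])
  case (1 x s1 c)
  note IH = 1(1)[rule_format]
  show ?case
  proof (cases x)
    case Nil
    then show ?thesis by (cases s1; cases "tl s1") auto
  next
    case (Cons nd x')
    obtain n d where nd: "nd = (n, d)" by (cases nd)
    show ?thesis
    proof (cases s1)
      case Nil
      have "ev ([(n, d)] @ (m, c) # (i, b) # s2) x' = 0"
        using 1(2,3) Cons by (intro IH) auto
      moreover have "ev ([] @ (m, c * d) # (i, b) # s2) x' = 0"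
        using 1(2,3) Cons nd by (intro IH) (auto simp: in_unitization_simps)
      \<comment> \<open>Having a larger left neighbour, the letter is a bottom or on a slope, never
        a peak, so its corrector is delta or 0.\<close>
      moreover have "cor ((i, b) # s2) m n c = 0"
        using assms(1) 1(2) lt_irrefl lt_trans by (auto simp: corrector_def)
      ultimately show ?thesis using Nil Cons nd by simp
    next
      case s1: (Cons kz s1')
      obtain k z where kz: "kz = (k, z)" by (cases kz)
      have "ev (((n, d) # (k, z') # s1') @ (m, c) # (i, b) # s2) x' = 0" for z'
        by (rule IH) (use 1(2,3) Cons in auto)
      moreover have "ev (((k, z * d) # s1') @ (m, c) # (i, b) # s2) x' = 0"
        by (rule IH) (use 1(2,3) Cons in auto)
      moreover have "ev (s1' @ (m, c) # (i, b) # s2) x = 0"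
        by (rule IH) (use 1(2,3) s1 in auto)
      ultimately show ?thesis using Cons nd s1 kz by simp
    qed
  qed
qed

text \<open>The factor \<open>ev st []\<close> is 1, the \<phi>-value or 0 if the state has no, one
  or more letters. It records the two fates of a local maximum: as an inner peak it leaves its
  \<psi>-value, and as the first letter, after the state has been absorbed into a number, its
  \<phi>-value.\<close>

lemma ev_letter_state:
  assumes "st = [] \<or> lt (fst (hd st)) i" "x = [] \<or> lt (fst (hd x)) i"
    and "length st \<ge> 2 \<Longrightarrow> delta_functional (snd (hd st)) = 0"
    and x: "\<forall>z\<in>set x. delta_functional (snd z) = 0"
  shows "ev st ((i, a) # x) = unital_extension \<psi> a * ev st x
    + (unital_extension \<phi> a - unital_extension \<psi> a) * ev st [] * ev [] x"
proof -
  have bottom: "ev [(i, a)] x = unital_extension \<phi> a * ev [] x"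
  proof (cases x)
    case (Cons mc x')
    obtain m c where mc: "mc = (m, c)" by (cases mc)
    have "ev ([] @ (m, c) # (i, b) # []) x' = 0" for b
      using assms(2) x Cons mc by (intro ev_peak_zero) auto
    moreover have "m \<noteq> i" using assms(2) Cons mc lt_irrefl by auto
    ultimately show ?thesis using Cons mc by (simp add: corrector_def)
  qed simp
  \<comment> \<open>If \<open>x\<close> is nonempty, its first label is below \<open>i\<close>, so
    the term with \<open>a\<close> centered vanishes by \<open>ev_peak_zero\<close> and only the
    correction survives.\<close>
  have peak: "ev ((i, a) # (j, y) # st') x = (if x = [] then 0 else unital_extension \<psi> a * ev ((j, y) # st') x)"
    if "lt j i" for j y st'
  proof (cases x)
    case (Cons mc x')
    obtain m c where mc: "mc = (m, c)" by (cases mc)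
    have "ev ([] @ (m, c) # (i, b) # (j, y) # st') x' = 0" for b
      using assms(2) x Cons mc by (intro ev_peak_zero) auto
    moreover have "m \<noteq> i" "cor ((j, y) # st') i m = unital_extension \<psi>"
      using assms(2) Cons mc lt_irrefl that by (auto simp: corrector_def)
    ultimately show ?thesis using Cons mc by simp
  qed simp
  show ?thesis
  proof (cases st)
    case Nil
    then show ?thesis using bottom by (simp add: algebra_simps)
  next
    case (Cons jy st')
    obtain j y where jy: "jy = (j, y)" by (cases jy)
    have "lt j i" using assms(1) Cons jy by simp
    then have "i \<noteq> j" using lt_irrefl by auto
    show ?thesis
    proof (cases st')
      case Nil
      let ?y = "unital_extension \<phi> y"
      \<comment> \<open>Undoing the \<phi>-centering of the only letter in the state expresses the
        centered value by \<open>ev st x\<close> and \<open>ev [] x\<close>.\<close>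
      have "ev [(j, y)] x = ev [(j, (y - ?y *\<^sub>C 1) + ?y *\<^sub>C 1)] x" by simp
      also have "\<dots> = ev [(j, y - ?y *\<^sub>C 1)] x + ?y * ev [(j, 1)] x"
        by (rule alpha.ev_linear_top)
      also have "ev [(j, 1)] x = ev [] x" using alpha.ev_one_state[of "[]" j "[]"] by simp
      finally have "ev [(j, y - ?y *\<^sub>C 1)] x = ev [(j, y)] x - ?y * ev [] x" by simp
      with peak[OF \<open>lt j i\<close>, of "y - ?y *\<^sub>C 1" "[]"]
      have "ev [(i, a), (j, y - ?y *\<^sub>C 1)] x =
          (if x = [] then 0 else unital_extension \<psi> a * (ev [(j, y)] x - ?y * ev [] x))"
        by presburger
      then show ?thesis using Cons jy Nil \<open>i \<noteq> j\<close> bottom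
        by (auto simp: corrector_def algebra_simps)
    next
      case (Cons kz st'')
      obtain k z where "kz = (k, z)" by (cases kz)
      moreover have "delta_functional y = 0" using assms(3) Cons \<open>st = jy # st'\<close> jy by simp
      ultimately have "cor st' j i y = 0"
        using \<open>lt j i\<close> lt_irrefl lt_trans Cons by (auto simp: corrector_def)
      then show ?thesis using Cons \<open>st = jy # st'\<close> jy \<open>i \<noteq> j\<close> peak[OF \<open>lt j i\<close>, of y st']
        by auto
    qed
  qed
qed

text \<open>Only the deepest letter of the state may have a scalar part, since it is centered by
  \<phi>. Any other letter acquires one only through \<psi>, that is, when a smaller label is pushed
  on it, and then the evaluation is 0 anyway.\<close>

lemma ev_letter:
  assumes "if u = [] then st = [] \<or> lt (fst (hd st)) i else lt (fst (last u)) i"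
    and x: "x = [] \<or> lt (fst (hd x)) i"
    and "\<forall>k. Suc k < length st \<longrightarrow> delta_functional (snd (st ! k)) = 0"
    and "\<forall>z\<in>set u. delta_functional (snd z) = 0" "delta_functional a = 0"
    and nil_x: "\<forall>z\<in>set x. delta_functional (snd z) = 0"
  shows "ev st (u @ (i, a) # x) = unital_extension \<psi> a * ev st (u @ x)
    + (unital_extension \<phi> a - unital_extension \<psi> a) * ev st u * ev [] x"
  using assms(1,3,4)
proof (induction "(u, st)" arbitrary: u st
    rule: wf_induct_rule[OF wf_lex_prod[OF wf_measure[of length] wf_measure[of length]]])
  case (1 u st)
  note IH = 1(1)[rule_format]
  show ?case
  proof (cases u)
    case Nil
    have "length st \<ge> 2 \<Longrightarrow> delta_functional (snd (hd st)) = 0"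
      using 1(3)[rule_format, of 0] by (cases st; cases "tl st") auto
    then show ?thesis using Nil ev_letter_state[of st i x a] 1(2) x nil_x by simp
  next
    case (Cons nc u')
    obtain n c where nc: "nc = (n, c)" by (cases nc)
    have nil: "delta_functional c = 0" "\<forall>z\<in>set u'. delta_functional (snd z) = 0"
      using 1(4) Cons nc by auto
    have last: "if u' = [] then lt n i else lt (fst (last u')) i"
      using 1(2) Cons nc by (auto split: if_splits)
    show ?thesis
    proof (cases st)
      case Nil
      then show ?thesis using Cons nc IH[of u' "[(n, c)]"] nil last by auto
    next
      case st: (Cons jy st')
      obtain j y where jy: "jy = (j, y)" by (cases jy)
      have inv': "\<forall>k. Suc k < length st' \<longrightarrow> delta_functional (snd (st' ! k)) = 0"
        using 1(3) st by auto
      have y: "st' \<noteq> [] \<Longrightarrow> delta_functional y = 0"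
        using 1(3)[rule_format, of 0] st jy by auto
      show ?thesis
      proof (cases "n = j")
        case True
        have "\<forall>k. Suc k < length ((j, y * c) # st') \<longrightarrow>
            delta_functional (snd (((j, y * c) # st') ! k)) = 0"
          using inv' nil by (auto simp: nth_Cons' in_unitization_simps)
        then have "ev ((j, y * c) # st') (u' @ (i, a) # x) =
            unital_extension \<psi> a * ev ((j, y * c) # st') (u' @ x)
            + (unital_extension \<phi> a - unital_extension \<psi> a) * ev ((j, y * c) # st') u' * ev [] x"
          using Cons nil last True by (intro IH) auto
        then show ?thesis using True Cons st nc jy by simp
      next
        case False
        let ?y = "y - cor st' j n y *\<^sub>C 1"
        have t1: "ev ((n, c) # (j, ?y) # st') (u' @ (i, a) # x) =
            unital_extension \<psi> a * ev ((n, c) # (j, ?y) # st') (u' @ x)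
            + (unital_extension \<phi> a - unital_extension \<psi> a) * ev ((n, c) # (j, ?y) # st') u' * ev [] x"
        \<comment> \<open>If \<open>n\<close> is below \<open>j\<close>, all three values are 0.
          Otherwise the corrector of an inner letter is delta or 0, so centering creates no scalar
          part and the induction hypothesis applies.\<close>
        proof (cases "lt n j")
          case True
          have "ev ((n, c) # (j, ?y) # st') v = 0" if "\<forall>z\<in>set v. delta_functional (snd z) = 0" for v
            using ev_peak_zero[OF True nil(1) that, of "[]"] by simp
          then show ?thesis using nil nil_x assms(5) by (auto simp: ball_Un)
        next
          case nlt: False
          have "delta_functional ?y = 0" if ne: "st' \<noteq> []"
          proof -
            obtain k z st'' where "st' = (k, z) # st''" using ne by (cases st') auto
            then show ?thesis using y nlt by (auto simp: corrector_def)
          qed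
          then have "\<forall>k. Suc k < length ((n, c) # (j, ?y) # st') \<longrightarrow>
            delta_functional (snd (((n, c) # (j, ?y) # st') ! k)) = 0"
            using inv' nil by (auto simp: nth_Cons split: nat.splits)
          then show ?thesis using last nil Cons by (intro IH) auto
        qed
        have t2: "ev st' (u @ (i, a) # x) =
            unital_extension \<psi> a * ev st' (u @ x)
            + (unital_extension \<phi> a - unital_extension \<psi> a) * ev st' u * ev [] x"
          using 1(2,4) inv' Cons st by (intro IH) auto
        have eval: "ev st (u @ v) = ev ((n, c) # (j, ?y) # st') (u' @ v) + cor st' j n y * ev st' (u @ v)"
          for v using False Cons st nc jy by simp
        show ?thesis unfolding eval[of "[]", simplified] eval t1 t2 by (simp add: algebra_simps)
      qed
    qed
  qed
qed

lemma g_letter: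
  assumes "u = [] \<or> lt (fst (last u)) i" "x = [] \<or> lt (fst (hd x)) i"
  shows "g (u @ (i, a) # x) = \<psi> a * g (u @ x) + (\<phi> a - \<psi> a) * g u * g x"
  unfolding c_monotone_eval_def map_append list.map
  using assms
    ev_letter[of "map (apsnd in_unitization) u" "[]" i "map (apsnd in_unitization) x" "in_unitization a"]
  by (cases "u = []"; cases "x = []") (simp_all add: in_unitization_simps last_map hd_map)

lemma g_single: "g [(i, a)] = \<phi> a"
  using g_letter[of "[]" i "[]" a] by (simp add: g_Nil)

lemma ex_max: "xs \<noteq> [] \<Longrightarrow> \<exists>m\<in>set xs. \<forall>y\<in>set xs. y = m \<or> lt y m"
proof (induction xs)
  case (Cons x xs)
  show ?case
  proof (cases "xs = []")
    case False
    then obtain m where m: "m \<in> set xs" "\<forall>y\<in>set xs. y = m \<or> lt y m" using Cons.IH by blast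
    consider "x = m" | "lt x m" | "lt m x" using lt_total by blast
    then show ?thesis
    proof cases
      case 3
      then have "\<forall>y\<in>set xs. lt y x" using m lt_trans by metis
      then show ?thesis by auto
    qed (use m in auto)
  qed simp
qed simp

lemma max_run:
  assumes "p \<noteq> []"
  obtains p1 q p2 m where "p = p1 @ q @ p2" "q \<noteq> []" "\<forall>z\<in>set q. fst z = m"
    "p1 = [] \<or> lt (fst (last p1)) m" "p2 = [] \<or> lt (fst (hd p2)) m"
proof -
  obtain m where m: "m \<in> set (map fst p)" "\<forall>y\<in>set (map fst p). y = m \<or> lt y m"
    using ex_max[of "map fst p"] assms by auto
  define p1 where "p1 = takeWhile (\<lambda>z. fst z \<noteq> m) p"
  define r where "r = dropWhile (\<lambda>z. fst z \<noteq> m) p"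
  define q where "q = takeWhile (\<lambda>z. fst z = m) r"
  define p2 where "p2 = dropWhile (\<lambda>z. fst z = m) r"
  have p: "p = p1 @ q @ p2" by (simp add: p1_def q_def p2_def r_def)
  have "r \<noteq> []" using m(1) unfolding r_def by (auto simp: dropWhile_eq_Nil_conv)
  moreover from this have "fst (hd r) = m"
    using hd_dropWhile[of "\<lambda>z. fst z \<noteq> m" p] by (simp add: r_def)
  ultimately have "q \<noteq> []" by (cases r) (auto simp: q_def)
  moreover have "\<forall>z\<in>set q. fst z = m" by (auto simp: q_def dest: set_takeWhileD)
  moreover have "p1 = [] \<or> lt (fst (last p1)) m"
  proof (cases "p1 = []")
    case False
    then have "last p1 \<in> set p1" by simp
    then have "fst (last p1) \<noteq> m" "last p1 \<in> set p"
      unfolding p1_def by (auto dest: set_takeWhileD)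
    then show ?thesis using m(2) by auto
  qed simp
  moreover have "p2 = [] \<or> lt (fst (hd p2)) m"
  proof (cases "p2 = []")
    case False
    then have "fst (hd p2) \<noteq> m" using hd_dropWhile[of "\<lambda>z. fst z = m" r] by (simp add: p2_def)
    moreover have "hd p2 \<in> set p" using False p by simp
    ultimately show ?thesis using m(2) by auto
  qed simp
  ultimately show thesis using p that by blast
qed

text \<open>A block whose labels exceed those of its two adjacent letters behaves like one letter at
  a local maximum, with \<open>g p\<close> and \<open>h p\<close> in place of \<phi> and \<psi>.
  Taking out a run of the largest label by \<open>g_letter\<close> leaves shorter blocks.\<close>

lemma g_block:
  assumes "u = [] \<or> (\<forall>z\<in>set p. lt (fst (last u)) (fst z))"
    and "x = [] \<or> (\<forall>z\<in>set p. lt (fst (hd x)) (fst z))"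
  defines "h \<equiv> c_monotone_eval lt \<psi> \<psi>"
  shows "g (u @ p @ x) = h p * g (u @ x) + (g p - h p) * g u * g x"
proof -
  interpret H: c_monotone_data lt \<psi> \<psi>
    by (rule c_monotone_data.intro, rule lt_irrefl, erule (1) lt_trans, erule lt_total, (rule clinear')+)
  have H: "h [] = 1" "compatible h" 
    "\<And>u x i a. u = [] \<or> lt (fst (last u)) i \<Longrightarrow> x = [] \<or> lt (fst (hd x)) i \<Longrightarrow>
      h (u @ (i, a) # x) = \<psi> a * h (u @ x)"
    using H.g_Nil H.compatible_g H.g_letter unfolding h_def by auto
  from assms(1,2) show ?thesis
  proof (induction "length p" arbitrary: p u x rule: less_induct)
    case less
    show ?case
    proof (cases "p = []")
      case True
      then show ?thesis using H by (simp add: g_Nil)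
    next
      case False
      then obtain p1 q p2 m where p: "p = p1 @ q @ p2" "q \<noteq> []" "\<forall>z\<in>set q. fst z = m"
        and p1: "p1 = [] \<or> lt (fst (last p1)) m" and p2: "p2 = [] \<or> lt (fst (hd p2)) m"
        by (rule max_run)
      define a where "a = list_mult (map snd q)"
      have merge: "f (v @ q @ y) = f (v @ (m, a) # y)" if "compatible f" for f v y
        unfolding a_def by (rule compatible_merge[OF that p(2,3)])
      have m: "m \<in> fst ` set p" using p by (cases q) auto
      have u: "u @ p1 = [] \<or> lt (fst (last (u @ p1))) m"
        using less.prems(1) p1 m by (cases "p1 = []") auto
      have x: "p2 @ x = [] \<or> lt (fst (hd (p2 @ x))) m"
        using less.prems(2) p2 m by (cases "p2 = []") auto
      have "g (u @ p @ x) = g ((u @ p1) @ (m, a) # p2 @ x)"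
        using merge[OF compatible_g, of "u @ p1" "p2 @ x"] by (simp add: p(1))
      \<comment> \<open>The padding by \<open>[]\<close> presents the two outer factors as instances
        of the block rule with nothing on one side.\<close>
      also have "\<dots> = \<psi> a * g (u @ (p1 @ p2) @ x) + (\<phi> a - \<psi> a) * g (u @ p1 @ []) * g ([] @ p2 @ x)"
        using g_letter[OF u x] by simp
      also have "g (u @ (p1 @ p2) @ x) =
          h (p1 @ p2) * g (u @ x) + (g (p1 @ p2) - h (p1 @ p2)) * g u * g x"
        using p less.prems by (intro less.hyps) auto
      also have "g (u @ p1 @ []) = h p1 * g (u @ []) + (g p1 - h p1) * g u * g []"
        using p less.prems by (intro less.hyps) auto
      also have "g ([] @ p2 @ x) = h p2 * g ([] @ x) + (g p2 - h p2) * g [] * g x"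
        using p less.prems by (intro less.hyps) auto
      finally have "g (u @ p @ x) = \<psi> a * (h (p1 @ p2) * g (u @ x)
          + (g (p1 @ p2) - h (p1 @ p2)) * g u * g x) + (\<phi> a - \<psi> a) * (g p1 * g u) * (g p2 * g x)"
        by (simp add: g_Nil algebra_simps)
      moreover have "g p = \<psi> a * g (p1 @ p2) + (\<phi> a - \<psi> a) * g p1 * g p2"
        using merge[OF compatible_g, of p1 p2] g_letter[OF p1 p2] by (simp add: p(1))
      moreover have "h p = \<psi> a * h (p1 @ p2)"
        using merge[OF H(2), of p1 p2] H(3)[OF p1 p2] by (simp add: p(1))
      ultimately show ?thesis by (simp only:) (simp add: algebra_simps)
    qed
  qed
qed

section \<open>Existence and uniqueness of the c-monotone product\<close>

lemma ex_local_max: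
  assumes "alternating w" shows "\<exists>p. local_max lt w p"
proof -
  have "map fst w \<noteq> []" using assms by (simp add: alternating_def)
  then obtain m where m: "m \<in> set (map fst w)" "\<forall>y\<in>set (map fst w). y = m \<or> lt y m"
    using ex_max by blast
  then obtain p where p: "p < length w" "fst (w ! p) = m" by (auto simp: in_set_conv_nth)
  have "lt (fst (w ! q)) m" if "q < length w" "q = Suc p \<or> Suc q = p" for q
  proof -
    have "fst (w ! q) \<noteq> m"
      using that p assms distinct_adj_nth[of "map fst w" p] distinct_adj_nth[of "map fst w" q]
      by (auto simp: alternating_def)
    moreover have "fst (w ! q) \<in> set (map fst w)" using that by auto
    ultimately show ?thesis using m by blast
  qed
  then show ?thesis using p by (intro exI[of _ p]) (auto simp: local_max_def)
qed

abbreviation is_c_monotone_product :: "(('i, 'a) free_product \<Rightarrow> complex) \<Rightarrow> bool" where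
  "is_c_monotone_product \<Phi> \<equiv> clinear \<Phi> \<and>
      (\<forall>i a. \<Phi> (embed i a) = \<phi> a) \<and>
      (\<forall>w p. alternating w \<and> 2 \<le> length w \<and> local_max lt w p \<longrightarrow>
        \<Phi> (word w) = value_or_one \<Phi> (take p w) * (\<phi> (snd (w ! p)) - \<psi> (snd (w ! p)))
            * value_or_one \<Phi> (drop (Suc p) w)
          + \<psi> (snd (w ! p)) * \<Phi> (word (take p w @ drop (Suc p) w)))"

lemma c_monotone_product_exists: "is_c_monotone_product (nonunital_extend g)"
proof (intro conjI allI impI)
  note ext = nonunital_extend_word[OF compatible_g]
  show "clinear (nonunital_extend g)" by (rule clinear_nonunital_extend[OF compatible_g])
  show "nonunital_extend g (embed i a) = \<phi> a" for i a
    using ext[of "[(i, a)]"] by (simp add: word_def g_single)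
  fix w :: "('i \<times> 'a) list" and p
  assume *: "alternating w \<and> 2 \<le> length w \<and> local_max lt w p"
  obtain i a where ia: "w ! p = (i, a)" by (cases "w ! p")
  have p: "p < length w" using * by (simp add: local_max_def)
  have w: "w = take p w @ (i, a) # drop (Suc p) w" using id_take_nth_drop[OF p] ia by simp
  have v: "value_or_one (nonunital_extend g) v = g v" for v
    by (simp add: value_or_one_def g_Nil ext)
  have "length (take p w @ drop (Suc p) w) > 0" using * p by auto
  then have ne: "take p w @ drop (Suc p) w \<noteq> []" by blast
  have "take p w = [] \<or> lt (fst (last (take p w))) i"
    using * p ia by (cases p) (auto simp: local_max_def take_Suc_conv_app_nth)
  moreover have "drop (Suc p) w = [] \<or> lt (fst (hd (drop (Suc p) w))) i"
    using * ia by (cases "Suc p < length w") (auto simp: local_max_def hd_drop_conv_nth)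
  ultimately have "g (take p w @ (i, a) # drop (Suc p) w) = \<psi> a * g (take p w @ drop (Suc p) w)
      + (\<phi> a - \<psi> a) * g (take p w) * g (drop (Suc p) w)"
    by (rule g_letter)
  moreover have "nonunital_extend g (word w) = g w" using p by (intro ext) auto
  ultimately show "nonunital_extend g (word w) = value_or_one (nonunital_extend g) (take p w)
      * (\<phi> (snd (w ! p)) - \<psi> (snd (w ! p))) * value_or_one (nonunital_extend g) (drop (Suc p) w)
      + \<psi> (snd (w ! p)) * nonunital_extend g (word (take p w @ drop (Suc p) w))"
    unfolding v ext[OF ne] using w ia by (simp add: algebra_simps)
qed

lemma word_merge: "word (p @ (i, a) # (i, b) # q) = word (p @ (i, a * b) # q)"
proof -
  have "word ((i, a) # (i, b) # q) = word ((i, a * b) # q)"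
    by (cases "q = []") (simp_all add: word_Cons embed_mult mult.assoc, simp_all add: word_def embed_mult)
  then show ?thesis by (cases "p = []") (simp_all add: word_append)
qed

text \<open>Equal neighbours merge, and an alternating word has a local maximum wherever its largest
  label occurs, so the recursion reaches every word.\<close>

lemma c_monotone_product_unique:
  assumes "is_c_monotone_product \<Phi>" "is_c_monotone_product \<Phi>'"
  shows "\<Phi> = \<Phi>'"
proof (rule free_product_eqI)
  show "clinear \<Phi>" "clinear \<Phi>'" using assms by auto
  show "\<Phi> (word w) = \<Phi>' (word w)" if "w \<noteq> []" for w
    using that
  proof (induction "length w" arbitrary: w rule: less_induct)
    case less
    show ?case
    proof (cases "distinct_adj (map fst w)")
      case False
      then obtain p i a b q where w: "w = p @ (i, a) # (i, b) # q" by (rule not_distinct_adjE)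
      then show ?thesis using less(1)[of "p @ (i, a * b) # q"] by (simp add: word_merge)
    next
      case True
      then have alt: "alternating w" using less.prems by (simp add: alternating_def)
      show ?thesis
      proof (cases "2 \<le> length w")
        case False
        then obtain i a where "w = [(i, a)]" using less.prems
          by (cases w; cases "tl w") auto
        then show ?thesis using assms by (simp add: word_def)
      next
        case len: True
        obtain p where p: "local_max lt w p" using ex_local_max[OF alt] by blast
        then have pl: "p < length w" by (simp add: local_max_def)
        have v: "value_or_one \<Phi> v = value_or_one \<Phi>' v" if "length v < length w" for v
          using less(1)[OF that] by (simp add: value_or_one_def)
        have "length (take p w @ drop (Suc p) w) > 0" using len pl by auto
        then have "\<Phi> (word (take p w @ drop (Suc p) w)) = \<Phi>' (word (take p w @ drop (Suc p) w))"
          using pl by (intro less) auto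
        then show ?thesis using assms alt len p pl v[of "take p w"] v[of "drop (Suc p) w"] by simp
      qed
    qed
  qed
qed

lemma c_monotone_product_eq:
  "fst (c_monotone_product_wrt lt (\<lambda>_. \<phi>) (\<lambda>_. \<psi>)) = nonunital_extend g"
  unfolding c_monotone_product_wrt_def fst_conv
  using c_monotone_product_exists by (intro the_equality c_monotone_product_unique) auto

end

section \<open>Relabelling, and reduction of the other products to the c-monotone one\<close>

lemma alpha_eval_relabel:
  assumes "inj_on \<rho> D" "\<And>i j. i \<in> D \<Longrightarrow> j \<in> D \<Longrightarrow> lt (\<rho> i) (\<rho> j) \<longleftrightarrow> lt' i j"
    and "fst ` set st \<subseteq> D" "fst ` set w \<subseteq> D"
  shows "alpha_eval lt \<phi> \<psi> \<theta> (map (apfst \<rho>) st) (map (apfst \<rho>) w) = alpha_eval lt' \<phi> \<psi> \<theta> st w"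
  using assms(2-4)
proof (induction lt' \<phi> \<psi> \<theta> st w rule: alpha_eval.induct)
  case (5 lt' \<phi> \<psi> \<theta> j y st i c w)
  have "\<rho> i = \<rho> j \<longleftrightarrow> i = j" using 5(5,6) assms(1) by (auto simp: inj_on_def)
  moreover have "corrector lt \<phi> \<psi> \<theta> (map (apfst \<rho>) st) (\<rho> j) (\<rho> i) = corrector lt' \<phi> \<psi> \<theta> st j i"
  proof (cases st)
    case (Cons kz st')
    then have "lt (\<rho> (fst kz)) (\<rho> j) = lt' (fst kz) j" "lt (\<rho> j) (\<rho> (fst kz)) = lt' j (fst kz)"
      "lt (\<rho> i) (\<rho> j) = lt' i j" "lt (\<rho> j) (\<rho> i) = lt' j i"
      using 5(5,6) by (auto intro!: 5(4))
    then show ?thesis using Cons by (cases kz) (simp add: corrector_def)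
  qed (simp add: corrector_def)
  ultimately show ?case using 5 by simp
qed simp_all

lemma label_sum_cong:
  assumes "\<And>w. map snd w = as \<Longrightarrow> fst ` set w \<subseteq> S \<Longrightarrow> f w = f' w"
  shows "label_sum S f as = label_sum S f' as"
  using assms
proof (induction as arbitrary: f f')
  case (Cons a as)
  show ?case unfolding label_sum.simps
    by (intro sum.cong refl Cons.IH Cons.prems) auto
qed simp

lemma label_sum_relabel:
  assumes "bij_betw \<rho> S S'"
  shows "label_sum S (\<lambda>w. f (map (apfst \<rho>) w)) as = label_sum S' f as"
proof (induction as arbitrary: f)
  case (Cons a as)
  have "label_sum S (\<lambda>w. f (map (apfst \<rho>) w)) (a # as) =
      (\<Sum>j\<in>S. label_sum S' (\<lambda>w. f ((\<rho> j, a) # w)) as)"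
    using Cons.IH[of "\<lambda>w. f ((\<rho> _, a) # w)"] by simp
  also have "\<dots> = label_sum S' f (a # as)"
    unfolding label_sum.simps
    by (rule sum.reindex_bij_betw[OF assms, of "\<lambda>j. label_sum S' (\<lambda>w. f ((j, a) # w)) as"])
  finally show ?case .
qed simp

lemma label_sum_map:
  "label_sum S f (map h as) = label_sum S (\<lambda>w. f (map (apsnd h) w)) as"
  by (induction as arbitrary: f) simp_all

lemma c_monotone_eval_relabel:
  assumes "inj_on \<rho> D" "\<And>i j. i \<in> D \<Longrightarrow> j \<in> D \<Longrightarrow> lt (\<rho> i) (\<rho> j) \<longleftrightarrow> lt' i j"
    and "fst ` set w \<subseteq> D"
  shows "c_monotone_eval lt \<phi> \<psi> (map (apfst \<rho>) w) = c_monotone_eval lt' \<phi> \<psi> w"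
proof -
  have swap: "map (apsnd in_unitization) (map (apfst \<rho>) w) = map (apfst \<rho>) (map (apsnd in_unitization) w)"
    by (simp add: comp_def)
  moreover have "fst ` set (map (apsnd in_unitization) w) \<subseteq> D" using assms(3) by auto
  ultimately show ?thesis
    unfolding c_monotone_eval_def swap
    using alpha_eval_relabel[where D = D and \<rho> = \<rho> and lt = lt and lt' = lt' and st = "[]"
        and w = "map (apsnd in_unitization) w", OF assms(1,2)]
    by (simp del: map_map)
qed

text \<open>Single words may have different values for the two orders; it is the set of all
  labellings that is invariant under the reflection of the labels.\<close>

lemma label_sum_reverse:
  "label_sum {..<N} (c_monotone_eval (>) \<phi> \<psi>) as = label_sum {..<N} (c_monotone_eval (<) \<phi> \<psi>) as"
proof -
  let ?\<rho> = "\<lambda>j. N - 1 - j"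
  have "label_sum {..<N} (c_monotone_eval (<) \<phi> \<psi>) as =
      label_sum {..<N} (\<lambda>w. c_monotone_eval (<) \<phi> \<psi> (map (apfst ?\<rho>) w)) as"
    by (rule label_sum_relabel[symmetric], rule bij_betw_byWitness[where f' = ?\<rho>]) auto
  also have "\<dots> = label_sum {..<N} (c_monotone_eval (>) \<phi> \<psi>) as"
    by (intro label_sum_cong c_monotone_eval_relabel[where D = "{..<N}"]) (auto simp: inj_on_def)
  finally show ?thesis by simp
qed

lemma product_cumulant_eq:
  assumes "c_monotone_data lt \<phi> \<psi>" "as \<noteq> []"
  shows "product_cumulant (fst (c_monotone_product_wrt lt (\<lambda>_. \<phi>) (\<lambda>_. \<psi>))) as =
    linear_coefficient (\<lambda>N. label_sum {..<N} (c_monotone_eval lt \<phi> \<psi>) as)"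
proof -
  interpret c_monotone_data lt \<phi> \<psi> by fact
  have "label_sum {..<N} (\<lambda>w. nonunital_extend g (word w)) as = label_sum {..<N} g as" for N
    using assms(2) by (intro label_sum_cong nonunital_extend_word[OF compatible_g]) auto
  then show ?thesis
    by (simp add: product_cumulant_def c_monotone_product_eq
        dilation_expand[OF clinear_nonunital_extend[OF compatible_g] assms(2)])
qed

text \<open>Reversing the order exchanges peaks and bottoms, hence \<psi> and \<theta>; the first
  letter is not affected.\<close>

lemma alpha_eval_swap:
  fixes \<phi> \<psi> \<theta> :: "'b::complex_algebra_1 \<Rightarrow> complex"
  shows "alpha_eval ((<) :: 'i::linorder \<Rightarrow> _) \<phi> \<psi> \<theta> st w = alpha_eval (>) \<phi> \<theta> \<psi> st w"
proof -
  have "corrector (<) \<phi> \<psi> \<theta> st j i = corrector (>) \<phi> \<theta> \<psi> st j i"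
    for st :: "('i \<times> 'b) list" and i j
    by (cases st) (auto simp: corrector_def)
  then show ?thesis
    by (induction "(<) :: 'i \<Rightarrow> _" \<phi> \<psi> \<theta> st w rule: alpha_eval.induct) simp_all
qed

context
  fixes \<phi> \<psi> :: "'a::complex_algebra \<Rightarrow> complex"
  assumes lin: "clinear \<phi>" "clinear \<psi>"
begin

lemma c_monotone_data_linorder:
  "c_monotone_data ((<) :: 'i::linorder \<Rightarrow> _) \<phi> \<psi>" "c_monotone_data ((>) :: 'i::linorder \<Rightarrow> _) \<phi> \<psi>"
  by (auto intro!: c_monotone_data.intro lin)

lemma K_CM_eq:
  "K_CM \<phi> \<psi> as = linear_coefficient (\<lambda>N. label_sum {..<N} (c_monotone_eval (<) \<phi> \<psi>) as)"
  unfolding K_CM_def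
  by (subst alpha_cumulant_label_sum)
    (simp_all add: lin unital_extension_unital delta_unital label_sum_map c_monotone_eval_def[abs_def])

lemma c_monotone_cumulant_eq: "as \<noteq> [] \<Longrightarrow> c_monotone_cumulant \<phi> \<psi> as = K_CM \<phi> \<psi> as"
  unfolding c_monotone_cumulant_def c_monotone_product_def K_CM_eq
  by (rule product_cumulant_eq[OF c_monotone_data_linorder(1)])

lemma c_antimonotone_cumulant_eq: "as \<noteq> [] \<Longrightarrow> c_antimonotone_cumulant \<phi> \<psi> as = K_CM \<phi> \<psi> as"
  unfolding c_antimonotone_cumulant_def c_antimonotone_product_def K_CM_eq
  by (subst product_cumulant_eq[OF c_monotone_data_linorder(2)]) (simp_all add: label_sum_reverse)

lemma K_CAM_eq: "K_CAM \<phi> \<psi> as = K_CM \<phi> \<psi> as"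
proof -
  have "K_CAM \<phi> \<psi> as = linear_coefficient (\<lambda>N. label_sum {..<N} (c_monotone_eval (>) \<phi> \<psi>) as)"
    unfolding K_CAM_def
    by (subst alpha_cumulant_label_sum)
      (simp_all add: lin unital_extension_unital delta_unital label_sum_map c_monotone_eval_def[abs_def]
        alpha_eval_swap)
  then show ?thesis by (simp add: K_CM_eq label_sum_reverse)
qed

end

text \<open>When both functionals coincide, the factor in the splitting term of the c-monotone rule
  is 0, and the two descriptions become identical.\<close>

lemma monotone_product_wrt_eq:
  "monotone_product_wrt lt \<psi> = fst (c_monotone_product_wrt lt \<psi> \<psi>)"
  by (simp add: monotone_product_wrt_def c_monotone_product_wrt_def)

lemma monotone_cumulant_eq: "monotone_cumulant \<psi> = c_monotone_cumulant \<psi> \<psi>"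
  by (simp add: monotone_cumulant_def c_monotone_cumulant_def monotone_product_def
      c_monotone_product_def monotone_product_wrt_eq)

lemma antimonotone_cumulant_eq: "antimonotone_cumulant \<psi> = c_antimonotone_cumulant \<psi> \<psi>"
  by (simp add: antimonotone_cumulant_def c_antimonotone_cumulant_def antimonotone_product_def
      c_antimonotone_product_def monotone_product_wrt_eq)

lemma K_M_eq: "K_M \<psi> = K_CM \<psi> \<psi>"
  by (simp add: K_M_def K_CM_def fun_eq_iff)

lemma K_AM_eq: "K_AM \<psi> = K_CAM \<psi> \<psi>"
  by (simp add: K_AM_def K_CAM_def fun_eq_iff)

lemma K_B_eq: "K_B \<phi> = K_CM \<phi> (\<lambda>_. 0)"
  by (simp add: K_B_def K_CM_def fun_eq_iff delta_functional_eq)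

text \<open>With \<psi> = 0 the c-monotone rule factors a word at a local maximum into left part,
  letter and right part; iterating this gives the product over all letters.\<close>

lemma boolean_product_eq:
  fixes \<phi> :: "'a::complex_algebra \<Rightarrow> complex"
  assumes "clinear \<phi>"
  shows "(boolean_product (\<lambda>_. \<phi>) :: ('i::linorder, 'a) free_product \<Rightarrow> complex) =
    fst (c_monotone_product (\<lambda>_. \<phi>) (\<lambda>_ _. 0))"
proof -
  interpret c_monotone_data "(<) :: 'i \<Rightarrow> _" \<phi> "\<lambda>_. 0"
    by (rule c_monotone_data_linorder[OF assms clinear_0])
  have g: "g w = (\<Prod>(i, a)\<leftarrow>w. \<phi> a)" if "distinct_adj (map fst w)" for w
    using that
  proof (induction "length w" arbitrary: w rule: less_induct)
    case less
    show ?case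
    proof (cases "w = []")
      case False
      then obtain p where p: "local_max (<) w p"
        using less.prems ex_local_max by (auto simp: alternating_def)
      obtain i a where ia: "w ! p = (i, a)" by (cases "w ! p")
      have pl: "p < length w" using p by (simp add: local_max_def)
      then have w: "w = take p w @ (i, a) # drop (Suc p) w" using id_take_nth_drop ia by metis
      have da: "distinct_adj (map fst (take p w))" "distinct_adj (map fst (drop (Suc p) w))"
        using less.prems distinct_adj_appendD1[of "map fst (take p w)"]
          distinct_adj_appendD2[of "map fst (take (Suc p) w)"]
        by (metis append_take_drop_id map_append)+
      have "take p w = [] \<or> fst (last (take p w)) < i"
        using p ia by (cases p) (auto simp: local_max_def take_Suc_conv_app_nth)
      moreover have "drop (Suc p) w = [] \<or> fst (hd (drop (Suc p) w)) < i"
        using p ia by (cases "Suc p < length w") (auto simp: local_max_def hd_drop_conv_nth)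
      ultimately have "g (take p w @ (i, a) # drop (Suc p) w) = \<phi> a * g (take p w) * g (drop (Suc p) w)"
        by (subst g_letter) auto
      moreover have "g (take p w) = (\<Prod>(i, a)\<leftarrow>take p w. \<phi> a)"
        "g (drop (Suc p) w) = (\<Prod>(i, a)\<leftarrow>drop (Suc p) w. \<phi> a)"
        using da pl by (auto intro: less.hyps)
      ultimately show ?thesis by (subst (2) w, subst w) simp
    qed (simp add: g_Nil)
  qed
  have "(boolean_product (\<lambda>_::'i. \<phi>)) = nonunital_extend g"
    unfolding boolean_product_def
  proof (rule the_equality)
    show *: "clinear (nonunital_extend g) \<and>
        (\<forall>w. alternating w \<longrightarrow> nonunital_extend g (word w) = (\<Prod>(i, a)\<leftarrow>w. \<phi> a))"
      using g by (auto simp: clinear_nonunital_extend[OF compatible_g] alternating_def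
          nonunital_extend_word[OF compatible_g])
    fix \<Phi> :: "('i, 'a) free_product \<Rightarrow> complex"
    assume \<Phi>: "clinear \<Phi> \<and> (\<forall>w. alternating w \<longrightarrow> \<Phi> (word w) = (\<Prod>(i, a)\<leftarrow>w. \<phi> a))"
    show "\<Phi> = nonunital_extend g"
    proof (rule free_product_eqI)
      show "\<Phi> (word w) = nonunital_extend g (word w)" if "w \<noteq> []" for w
        using that
      proof (induction "length w" arbitrary: w rule: less_induct)
        case less
        show ?case
        proof (cases "distinct_adj (map fst w)")
          case True
          then show ?thesis using \<Phi> * less.prems by (simp add: alternating_def)
        next
          case False
          then obtain p i a b q where w: "w = p @ (i, a) # (i, b) # q" by (rule not_distinct_adjE)
          then show ?thesis using less(1)[of "p @ (i, a * b) # q"] by (simp add: word_merge)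
        qed
      qed
    qed (use \<Phi> * in auto)
  qed
  then show ?thesis by (simp add: c_monotone_product_def c_monotone_product_eq)
qed

lemma boolean_cumulant_eq: "clinear \<phi> \<Longrightarrow> boolean_cumulant \<phi> = c_monotone_cumulant \<phi> (\<lambda>_. 0)"
  by (simp add: boolean_cumulant_def c_monotone_cumulant_def boolean_product_eq)

section \<open>Dependence on the number of copies\<close>

lemma label_sum_add: "label_sum S (\<lambda>w. f w + f' w) as = label_sum S f as + label_sum S f' as"
  by (induction as arbitrary: f f') (simp_all add: sum.distrib)

lemma label_sum_cmult: "label_sum S (\<lambda>w. c * f w) as = c * label_sum S f as"
  by (induction as arbitrary: f) (simp_all add: sum_distrib_left)

lemma label_sum_multc: "label_sum S (\<lambda>w. f w * c) as = label_sum S f as * c"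
  using label_sum_cmult[of S c f as] by (simp add: mult.commute)

lemma label_sum_sum: "label_sum S (\<lambda>w. \<Sum>j\<in>I. f j w) as = (\<Sum>j\<in>I. label_sum S (f j) as)"
proof (induction as arbitrary: f)
  case (Cons a as)
  then show ?case by simp (rule sum.swap)
qed simp

lemma label_sum_append:
  "label_sum S f (as @ bs) = label_sum S (\<lambda>u. label_sum S (\<lambda>v. f (u @ v)) bs) as"
  by (induction as arbitrary: f) simp_all

lemma label_sum_diff: "label_sum S (\<lambda>w. f w - f' w) as = label_sum S f as - label_sum S f' as"
  by (induction as arbitrary: f f') (simp_all add: sum_subtractf)

section \<open>Polynomials in the number of copies\<close>

lemma poly_eq_of_nat:
  assumes "\<And>N. N \<ge> k \<Longrightarrow> poly p (of_nat N :: complex) = poly q (of_nat N)"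
  shows "p = q"
proof -
  have "infinite (of_nat ` {k..} :: complex set)"
    by (subst finite_image_iff) (auto simp: inj_on_def infinite_Ici)
  moreover have "of_nat ` {k..} \<subseteq> {x. poly (p - q) x = 0}" using assms by auto
  ultimately have "infinite {x. poly (p - q) x = 0}" by (meson finite_subset)
  then show ?thesis using poly_roots_finite[of "p - q"] by auto
qed

lemma linear_coefficient_eq:
  assumes "\<And>N. f N = poly p (of_nat N)" shows "linear_coefficient f = coeff p 1"
proof -
  have "(THE p. \<forall>N\<ge>1. poly p (of_nat N) = f N) = p"
    by (rule the_equality) (use assms in \<open>auto intro: poly_eq_of_nat[of 1]\<close>)
  then show ?thesis by (simp add: linear_coefficient_def)
qed

lemma antidifference:
  "\<exists>q. \<forall>x. poly q (x + 1) - poly q x = poly p (x :: complex)"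
proof -
  have mono: "\<exists>q. \<forall>x. poly q (x + 1) - poly q x = (x :: complex) ^ n" for n
  proof (induction n rule: less_induct)
    case (less n)
    then obtain q where q: "\<And>k x. k < n \<Longrightarrow> poly (q k) (x + 1) - poly (q k) x = (x :: complex) ^ k"
      by metis
    \<comment> \<open>This solves the binomial expansion of
      \<open>(x + 1) ^ Suc n - x ^ Suc n\<close> for \<open>x ^ n\<close>, with the lower powers
      replaced by their antidifferences.\<close>
    define r where "r = smult (1 / of_nat (Suc n))
      (monom 1 (Suc n) - (\<Sum>k<n. smult (of_nat (Suc n choose k)) (q k)))"
    have "poly r (x + 1) - poly r x = x ^ n" for x
    proof -
      have "(x + 1) ^ Suc n = (\<Sum>k\<le>Suc n. of_nat (Suc n choose k) * x ^ k)"
        by (subst binomial_ring) simp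
      also have "\<dots> = (\<Sum>k<n. of_nat (Suc n choose k) * x ^ k) + of_nat (Suc n) * x ^ n + x ^ Suc n"
        unfolding lessThan_Suc_atMost[symmetric] sum.lessThan_Suc by (simp add: lessThan_Suc_atMost)
      finally have "of_nat (Suc n) * x ^ n = (x + 1) ^ Suc n - x ^ Suc n
          - (\<Sum>k<n. of_nat (Suc n choose k) * x ^ k)"
        by simp
      also have "(\<Sum>k<n. of_nat (Suc n choose k) * x ^ k) =
          (\<Sum>k<n. of_nat (Suc n choose k) * poly (q k) (x + 1)) - (\<Sum>k<n. of_nat (Suc n choose k) * poly (q k) x)"
        unfolding sum_subtractf[symmetric]
        by (intro sum.cong refl) (simp add: q flip: right_diff_distrib)
      also have "(x + 1) ^ Suc n - x ^ Suc n - \<dots> = of_nat (Suc n) * (poly r (x + 1) - poly r x)"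
        by (simp add: r_def poly_monom poly_sum right_diff_distrib del: power_Suc of_nat_Suc)
      finally show ?thesis by (simp del: of_nat_Suc)
    qed
    then show ?case by blast
  qed
  then obtain q where q: "\<And>n x. poly (q n) (x + 1) - poly (q n) x = (x :: complex) ^ n" by metis
  show ?thesis
  proof (intro exI allI)
    fix x
    show "poly (\<Sum>n\<le>degree p. smult (coeff p n) (q n)) (x + 1)
        - poly (\<Sum>n\<le>degree p. smult (coeff p n) (q n)) x = poly p x"
      by (simp add: poly_sum poly_altdef[of p] q flip: sum_subtractf right_diff_distrib)
  qed
qed

definition polynomial_in :: "(nat \<Rightarrow> complex) \<Rightarrow> bool" where
  "polynomial_in f \<longleftrightarrow> (\<exists>p. \<forall>N. f N = poly p (of_nat N))"

lemma polynomial_in_intros: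
  "polynomial_in (\<lambda>_. c)"
  "polynomial_in f \<Longrightarrow> polynomial_in f' \<Longrightarrow> polynomial_in (\<lambda>N. f N + f' N)"
  "polynomial_in f \<Longrightarrow> polynomial_in f' \<Longrightarrow> polynomial_in (\<lambda>N. f N * f' N)"
  unfolding polynomial_in_def
  by (intro exI[of _ "[:c:]"], simp) (metis poly_add, metis poly_mult)

lemma polynomial_in_differences:
  assumes "polynomial_in (\<lambda>N. f (Suc N) - f N)" shows "polynomial_in f"
proof -
  obtain p where p: "\<And>N. f (Suc N) - f N = poly p (of_nat N)"
    using assms by (auto simp: polynomial_in_def)
  obtain q where q: "\<And>x. poly q (x + 1) - poly q x = poly p x" using antidifference by blast
  have "f N = poly ([:f 0 - poly q 0:] + q) (of_nat N)" for N
  proof (induction N)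
    case (Suc N)
    then show ?case using p[of N] q[of "of_nat N"] by (simp add: algebra_simps)
  qed simp
  then show ?thesis unfolding polynomial_in_def by blast
qed

text \<open>Arithmetic modulo the square of the variable: products of the pairs \<open>c\<close>,
  \<open>d\<close> follow the rule for dual numbers.\<close>

definition coefficients01 :: "(nat \<Rightarrow> complex) \<Rightarrow> complex \<Rightarrow> complex \<Rightarrow> bool" where
  "coefficients01 f c d \<longleftrightarrow>
    (\<exists>p. (\<forall>N. f N = poly p (of_nat N)) \<and> coeff p 0 = c \<and> coeff p 1 = d)"

lemma coefficients01_const: "coefficients01 (\<lambda>_. c) c 0"
  unfolding coefficients01_def by (intro exI[of _ "[:c:]"]) simp

lemma coefficients01_add:
  "coefficients01 f c d \<Longrightarrow> coefficients01 f' c' d' \<Longrightarrow>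
    coefficients01 (\<lambda>N. f N + f' N) (c + c') (d + d')"
  unfolding coefficients01_def by (metis poly_add coeff_add)

lemma coefficients01_mult:
  assumes "coefficients01 f c d" "coefficients01 f' c' d'"
  shows "coefficients01 (\<lambda>N. f N * f' N) (c * c') (c * d' + d * c')"
proof -
  obtain p q where "\<forall>N. f N = poly p (of_nat N)" "coeff p 0 = c" "coeff p 1 = d"
    "\<forall>N. f' N = poly q (of_nat N)" "coeff q 0 = c'" "coeff q 1 = d'"
    using assms by (auto simp: coefficients01_def)
  then show ?thesis unfolding coefficients01_def
    by (intro exI[of _ "p * q"]) (simp add: coeff_mult)
qed

lemma coefficients01_diff:
  "coefficients01 f c d \<Longrightarrow> coefficients01 f' c' d' \<Longrightarrow>
    coefficients01 (\<lambda>N. f N - f' N) (c - c') (d - d')"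
  unfolding coefficients01_def by (metis poly_diff coeff_diff)

text \<open>What the moment formula uses of the two evaluations, without any algebra structure on
  the letters. The run \<open>p\<close> of upper labels follows a lower prefix \<open>u\<close>,
  while \<open>x\<close> only has to start with a lower label, since a scan from the left has not
  yet reached the rest. By \<open>shift\<close>, the upper labels count like an initial segment.
  With \<open>g\<close> replaced by \<open>h\<close> the axioms hold again, so all results also
  apply to \<open>h\<close>.\<close>

locale block_system =
  fixes g h :: "(nat \<times> 'a) list \<Rightarrow> complex"
  assumes g_Nil: "g [] = 1" and h_Nil: "h [] = 1"
    and block: "\<And>N u p x. fst ` set u \<subseteq> {..<N} \<Longrightarrow> fst ` set p \<subseteq> {N..} \<Longrightarrow>
      x = [] \<or> fst (hd x) < N \<Longrightarrow> g (u @ p @ x) = h p * g (u @ x) + (g p - h p) * g u * g x"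
    and block_h: "\<And>N u p x. fst ` set u \<subseteq> {..<N} \<Longrightarrow> fst ` set p \<subseteq> {N..} \<Longrightarrow>
      x = [] \<or> fst (hd x) < N \<Longrightarrow> h (u @ p @ x) = h p * h (u @ x)"
    and shift: "\<And>N w. g (map (apfst ((+) N)) w) = g w" "\<And>N w. h (map (apfst ((+) N)) w) = h w"
begin

definition G :: "nat \<Rightarrow> 'a list \<Rightarrow> complex" where "G N as = label_sum {..<N} g as"
definition H :: "nat \<Rightarrow> 'a list \<Rightarrow> complex" where "H N as = label_sum {..<N} h as"

text \<open>\<open>low_any\<close> and \<open>low_high_any\<close> are the two stages of expanding
  \<open>G (N + M)\<close> letter by letter: after the lower prefix \<open>u\<close>, either no
  upper run is pending, or \<open>p\<close> is. Runs that have ended are already removed by the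
  block rule.\<close>

definition low_any :: "nat \<Rightarrow> nat \<Rightarrow> 'a list \<Rightarrow> 'a list \<Rightarrow> complex" where
  "low_any N M u as = label_sum {..<N} (\<lambda>w. label_sum {..<N + M} (\<lambda>v. g (w @ v)) as) u"

definition low_high_any :: "nat \<Rightarrow> nat \<Rightarrow> 'a list \<Rightarrow> 'a list \<Rightarrow> 'a list \<Rightarrow> complex" where
  "low_high_any N M u p as = label_sum {..<N} (\<lambda>w. label_sum {N..<N + M} (\<lambda>w'.
     label_sum {..<N + M} (\<lambda>v. g (w @ w' @ v)) as) p) u"

lemma split_labels: "(\<Sum>j<N + M. f j) = (\<Sum>j<N. f j) + (\<Sum>j\<in>{N..<N + M}. f (j :: nat) :: complex)"
  by (subst sum.union_disjoint[symmetric]) (auto intro: sum.cong)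

lemma low_any_Nil: "low_any N M u [] = G N u"
  by (simp add: low_any_def G_def)

lemma low_any_Cons: "low_any N M u (a # as) = low_any N M (u @ [a]) as + low_high_any N M u [a] as"
  by (simp add: low_any_def low_high_any_def label_sum_append split_labels label_sum_add)

lemma high: 
  "label_sum {N..<N + M} g p = G M p" "label_sum {N..<N + M} h p = H M p"
proof -
  have "bij_betw ((+) N) {..<M} {N..<N + M}"
    by (rule bij_betw_byWitness[where f' = "\<lambda>j. j - N"]) auto
  note relabel = label_sum_relabel[OF this]
  show "label_sum {N..<N + M} g p = G M p" "label_sum {N..<N + M} h p = H M p"
    unfolding G_def H_def relabel[symmetric] shift by simp_all
qed

lemma low_high_any_Nil: "low_high_any N M u p [] = G N u * G M p"
proof -
  have "low_high_any N M u p [] =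
      label_sum {..<N} (\<lambda>w. label_sum {N..<N + M} (\<lambda>w'. g w * g w') p) u"
    unfolding low_high_any_def label_sum.simps
  proof (intro label_sum_cong)
    fix w w' :: "(nat \<times> 'a) list"
    assume "fst ` set w \<subseteq> {..<N}" "fst ` set w' \<subseteq> {N..<N + M}"
    moreover from this have "fst ` set w' \<subseteq> {N..}" by auto
    ultimately show "g (w @ w' @ []) = g w * g w'"
      using block[of w N w' "[]"] by (simp add: g_Nil algebra_simps)
  qed
  then show ?thesis by (simp add: label_sum_cmult label_sum_multc high G_def)
qed

lemma low_high_any_Cons:
  "low_high_any N M u p (a # as) = low_high_any N M u (p @ [a]) as
    + (H M p * low_any N M (u @ [a]) as + (G M p - H M p) * G N u * low_any N M [a] as)"
proof -
  have "low_high_any N M u p (a # as) = low_high_any N M u (p @ [a]) as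
    + label_sum {..<N} (\<lambda>w. label_sum {N..<N + M} (\<lambda>w'. \<Sum>j<N.
        label_sum {..<N + M} (\<lambda>v. g (w @ w' @ (j, a) # v)) as) p) u"
    by (simp add: low_high_any_def label_sum_append split_labels label_sum_add)
  \<comment> \<open>A letter with label \<open>j < N\<close> ends the run \<open>w'\<close>, so the
    block rule applies whatever labels \<open>v\<close> carries.\<close>
  also have "label_sum {..<N} (\<lambda>w. label_sum {N..<N + M} (\<lambda>w'. \<Sum>j<N.
        label_sum {..<N + M} (\<lambda>v. g (w @ w' @ (j, a) # v)) as) p) u =
      label_sum {..<N} (\<lambda>w. label_sum {N..<N + M} (\<lambda>w'. \<Sum>j<N. label_sum {..<N + M}
        (\<lambda>v. h w' * g (w @ (j, a) # v) + (g w' - h w') * g w * g ((j, a) # v)) as) p) u"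
    by (intro label_sum_cong sum.cong refl block) (auto simp: subset_iff)
  also have "\<dots> = label_sum {..<N} (\<lambda>w. label_sum {N..<N + M} (\<lambda>w'.
      h w' * (\<Sum>j<N. label_sum {..<N + M} (\<lambda>v. g (w @ (j, a) # v)) as)
      + (g w' - h w') * g w * low_any N M [a] as) p) u"
    by (simp add: label_sum_add label_sum_cmult sum.distrib low_any_def flip: sum_distrib_left)
  also have "\<dots> = label_sum {..<N} (\<lambda>w.
      H M p * (\<Sum>j<N. label_sum {..<N + M} (\<lambda>v. g (w @ (j, a) # v)) as)
      + (G M p - H M p) * g w * low_any N M [a] as) u"
    by (simp add: label_sum_add label_sum_multc label_sum_diff high)
  also have "\<dots> = H M p * low_any N M (u @ [a]) as + (G M p - H M p) * G N u * low_any N M [a] as"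
    by (simp add: label_sum_add label_sum_multc label_sum_cmult low_any_def label_sum_append G_def)
  finally show ?thesis .
qed

lemma G_plus: "G (N + M) as = low_any N M [] as"
  by (simp add: G_def low_any_def)

text \<open>The first inequality is strict because a pending run is nonempty and splits off, leaving
  moments of shorter tuples; without a pending run the full tuple may occur.\<close>

lemma polynomial_aux:
  "(\<forall>u p. p \<noteq> [] \<longrightarrow> (\<forall>bs. length bs < length (u @ p @ as) \<longrightarrow> polynomial_in (\<lambda>N. G N bs)) \<longrightarrow>
      polynomial_in (\<lambda>N. low_high_any N 1 u p as)) \<and>
   (\<forall>u. (\<forall>bs. length bs \<le> length (u @ as) \<longrightarrow> polynomial_in (\<lambda>N. G N bs)) \<longrightarrow>
      polynomial_in (\<lambda>N. low_any N 1 u as))"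
proof (induction as)
  case Nil
  then show ?case
    by (auto simp: low_any_Nil low_high_any_Nil intro!: polynomial_in_intros)
next
  case (Cons a as)
  have IH1: "polynomial_in (\<lambda>N. low_high_any N 1 u p as)"
    if "p \<noteq> []" "\<forall>bs. length bs < length (u @ p @ as) \<longrightarrow> polynomial_in (\<lambda>N. G N bs)" for u p
    using Cons that by blast
  have IH2: "polynomial_in (\<lambda>N. low_any N 1 u as)"
    if "\<forall>bs. length bs \<le> length (u @ as) \<longrightarrow> polynomial_in (\<lambda>N. G N bs)" for u
    using Cons that by blast
  show ?case
  proof (intro conjI allI impI)
    fix u p :: "'a list"
    assume *: "p \<noteq> []" "\<forall>bs. length bs < length (u @ p @ a # as) \<longrightarrow> polynomial_in (\<lambda>N. G N bs)"
    have p: "length p > 0" using *(1) by simp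
    have "polynomial_in (\<lambda>N. low_high_any N 1 u (p @ [a]) as)"
      by (rule IH1) (use * in simp_all)
    moreover have "polynomial_in (\<lambda>N. low_any N 1 (u @ [a]) as)"
    proof (rule IH2, intro allI impI)
      fix bs :: "'a list" assume "length bs \<le> length ((u @ [a]) @ as)"
      then have "length bs < length (u @ p @ a # as)"
        using p by (simp del: length_greater_0_conv)
      then show "polynomial_in (\<lambda>N. G N bs)" using *(2) by blast
    qed
    moreover have "polynomial_in (\<lambda>N. low_any N 1 [a] as)"
    proof (rule IH2, intro allI impI)
      fix bs :: "'a list" assume "length bs \<le> length ([a] @ as)"
      then have "length bs < length (u @ p @ a # as)"
        using p by (simp del: length_greater_0_conv)
      then show "polynomial_in (\<lambda>N. G N bs)" using *(2) by blast
    qed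
    moreover have "polynomial_in (\<lambda>N. G N u)"
      using *(2) p by simp
    ultimately show "polynomial_in (\<lambda>N. low_high_any N 1 u p (a # as))"
      unfolding low_high_any_Cons by (intro polynomial_in_intros)
  next
    fix u :: "'a list"
    assume *: "\<forall>bs. length bs \<le> length (u @ a # as) \<longrightarrow> polynomial_in (\<lambda>N. G N bs)"
    have "polynomial_in (\<lambda>N. low_any N 1 (u @ [a]) as)"
      by (rule IH2) (use * in simp)
    moreover have "polynomial_in (\<lambda>N. low_high_any N 1 u [a] as)"
      by (rule IH1) (use * in simp_all)
    ultimately show "polynomial_in (\<lambda>N. low_any N 1 u (a # as))"
      unfolding low_any_Cons by (intro polynomial_in_intros)
  qed
qed

text \<open>Subtracting the term in which no letter gets the new label removes the only moment of
  full length, so that polynomiality can be proved by induction on the length.\<close>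

lemma polynomial_difference_aux:
  assumes "\<forall>bs. length bs < length (u @ as) \<longrightarrow> polynomial_in (\<lambda>N. G N bs)"
  shows "polynomial_in (\<lambda>N. low_any N 1 u as - G N (u @ as))"
  using assms
proof (induction as arbitrary: u)
  case Nil
  then show ?case by (simp add: low_any_Nil polynomial_in_intros)
next
  case (Cons a as)
  have "polynomial_in (\<lambda>N. (low_any N 1 (u @ [a]) as - G N ((u @ [a]) @ as)) + low_high_any N 1 u [a] as)"
  proof (intro polynomial_in_intros(2) Cons.IH)
    show "\<forall>bs. length bs < length ((u @ [a]) @ as) \<longrightarrow> polynomial_in (\<lambda>N. G N bs)"
      using Cons.prems by simp
    show "polynomial_in (\<lambda>N. low_high_any N 1 u [a] as)"
      by (rule polynomial_aux[THEN conjunct1, rule_format]) (use Cons.prems in simp_all)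
  qed
  then show ?case by (simp add: low_any_Cons algebra_simps)
qed

lemma polynomial_G: "polynomial_in (\<lambda>N. G N as)"
proof (induction "length as" arbitrary: as rule: less_induct)
  case less
  have "polynomial_in (\<lambda>N. low_any N 1 [] as - G N ([] @ as))"
  proof (rule polynomial_difference_aux, intro allI impI)
    fix bs :: "'a list" assume "length bs < length ([] @ as)"
    then show "polynomial_in (\<lambda>N. G N bs)" by (intro less.hyps) simp
  qed
  moreover have "low_any N 1 [] as = G (Suc N) as" for N
    using G_plus[of N 1 as] by simp
  ultimately have "polynomial_in (\<lambda>N. G (Suc N) as - G N as)"
    by (simp only: append_Nil)
  then show ?case by (rule polynomial_in_differences)
qed

definition GP :: "'a list \<Rightarrow> complex poly" where
  "GP as = (SOME p. \<forall>N. G N as = poly p (of_nat N))"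

lemma GP: "G N as = poly (GP as) (of_nat N)"
  unfolding GP_def
  by (rule someI_ex[OF polynomial_G[unfolded polynomial_in_def], THEN spec])

lemma linear_coefficient_G: "linear_coefficient (\<lambda>N. G N as) = coeff (GP as) 1"
  by (rule linear_coefficient_eq) (rule GP)

lemma GP_Nil: "GP [] = 1"
  by (rule poly_eq_of_nat[of 0]) (simp add: GP[symmetric] G_def g_Nil)

text \<open>With no copies, the sum over labellings of a nonempty tuple is empty.\<close>

lemma GP_0: "as \<noteq> [] \<Longrightarrow> coeff (GP as) 0 = 0"
  using GP[of 0 as] by (cases as) (simp_all add: G_def poly_0_coeff_0)

lemma coefficients01_G: "as \<noteq> [] \<Longrightarrow> coefficients01 (\<lambda>N. G N as) 0 (coeff (GP as) 1)"
  unfolding coefficients01_def using GP GP_0 by blast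

end

lemma (in block_system) block_system_h: "block_system h h"
proof
  fix N and u p x :: "(nat \<times> 'a) list"
  assume 1: "fst ` set u \<subseteq> {..<N}" "fst ` set p \<subseteq> {N..}" "x = [] \<or> fst (hd x) < N"
  show "h (u @ p @ x) = h p * h (u @ x) + (h p - h p) * h u * h x"
    using block_h[OF 1] by simp
  show "h (u @ p @ x) = h p * h (u @ x)" by (rule block_h[OF 1])
qed (simp_all add: h_Nil shift)

section \<open>The differential equation for the moments\<close>

context block_system
begin

interpretation hh: block_system h h by (rule block_system_h)

definition HP :: "'a list \<Rightarrow> complex poly" where "HP = hh.GP"

lemma hh_G: "hh.G = H"
  by (simp add: fun_eq_iff hh.G_def H_def)

lemma HP: "H N as = poly (HP as) (of_nat N)"
  using hh.GP by (simp add: HP_def hh_G)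

lemma coefficients01_H: "as \<noteq> [] \<Longrightarrow> coefficients01 (\<lambda>N. H N as) 0 (coeff (HP as) 1)"
  using hh.coefficients01_G by (simp add: HP_def hh_G)

definition kg :: "'a list \<Rightarrow> complex" where "kg p = coeff (GP p) 1"
definition kh :: "'a list \<Rightarrow> complex" where "kh p = coeff (HP p) 1"

text \<open>The coefficient of \<open>M\<close> in the block rule when \<open>p\<close> is the only
  upper run: for nonempty \<open>p\<close>, \<open>H M p\<close> and \<open>G M p\<close> vanish at
  \<open>M = 0\<close> and have linear coefficients \<open>kh p\<close> and
  \<open>kg p\<close>.\<close>

definition insertion :: "nat \<Rightarrow> 'a list \<Rightarrow> 'a list \<Rightarrow> 'a list \<Rightarrow> complex" where
  "insertion N u p x = kh p * G N (u @ x) + (kg p - kh p) * G N u * G N x"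

text \<open>Every upper run contributes a factor without constant term in \<open>M\<close>, so the
  linear coefficient sees exactly one run. The first sum chooses where the pending run ends, the
  second where a run starts and how long it is.\<close>

lemma coefficients01_low:
  "(\<forall>u p. p \<noteq> [] \<longrightarrow> coefficients01 (\<lambda>M. low_high_any N M u p as) 0
      (\<Sum>m<Suc (length as). insertion N u (p @ take m as) (drop m as))) \<and>
   (\<forall>u. coefficients01 (\<lambda>M. low_any N M u as) (G N (u @ as))
      (\<Sum>l<length as. \<Sum>m<length as - l.
        insertion N (u @ take l as) (take (Suc m) (drop l as)) (drop (l + Suc m) as)))"
proof (induction as)
  case Nil
  show ?case
  proof (intro conjI allI impI)
    fix u p :: "'a list" assume "p \<noteq> []"
    from coefficients01_mult[OF coefficients01_const[of "G N u"] coefficients01_G[OF this]]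
    show "coefficients01 (\<lambda>M. low_high_any N M u p []) 0
      (\<Sum>m<Suc (length []). insertion N u (p @ take m []) (drop m []))"
      by (simp add: low_high_any_Nil insertion_def kg_def G_def g_Nil algebra_simps)
  qed (simp add: low_any_Nil coefficients01_const)
next
  case (Cons a as)
  have IH1: "coefficients01 (\<lambda>M. low_high_any N M u p as) 0
      (\<Sum>m<Suc (length as). insertion N u (p @ take m as) (drop m as))" if "p \<noteq> []" for u p
    using Cons that by blast
  have IH2: "coefficients01 (\<lambda>M. low_any N M u as) (G N (u @ as))
      (\<Sum>l<length as. \<Sum>m<length as - l.
        insertion N (u @ take l as) (take (Suc m) (drop l as)) (drop (l + Suc m) as))" for u
    using Cons by blast
  show ?case
  proof (intro conjI allI impI)
    fix u p :: "'a list" assume p: "p \<noteq> []"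
    note c1 = coefficients01_mult[OF coefficients01_H[OF p] IH2[of "u @ [a]"]]
    note c2 = coefficients01_mult[OF coefficients01_mult[OF coefficients01_diff[OF
        coefficients01_G[OF p] coefficients01_H[OF p]] coefficients01_const[of "G N u"]] IH2[of "[a]"]]
    have "coefficients01 (\<lambda>M. low_high_any N M u (p @ [a]) as) 0
      (\<Sum>m<Suc (length as). insertion N u ((p @ [a]) @ take m as) (drop m as))"
      by (rule IH1) simp
    \<comment> \<open>The summand \<open>m = 0\<close> is the run that ends before \<open>a\<close>;
      the others come from the run extended by \<open>a\<close>.\<close>
    from coefficients01_add[OF this coefficients01_add[OF c1 c2]]
    show "coefficients01 (\<lambda>M. low_high_any N M u p (a # as)) 0
      (\<Sum>m<Suc (length (a # as)). insertion N u (p @ take m (a # as)) (drop m (a # as)))"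
      by (simp only: low_high_any_Cons length_Cons sum.lessThan_Suc_shift[of _ "Suc (length as)"])
        (simp add: insertion_def kg_def kh_def add.commute del: sum.lessThan_Suc)
  next
    fix u :: "'a list"
    have "coefficients01 (\<lambda>M. low_high_any N M u [a] as) 0
      (\<Sum>m<Suc (length as). insertion N u ([a] @ take m as) (drop m as))"
      by (rule IH1) simp
    from coefficients01_add[OF this IH2[of "u @ [a]"]]
    show "coefficients01 (\<lambda>M. low_any N M u (a # as)) (G N (u @ a # as))
      (\<Sum>l<length (a # as). \<Sum>m<length (a # as) - l.
        insertion N (u @ take l (a # as)) (take (Suc m) (drop l (a # as))) (drop (l + Suc m) (a # as)))"
      unfolding low_any_Cons length_Cons
      by (subst sum.lessThan_Suc_shift)
        (simp add: add.commute[of _ "low_high_any _ _ _ _ _"] del: sum.lessThan_Suc)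
  qed
qed

lemma coeff_1_shift: "coeff (p \<circ>\<^sub>p [:c, 1:]) 1 = poly (pderiv p) (c :: complex)"
proof -
  have "coeff (p \<circ>\<^sub>p [:c, 1:]) 1 = coeff (pderiv (p \<circ>\<^sub>p [:c, 1:])) 0"
    by (simp add: coeff_pderiv)
  also have "\<dots> = poly (pderiv p) c"
    by (simp add: pderiv_pcompose pderiv_pCons poly_pcompose flip: poly_0_coeff_0)
  finally show ?thesis .
qed

theorem pderiv_GP:
  "pderiv (GP as) = (\<Sum>l<length as. \<Sum>m<length as - l.
    (let u = take l as; p = take (Suc m) (drop l as); x = drop (l + Suc m) as in
      smult (kh p) (GP (u @ x)) + smult (kg p - kh p) (GP u * GP x)))"
proof (rule poly_eq_of_nat)
  fix N :: nat
  obtain q where q: "\<And>M. low_any N M [] as = poly q (of_nat M)"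
    and "coeff q 1 = (\<Sum>l<length as. \<Sum>m<length as - l.
        insertion N ([] @ take l as) (take (Suc m) (drop l as)) (drop (l + Suc m) as))"
    using coefficients01_low[of N as] unfolding coefficients01_def by blast
  \<comment> \<open>Both polynomials interpolate \<open>G (N + M) as\<close> as a function of
    \<open>M\<close>, so the linear coefficient of \<open>q\<close> is the derivative of
    \<open>GP as\<close> at \<open>N\<close>.\<close>
  moreover have "q = GP as \<circ>\<^sub>p [:of_nat N, 1:]"
  proof (rule poly_eq_of_nat)
    fix M show "poly q (of_nat M) = poly (GP as \<circ>\<^sub>p [:of_nat N, 1:]) (of_nat M)"
      using q[of M] GP[of "N + M" as] by (simp add: poly_pcompose G_plus)
  qed
  ultimately show "poly (pderiv (GP as)) (of_nat N) = poly (\<Sum>l<length as. \<Sum>m<length as - l.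
    (let u = take l as; p = take (Suc m) (drop l as); x = drop (l + Suc m) as in
      smult (kh p) (GP (u @ x)) + smult (kg p - kh p) (GP u * GP x))) (of_nat N)"
    by (simp add: coeff_1_shift[symmetric] poly_sum Let_def insertion_def GP mult.assoc)
qed

end

section \<open>Monotone partitions\<close>

text \<open>Arbitrary ground sets are allowed because removing or separating blocks leaves sets that
  are not initial segments. The order condition is a \<open>sorted_wrt\<close>, which behaves well
  under appending a block and under filtering.\<close>

definition monotone_partition_on :: "nat set \<Rightarrow> nat set list \<Rightarrow> bool" where
  "monotone_partition_on A \<pi> \<longleftrightarrow> distinct \<pi> \<and> partition_on A (set \<pi>) \<and> noncrossing (set \<pi>) \<and>
     sorted_wrt (\<lambda>P Q. \<not> covers Q P) \<pi>"

definition crosses :: "nat set \<Rightarrow> nat set \<Rightarrow> bool" where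
  "crosses P Q \<longleftrightarrow> (\<exists>i j k l. i < j \<and> j < k \<and> k < l \<and> i \<in> P \<and> k \<in> P \<and> j \<in> Q \<and> l \<in> Q)"

lemma noncrossing_iff: "noncrossing \<sigma> \<longleftrightarrow> (\<forall>P\<in>\<sigma>. \<forall>Q\<in>\<sigma>. P \<noteq> Q \<longrightarrow> \<not> crosses P Q)"
proof -
  have "noncrossing \<sigma> \<longleftrightarrow> \<not> (\<exists>P\<in>\<sigma>. \<exists>Q\<in>\<sigma>. P \<noteq> Q \<and> crosses P Q)"
    unfolding noncrossing_def crosses_def by (rule refl)
  then show ?thesis by blast
qed

lemma crossesI:
  "i < j \<Longrightarrow> j < k \<Longrightarrow> k < l \<Longrightarrow> i \<in> P \<Longrightarrow> k \<in> P \<Longrightarrow> j \<in> Q \<Longrightarrow> l \<in> Q \<Longrightarrow> crosses P Q"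
  unfolding crosses_def by blast

lemma covers_irrefl: "\<not> covers P P"
  by (auto simp: covers_def)

lemma monotone_partitions_iff: "\<pi> \<in> monotone_partitions n \<longleftrightarrow> monotone_partition_on {..<n} \<pi>"
proof -
  have "(\<forall>i<length \<pi>. \<forall>j<length \<pi>. covers (\<pi> ! i) (\<pi> ! j) \<longrightarrow> i < j) \<longleftrightarrow>
      sorted_wrt (\<lambda>P Q. \<not> covers Q P) \<pi>"
    unfolding sorted_wrt_iff_nth_less
  proof (intro iffI allI impI notI)
    fix i j assume *: "\<forall>i<length \<pi>. \<forall>j<length \<pi>. covers (\<pi> ! i) (\<pi> ! j) \<longrightarrow> i < j"
      and "i < j" "j < length \<pi>" "covers (\<pi> ! j) (\<pi> ! i)"
    then have "j < i" by (meson less_trans)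
    then show False using \<open>i < j\<close> by simp
  next
    fix i j assume *: "\<forall>i j. i < j \<longrightarrow> j < length \<pi> \<longrightarrow> \<not> covers (\<pi> ! j) (\<pi> ! i)"
      and "i < length \<pi>" "j < length \<pi>" "covers (\<pi> ! i) (\<pi> ! j)"
    then have "\<not> j < i" "i \<noteq> j" using covers_irrefl by auto
    then show "i < j" by simp
  qed
  then show ?thesis
    by (auto simp: monotone_partitions_def monotone_partition_on_def ordered_set_partition_def)
qed

lemma monotone_partitions_eq: "monotone_partitions n = {\<pi>. monotone_partition_on {..<n} \<pi>}"
  using monotone_partitions_iff by auto

lemma finite_monotone_partition_on: "finite A \<Longrightarrow> finite {\<pi>. monotone_partition_on A \<pi>}"
  by (rule finite_subset[OF _ finite_subset_distinct[of "Pow A"]])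
    (auto simp: monotone_partition_on_def partition_on_def)

lemma monotone_partition_on_empty: "monotone_partition_on {} \<pi> \<longleftrightarrow> \<pi> = []"
  by (auto simp: monotone_partition_on_def partition_on_empty noncrossing_def)

lemma covers_image:
  assumes "strict_mono_on A f" "P \<subseteq> A" "Q \<subseteq> A"
  shows "covers (f ` P) (f ` Q) \<longleftrightarrow> covers P Q"
proof -
  have "f i < f k \<longleftrightarrow> i < k" if "i \<in> A" "k \<in> A" for i k
    using strict_mono_on_less[OF assms(1) that] .
  with assms(2,3) show ?thesis unfolding covers_def by (simp add: subset_iff)
qed

lemma noncrossing_image:
  assumes "strict_mono_on A f" "\<Union>\<sigma> \<subseteq> A" "noncrossing \<sigma>"
  shows "noncrossing ((`) f ` \<sigma>)"
  unfolding noncrossing_iff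
proof (intro ballI impI notI, elim imageE)
  fix P' Q' P Q
  assume 1: "P' \<noteq> Q'" "P \<in> \<sigma>" "Q \<in> \<sigma>" "P' = f ` P" "Q' = f ` Q" and "crosses P' Q'"
  then obtain i j k l where *: "i \<in> P" "k \<in> P" "j \<in> Q" "l \<in> Q" "f i < f j" "f j < f k" "f k < f l"
    unfolding crosses_def by blast
  then have "i \<in> A" "j \<in> A" "k \<in> A" "l \<in> A" using assms(2) 1 by auto
  then have "i < j" "j < k" "k < l" using * strict_mono_on_less[OF assms(1)] by auto
  then have "crosses P Q" using * by (intro crossesI)
  then show False using 1 assms(3) unfolding noncrossing_iff by blast
qed

lemma monotone_partition_on_image:
  assumes "strict_mono_on A f" "monotone_partition_on A \<pi>"
  shows "monotone_partition_on (f ` A) (map ((`) f) \<pi>)"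
proof -
  have part: "partition_on A (set \<pi>)" and U: "\<Union>(set \<pi>) = A" and ne: "{} \<notin> set \<pi>"
    using assms(2) by (auto simp: monotone_partition_on_def partition_on_def)
  have inj: "inj_on f A" by (rule strict_mono_on_imp_inj_on[OF assms(1)])
  have "inj_on ((`) f) (set \<pi>)"
    using inj U by (intro inj_on_image) auto
  moreover have "(`) f ` set \<pi> - {{}} = (`) f ` set \<pi>" using ne by auto
  then have "partition_on (f ` A) ((`) f ` set \<pi>)"
    using partition_on_inj_image[OF part inj] by simp
  moreover have "sorted_wrt (\<lambda>P Q. \<not> covers Q P) (map ((`) f) \<pi>)"
    unfolding sorted_wrt_map
  proof (rule sorted_wrt_mono_rel)
    show "sorted_wrt (\<lambda>P Q. \<not> covers Q P) \<pi>" using assms(2) by (simp add: monotone_partition_on_def)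
    show "\<not> covers (f ` Q) (f ` P)" if "P \<in> set \<pi>" "Q \<in> set \<pi>" "\<not> covers Q P" for P Q
      using that U by (subst covers_image[OF assms(1)]) auto
  qed
  ultimately show ?thesis
    using assms U by (auto simp: monotone_partition_on_def distinct_map intro: noncrossing_image)
qed

lemma inner_blocks_image:
  assumes "strict_mono_on A f" "\<Union>\<sigma> \<subseteq> A"
  shows "inner_blocks ((`) f ` \<sigma>) = (`) f ` inner_blocks \<sigma>"
proof -
  have "covers (f ` P') (f ` P) \<longleftrightarrow> covers P' P" if "P \<in> \<sigma>" "P' \<in> \<sigma>" for P P'
    by (rule covers_image[OF assms(1)]) (use that assms(2) in auto)
  then show ?thesis unfolding inner_blocks_def by auto
qed

lemma outer_blocks_image:
  assumes "strict_mono_on A f" "\<Union>\<sigma> \<subseteq> A"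
  shows "outer_blocks ((`) f ` \<sigma>) = (`) f ` outer_blocks \<sigma>"
proof -
  have "inj_on ((`) f) \<sigma>"
    using strict_mono_on_imp_inj_on[OF assms(1)] assms(2)
    by (intro inj_on_image) (rule inj_on_subset)
  then show ?thesis unfolding outer_blocks_def inner_blocks_image[OF assms]
    by (subst inj_on_image_set_diff) (auto simp: inner_blocks_def)
qed

definition partition_weight ::
  "('a list \<Rightarrow> complex) \<Rightarrow> ('a list \<Rightarrow> complex) \<Rightarrow> (nat set \<Rightarrow> 'a list) \<Rightarrow> nat set list \<Rightarrow> complex" where
  "partition_weight k \<kappa> r \<pi> =
    (\<Prod>P\<in>outer_blocks (set \<pi>). k (r P)) * (\<Prod>P\<in>inner_blocks (set \<pi>). \<kappa> (r P))"

lemma partition_weight_cong: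
  assumes "\<And>P. P \<in> set \<pi> \<Longrightarrow> r P = r' P"
  shows "partition_weight k \<kappa> r \<pi> = partition_weight k \<kappa> r' \<pi>"
  unfolding partition_weight_def
  by (intro arg_cong2[where f = "(*)"] prod.cong refl)
    (auto simp: assms inner_blocks_def outer_blocks_def)

lemma partition_weight_image:
  assumes "strict_mono_on A f" "\<Union>(set \<pi>) \<subseteq> A"
    and "\<And>P. P \<in> set \<pi> \<Longrightarrow> r (f ` P) = r' P"
  shows "partition_weight k \<kappa> r (map ((`) f) \<pi>) = partition_weight k \<kappa> r' \<pi>"
proof -
  have inj: "inj_on ((`) f) (set \<pi>)"
    using strict_mono_on_imp_inj_on[OF assms(1)] assms(2)
    by (intro inj_on_image) (rule inj_on_subset)
  have sub: "outer_blocks (set \<pi>) \<subseteq> set \<pi>" "inner_blocks (set \<pi>) \<subseteq> set \<pi>"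
    by (auto simp: outer_blocks_def inner_blocks_def)
  have "(\<Prod>P\<in>(`) f ` S. g (r P)) = (\<Prod>P\<in>S. g (r' P))" if "S \<subseteq> set \<pi>" for S and g :: "'a list \<Rightarrow> complex"
    using that assms(3) by (subst prod.reindex[OF inj_on_subset[OF inj]]) (auto intro!: prod.cong)
  then show ?thesis
    using sub by (simp add: partition_weight_def outer_blocks_image[OF assms(1,2)]
        inner_blocks_image[OF assms(1,2)])
qed

text \<open>A block that is an interval covers nothing and crosses nothing, so it may be appended to or
  removed from the end of a monotone partition.\<close>

lemma monotone_partition_on_snoc:
  assumes "A \<inter> P = {}" "P \<noteq> {}" "\<And>x y z. x \<in> P \<Longrightarrow> y \<in> P \<Longrightarrow> x < z \<Longrightarrow> z < y \<Longrightarrow> z \<in> P"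
  shows "P \<notin> set \<pi> \<and> monotone_partition_on (A \<union> P) (\<pi> @ [P]) \<longleftrightarrow> monotone_partition_on A \<pi>"
proof -
  \<comment> \<open>\<open>insert P\<close> would hide another occurrence of \<open>P\<close>, so
    nonmembership is carried along.\<close>
  have part: "P \<notin> set \<pi> \<and> partition_on (A \<union> P) (insert P (set \<pi>)) \<longleftrightarrow> partition_on A (set \<pi>)"
  proof (cases "disjnt P (\<Union>(set \<pi>))")
    case True
    then have "partition_on (A \<union> P) (insert P (set \<pi>)) \<longleftrightarrow> partition_on (A \<union> P - P) (set \<pi>)"
      using assms(2) by (subst partition_on_insert) auto
    moreover have "A \<union> P - P = A" using assms(1) by auto
    moreover have "P \<notin> set \<pi>" using True assms(2) by (auto simp: disjnt_def)
    ultimately show ?thesis by simp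
  next
    case False
    then have "\<not> partition_on A (set \<pi>)"
      using assms(1) by (auto simp: partition_on_def disjnt_def)
    moreover have "\<not> (P \<notin> set \<pi> \<and> partition_on (A \<union> P) (insert P (set \<pi>)))"
      using False by (auto simp: partition_on_def pairwise_insert disjnt_def)
    ultimately show ?thesis by blast
  qed
  have "noncrossing (insert P (set \<pi>)) \<longleftrightarrow> noncrossing (set \<pi>)" if "partition_on A (set \<pi>)"
  proof -
    have dis: "Q \<inter> P = {}" if "Q \<in> set \<pi>" for Q
      using that \<open>partition_on A (set \<pi>)\<close> assms(1) by (auto simp: partition_on_def)
    have "\<not> crosses P Q" "\<not> crosses Q P" if "Q \<in> set \<pi>" for Q
      using dis[OF that] assms(3) unfolding crosses_def by blast+
    then show ?thesis unfolding noncrossing_iff by auto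
  qed
  moreover have "\<not> covers P Q" if "Q \<in> set \<pi>" "partition_on A (set \<pi>)" for Q
  proof
    assume "covers P Q"
    then obtain i j where ij: "i \<in> P" "j \<in> P" "\<forall>k\<in>Q. i < k \<and> k < j" by (auto simp: covers_def)
    have "Q \<noteq> {}" "Q \<inter> P = {}" using that assms(1) by (auto simp: partition_on_def)
    then obtain q where "q \<in> Q" "q \<notin> P" by blast
    then show False using ij assms(3) by blast
  qed
  ultimately show ?thesis
    using part unfolding monotone_partition_on_def by (auto simp: sorted_wrt_append)
qed

text \<open>The block through \<open>z\<close> cannot leave the gap between \<open>x\<close> and
  \<open>y\<close> without crossing \<open>P\<close>. This serves both the last block of a monotone
  partition and partitions without inner blocks.\<close>

lemma noncrossing_gap_covers:
  assumes "partition_on A \<sigma>" "noncrossing \<sigma>" "P \<in> \<sigma>" "x \<in> P" "y \<in> P" "x < z" "z < y" "z \<in> A" "z \<notin> P"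
  obtains Q where "Q \<in> \<sigma>" "Q \<noteq> P" "covers P Q"
proof -
  obtain Q where Q: "Q \<in> \<sigma>" "z \<in> Q" using assms(1,8) by (auto simp: partition_on_def)
  have "P \<noteq> Q" using assms(9) Q(2) by auto
  moreover from this have "disjnt P Q"
    using pairwiseD[OF partition_onD2[OF assms(1)] assms(3) Q(1)] by simp
  ultimately have PQ: "P \<noteq> Q" "P \<inter> Q = {}" by (simp_all add: disjnt_def)
  have nx: "\<not> crosses P Q" "\<not> crosses Q P"
    using assms(2,3) Q(1) PQ(1) by (auto simp: noncrossing_iff)
  have "\<forall>q\<in>Q. x < q \<and> q < y"
  proof
    fix q assume q: "q \<in> Q"
    then have "q \<noteq> x" "q \<noteq> y" using PQ assms(4,5) by auto
    moreover have "\<not> q < x" using nx(2) crossesI[of q x z y Q P] q assms(4-7) Q(2) by blast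
    moreover have "\<not> y < q" using nx(1) crossesI[of x z y q P Q] q assms(4-7) Q(2) by blast
    ultimately show "x < q \<and> q < y" by auto
  qed
  then have "covers P Q" unfolding covers_def using assms(4,5) by blast
  then show thesis using that[OF Q(1)] PQ(1) by blast
qed

lemma convex_eq_interval:
  fixes P :: "nat set"
  assumes "finite P" "P \<noteq> {}" "\<And>x y z. x \<in> P \<Longrightarrow> y \<in> P \<Longrightarrow> x < z \<Longrightarrow> z < y \<Longrightarrow> z \<in> P"
  shows "P = {Min P..Max P}"
proof (intro equalityI subsetI)
  note min_max = Min_in[OF assms(1,2)] Max_in[OF assms(1,2)]
  fix z assume "z \<in> {Min P..Max P}"
  then have "z = Min P \<or> z = Max P \<or> Min P < z \<and> z < Max P" by auto
  then show "z \<in> P" using assms(3)[OF min_max, of z] min_max by blast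
qed (use assms(1) in auto)

text \<open>A gap in \<open>P\<close> would contain a block covered by \<open>P\<close>, and no
  earlier block may be covered by a later one. The length is written \<open>Suc m\<close> because
  blocks are nonempty.\<close>

lemma last_block_interval:
  assumes "monotone_partition_on {..<n} (\<pi> @ [P])"
  obtains l m where "P = {l..<l + Suc m}" "l < n" "m < n - l"
proof -
  have part: "partition_on {..<n} (insert P (set \<pi>))" and nc: "noncrossing (insert P (set \<pi>))"
    and cov: "\<And>Q. Q \<in> set \<pi> \<Longrightarrow> \<not> covers P Q"
    using assms by (auto simp: monotone_partition_on_def sorted_wrt_append)
  have P: "P \<noteq> {}" "P \<subseteq> {..<n}" using part by (auto simp: partition_on_def)
  then have fin: "finite P" using finite_subset by blast
  have "z \<in> P" if xy: "x \<in> P" "y \<in> P" "x < z" "z < y" for x y z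
  proof (rule ccontr)
    assume "z \<notin> P"
    moreover have "z \<in> {..<n}" using P(2) xy by (auto dest: less_trans)
    ultimately obtain Q where "Q \<in> insert P (set \<pi>)" "Q \<noteq> P" "covers P Q"
      using noncrossing_gap_covers[OF part nc insertI1 xy] by blast
    then show False using cov by blast
  qed
  then have "P = {Min P..Max P}" by (rule convex_eq_interval[OF fin P(1)])
  moreover have "Min P \<le> Max P" "Max P < n" using fin P by auto
  ultimately obtain a b where "P = {a..b}" "a \<le> b" "b < n" by blast
  then show thesis by (intro that[of a "b - a"]) auto
qed

section \<open>Inserting and deleting an interval block\<close>

definition skip :: "nat \<Rightarrow> nat \<Rightarrow> nat \<Rightarrow> nat" where
  "skip l m x = (if x < l then x else x + m)"

definition unskip :: "nat \<Rightarrow> nat \<Rightarrow> nat \<Rightarrow> nat" where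
  "unskip l m x = (if x < l then x else x - m)"

lemma strict_mono_skip: "strict_mono_on A (skip l m)"
  by (auto simp: skip_def strict_mono_on_def)

lemma strict_mono_unskip: "strict_mono_on ({..<n} - {l..<l + m}) (unskip l m)"
  by (auto simp: unskip_def strict_mono_on_def)

lemma skip_image: "l + m \<le> n \<Longrightarrow> skip l m ` {..<n - m} = {..<n} - {l..<l + m}"
proof (intro equalityI subsetI)
  fix x assume "l + m \<le> n" "x \<in> {..<n} - {l..<l + m}"
  then show "x \<in> skip l m ` {..<n - m}"
    by (intro image_eqI[of _ _ "if x < l then x else x - m"]) (auto simp: skip_def)
qed (auto simp: skip_def split: if_splits)

lemma unskip_skip: "unskip l m (skip l m x) = x"
  by (simp add: skip_def unskip_def)

lemma skip_unskip: "x \<notin> {l..<l + m} \<Longrightarrow> skip l m (unskip l m x) = x"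
  by (auto simp: skip_def unskip_def)

lemma unskip_image: "l + m \<le> n \<Longrightarrow> unskip l m ` ({..<n} - {l..<l + m}) = {..<n - m}"
  by (subst skip_image[symmetric]) (simp_all add: image_image unskip_skip)

lemma monotone_partition_on_insert:
  assumes "l + Suc m \<le> n" "monotone_partition_on {..<n - Suc m} \<pi>"
  shows "monotone_partition_on {..<n} (map ((`) (skip l (Suc m))) \<pi> @ [{l..<l + Suc m}])"
proof -
  let ?P = "{l..<l + Suc m}"
  have "monotone_partition_on ({..<n} - ?P) (map ((`) (skip l (Suc m))) \<pi>)"
    using monotone_partition_on_image[OF strict_mono_skip[of _ l "Suc m"] assms(2)]
    unfolding skip_image[OF assms(1)] .
  then have "monotone_partition_on (({..<n} - ?P) \<union> ?P) (map ((`) (skip l (Suc m))) \<pi> @ [?P])"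
    by (subst (asm) monotone_partition_on_snoc[symmetric, of _ ?P]) auto
  moreover have "({..<n} - ?P) \<union> ?P = {..<n}" using assms(1) by auto
  ultimately show ?thesis by simp
qed

lemma monotone_partition_on_delete:
  assumes "monotone_partition_on {..<n} (\<pi> @ [{l..<l + Suc m}])" "l + Suc m \<le> n"
  shows "monotone_partition_on {..<n - Suc m} (map ((`) (unskip l (Suc m))) \<pi>)"
    and "map ((`) (skip l (Suc m))) (map ((`) (unskip l (Suc m))) \<pi>) = \<pi>"
proof -
  let ?P = "{l..<l + Suc m}"
  have eq: "({..<n} - ?P) \<union> ?P = {..<n}" using assms(2) by auto
  have "?P \<notin> set \<pi>" using assms(1) by (auto simp: monotone_partition_on_def)
  then have \<pi>: "monotone_partition_on ({..<n} - ?P) \<pi>"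
    using assms(1) by (subst monotone_partition_on_snoc[symmetric, of _ ?P], unfold eq) auto
  show "monotone_partition_on {..<n - Suc m} (map ((`) (unskip l (Suc m))) \<pi>)"
    using monotone_partition_on_image[OF strict_mono_unskip \<pi>] unfolding unskip_image[OF assms(2)] .
  have "skip l (Suc m) ` unskip l (Suc m) ` Q = Q" if "Q \<in> set \<pi>" for Q
  proof -
    have "Q \<subseteq> {..<n} - ?P" using \<pi> that by (auto simp: monotone_partition_on_def partition_on_def)
    then show ?thesis unfolding image_image by (subst image_cong[OF refl skip_unskip]) auto
  qed
  then show "map ((`) (skip l (Suc m))) (map ((`) (unskip l (Suc m))) \<pi>) = \<pi>"
    by (simp add: map_idI)
qed

text \<open>Deleting the last block and closing the gap is a bijection: the interval may have any
  position and length, and any monotone partition of the remaining points may precede it.\<close>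

lemma sum_monotone_partitions_peel:
  fixes F :: "nat set list \<Rightarrow> 'b::comm_monoid_add"
  assumes "n > 0"
  shows "(\<Sum>\<pi>\<in>monotone_partitions n. F \<pi>) =
    (\<Sum>l<n. \<Sum>m<n - l. \<Sum>\<pi>\<in>monotone_partitions (n - Suc m).
      F (map ((`) (skip l (Suc m))) \<pi> @ [{l..<l + Suc m}]))"
proof -
  let ?T = "SIGMA l:{..<n}. SIGMA m:{..<n - l}. monotone_partitions (n - Suc m)"
  let ?i = "\<lambda>(l, m, \<pi>). map ((`) (skip l (Suc m))) \<pi> @ [{l..<l + Suc m}]"
  let ?j = "\<lambda>\<pi>. let l = Min (last \<pi>); m = card (last \<pi>) - 1 in
    (l, m, map ((`) (unskip l (Suc m))) (butlast \<pi>))"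
  have "(\<Sum>\<pi>\<in>monotone_partitions n. F \<pi>) = (\<Sum>t\<in>?T. F (?i t))"
  proof (rule sum.reindex_bij_witness[of _ ?i ?j])
    fix \<pi> assume \<pi>: "\<pi> \<in> monotone_partitions n"
    then have "\<pi> \<noteq> []"
      using assms by (auto simp: monotone_partitions_iff monotone_partition_on_def partition_on_def)
    then obtain \<pi>' P where \<pi>': "\<pi> = \<pi>' @ [P]" by (metis append_butlast_last_id)
    with \<pi> obtain l m where lm: "P = {l..<l + Suc m}" "l < n" "m < n - l"
      using last_block_interval[of n \<pi>' P] by (auto simp: monotone_partitions_iff)
    have "Min P = l" "card P = Suc m" unfolding lm by (auto intro: Min_eqI)
    then have j: "?j \<pi> = (l, m, map ((`) (unskip l (Suc m))) \<pi>')" by (simp add: \<pi>' Let_def)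
    note del = monotone_partition_on_delete[of n \<pi>' l m]
    show "?i (?j \<pi>) = \<pi>" unfolding j using del(2) \<pi> \<pi>' lm
      by (simp add: monotone_partitions_iff del: map_map)
    show "?j \<pi> \<in> ?T" unfolding j using del(1) \<pi> \<pi>' lm
      by (simp add: monotone_partitions_iff)
    show "F (?i (?j \<pi>)) = F \<pi>" unfolding \<open>?i (?j \<pi>) = \<pi>\<close> ..
  next
    fix t assume "t \<in> ?T"
    then obtain l m \<pi> where t: "t = (l, m, \<pi>)" "l < n" "m < n - l"
      "monotone_partition_on {..<n - Suc m} \<pi>" by (auto simp: monotone_partitions_iff)
    have "Min {l..<l + Suc m} = l" by (rule Min_eqI) auto
    moreover have "map ((`) (\<lambda>x. x)) \<pi> = \<pi>" by (simp add: map_idI)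
    ultimately show "?j (?i t) = t"
      by (simp add: t Let_def image_image unskip_skip comp_def del: add_Suc_right)
    show "?i t \<in> monotone_partitions n"
      using t monotone_partition_on_insert[of l m n \<pi>] by (simp add: monotone_partitions_iff)
  qed
  also have "\<dots> = (\<Sum>l<n. \<Sum>m<n - l. \<Sum>\<pi>\<in>monotone_partitions (n - Suc m). F (?i (l, m, \<pi>)))"
    by (simp add: sum.Sigma monotone_partitions_eq finite_monotone_partition_on case_prod_unfold
        del: add_Suc_right)
  finally show ?thesis by simp
qed

lemma nths_cong: "(\<And>i. i < length xs \<Longrightarrow> i \<in> A \<longleftrightarrow> i \<in> B) \<Longrightarrow> nths xs A = nths xs B"
  unfolding nths_def by (intro arg_cong[where f = "map fst"] filter_cong) (auto simp: set_zip)

lemma nths_skip: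
  assumes "l + m \<le> length as"
  shows "nths as (skip l m ` Q) = nths (take l as @ drop (l + m) as) Q"
proof -
  have as: "as = take l as @ take m (drop l as) @ drop (l + m) as"
    by (metis append_assoc append_take_drop_id take_add)
  have len: "length (take l as) = l" "length (take m (drop l as)) = m" using assms by auto
  have "nths as (skip l m ` Q) = nths (take l as) (skip l m ` Q)
      @ nths (take m (drop l as)) {j. j + l \<in> skip l m ` Q}
      @ nths (drop (l + m) as) {j. j + m + l \<in> skip l m ` Q}"
    by (subst as) (simp only: nths_append len mem_Collect_eq)
  also have "nths (take l as) (skip l m ` Q) = nths (take l as) Q"
    using len by (intro nths_cong) (auto simp: skip_def image_iff split: if_splits)
  \<comment> \<open>No value of \<open>skip\<close> falls into the hole, so the middle part
    contributes nothing.\<close>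
  also have "nths (take m (drop l as)) {j. j + l \<in> skip l m ` Q} = nths (take m (drop l as)) {}"
    using len by (intro nths_cong) (auto simp: skip_def image_iff split: if_splits)
  also have "nths (drop (l + m) as) {j. j + m + l \<in> skip l m ` Q} =
      nths (drop (l + m) as) {j. j + l \<in> Q}"
    by (intro nths_cong) (auto simp: skip_def image_iff split: if_splits)
  finally show ?thesis by (simp only: nths_append len nths_empty append_Nil)
qed

lemma nths_block:
  assumes "l + m \<le> length as"
  shows "nths as {l..<l + m} = take m (drop l as)"
proof -
  have "(+) l ` {..<m} = {l..<l + m}" by (simp add: lessThan_atLeast0 add.commute)
  then show ?thesis using nths_drop[of l as "{..<m}"] by simp
qed

text \<open>Here \<open>l\<close> is the cut left by a deleted block after the gap is closed; the
  straddling blocks are those that cover the block once it is put back.\<close>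

definition straddles :: "nat \<Rightarrow> nat set \<Rightarrow> bool" where
  "straddles l Q \<longleftrightarrow> (\<exists>i\<in>Q. i < l) \<and> (\<exists>j\<in>Q. l \<le> j)"

text \<open>The inserted interval covers no block, so the others keep their status as inner or
  outer; the interval itself is inner exactly if some block straddles the cut.\<close>

lemma partition_weight_insert:
  assumes "l + Suc m \<le> length as" "monotone_partition_on {..<length as - Suc m} \<pi>"
  shows "partition_weight k \<kappa> (nths as) (map ((`) (skip l (Suc m))) \<pi> @ [{l..<l + Suc m}]) =
    partition_weight k \<kappa> (nths (take l as @ drop (l + Suc m) as)) \<pi> *
      (if \<exists>Q\<in>set \<pi>. straddles l Q then \<kappa> (take (Suc m) (drop l as)) else k (take (Suc m) (drop l as)))"
proof -
  let ?s = "skip l (Suc m)" and ?P = "{l..<l + Suc m}"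
  let ?\<sigma> = "(`) ?s ` set \<pi>"
  have P: "?P \<notin> ?\<sigma>"
  proof
    assume "?P \<in> ?\<sigma>"
    then obtain Q where "?P = ?s ` Q" by auto
    then have "l \<in> ?s ` Q" by (metis add_Suc_right atLeastLessThan_iff le_refl less_Suc_eq_le le_add1)
    then show False by (auto simp: skip_def split: if_splits)
  qed
  have ne: "{} \<notin> set \<pi>" using assms(2) by (auto simp: monotone_partition_on_def partition_on_def)
  have cP: "covers (?s ` Q) ?P \<longleftrightarrow> straddles l Q" for Q
  proof
    assume "covers (?s ` Q) ?P"
    then obtain i j where "i \<in> Q" "j \<in> Q" "\<forall>k\<in>?P. ?s i < k \<and> k < ?s j" by (auto simp: covers_def)
    then have "?s i < l" "l < ?s j" by auto
    then have "i < l" "l \<le> j" by (auto simp: skip_def split: if_splits)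
    then show "straddles l Q" using \<open>i \<in> Q\<close> \<open>j \<in> Q\<close> by (auto simp: straddles_def)
  next
    assume "straddles l Q"
    then obtain i j where "i \<in> Q" "i < l" "j \<in> Q" "l \<le> j" by (auto simp: straddles_def)
    then show "covers (?s ` Q) ?P" unfolding covers_def
      by (intro bexI[of _ "?s i"] bexI[of _ "?s j"]) (auto simp: skip_def)
  qed
  have cP': "\<not> covers ?P (?s ` Q)" if "Q \<in> set \<pi>" for Q
  proof
    assume "covers ?P (?s ` Q)"
    moreover have "Q \<noteq> {}" using ne that by auto
    then obtain q where "q \<in> Q" by blast
    ultimately have "l < ?s q" "?s q < l + Suc m" by (auto simp: covers_def)
    then show False by (auto simp: skip_def split: if_splits)
  qed
  have inner: "inner_blocks (insert ?P ?\<sigma>) =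
      (if \<exists>Q\<in>set \<pi>. straddles l Q then insert ?P (inner_blocks ?\<sigma>) else inner_blocks ?\<sigma>)"
    using cP cP' covers_irrefl by (auto simp: inner_blocks_def)
  have PI: "?P \<notin> inner_blocks ?\<sigma>" using P by (auto simp: inner_blocks_def)
  then have outer: "outer_blocks (insert ?P ?\<sigma>) =
      (if \<exists>Q\<in>set \<pi>. straddles l Q then outer_blocks ?\<sigma> else insert ?P (outer_blocks ?\<sigma>))"
    using P unfolding outer_blocks_def inner by auto
  have PO: "?P \<notin> outer_blocks ?\<sigma>" using P by (auto simp: outer_blocks_def)
  have fin2: "finite (inner_blocks ?\<sigma>)" "finite (outer_blocks ?\<sigma>)"
    by (auto simp: inner_blocks_def outer_blocks_def)
  have "partition_weight k \<kappa> (nths as) (map ((`) ?s) \<pi> @ [?P]) =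
      partition_weight k \<kappa> (nths as) (map ((`) ?s) \<pi>) *
      (if \<exists>Q\<in>set \<pi>. straddles l Q then \<kappa> (nths as ?P) else k (nths as ?P))"
    using PI PO fin2 by (simp add: partition_weight_def inner outer del: add_Suc_right)
  also have "partition_weight k \<kappa> (nths as) (map ((`) ?s) \<pi>) =
      partition_weight k \<kappa> (nths (take l as @ drop (l + Suc m) as)) \<pi>"
    by (rule partition_weight_image[OF strict_mono_skip]) (auto simp: nths_skip[OF assms(1)] simp del: add_Suc_right)
  finally show ?thesis by (simp add: nths_block[OF assms(1)] del: add_Suc_right)
qed

section \<open>Partitions that respect a cut\<close>

lemma sorted_wrt_filters:
  assumes "\<And>x y. x \<in> set zs \<Longrightarrow> y \<in> set zs \<Longrightarrow> p x \<noteq> p y \<Longrightarrow> R x y"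
  shows "sorted_wrt R zs \<longleftrightarrow> sorted_wrt R (filter p zs) \<and> sorted_wrt R (filter (\<lambda>x. \<not> p x) zs)"
  using assms
proof (induction zs)
  case (Cons z zs)
  have "sorted_wrt R zs \<longleftrightarrow> sorted_wrt R (filter p zs) \<and> sorted_wrt R (filter (\<lambda>x. \<not> p x) zs)"
    by (rule Cons.IH) (use Cons.prems in auto)
  then show ?case using Cons.prems by (cases "p z") auto
qed simp

lemma distinct_filters: "distinct zs \<longleftrightarrow> distinct (filter p zs) \<and> distinct (filter (\<lambda>x. \<not> p x) zs)"
proof -
  have "distinct zs" if "distinct (filter p zs)" "distinct (filter (\<lambda>x. \<not> p x) zs)"
    using that by (induction zs) (auto split: if_splits)
  then show ?thesis using distinct_filter by blast
qed

lemma no_cross_covers: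
  assumes "\<And>i j. i \<in> A \<Longrightarrow> j \<in> B \<Longrightarrow> i < (j :: nat)" "P \<noteq> {}" "Q \<noteq> {}"
    "P \<subseteq> A \<and> Q \<subseteq> B \<or> P \<subseteq> B \<and> Q \<subseteq> A"
  shows "\<not> covers P Q"
proof
  assume "covers P Q"
  then obtain i j q where "i \<in> P" "j \<in> P" "q \<in> Q" "i < q" "q < j"
    using assms(3) by (auto simp: covers_def)
  then show False using assms(1,4) by (meson less_asym subsetD)
qed

text \<open>Blocks on different sides of a cut neither cross nor cover each other, so all conditions
  hold side by side and the interleaving of the two lists is arbitrary.\<close>

lemma monotone_partition_on_union:
  assumes AB: "\<And>i j. i \<in> A \<Longrightarrow> j \<in> B \<Longrightarrow> i < j"
    and \<pi>: "\<forall>P\<in>set \<pi>. P \<noteq> {}" 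
  shows "monotone_partition_on (A \<union> B) \<pi> \<and> (\<forall>P\<in>set \<pi>. P \<subseteq> A \<or> P \<subseteq> B) \<longleftrightarrow>
    monotone_partition_on A (filter (\<lambda>P. P \<subseteq> A) \<pi>) \<and> monotone_partition_on B (filter (\<lambda>P. \<not> P \<subseteq> A) \<pi>)"
    (is "?L \<longleftrightarrow> ?R")
proof -
  let ?A = "{P \<in> set \<pi>. P \<subseteq> A}" and ?B = "{P \<in> set \<pi>. \<not> P \<subseteq> A}"
  have disj: "A \<inter> B = {}" using AB by force
  have sub: "\<forall>P\<in>set \<pi>. P \<subseteq> A \<or> P \<subseteq> B" if ?R
    using that by (auto simp: monotone_partition_on_def partition_on_def)
  have *: "?L \<longleftrightarrow> ?R" if sub: "\<forall>P\<in>set \<pi>. P \<subseteq> A \<or> P \<subseteq> B"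
  proof -
    have B: "P \<subseteq> B" if "P \<in> ?B" for P using that sub by auto
    have "partition_on (A \<union> B) (set \<pi>) \<longleftrightarrow> partition_on A ?A \<and> partition_on B ?B"
    proof -
      have "\<Union>(set \<pi>) = A \<union> B \<longleftrightarrow> \<Union>?A = A \<and> \<Union>?B = B"
      proof -
        have eq: "X \<union> Y = A \<union> B \<longleftrightarrow> X = A \<and> Y = B" if "X \<subseteq> A" "Y \<subseteq> B" for X Y
          using that disj by (intro iffI conjI equalityI) auto
        have "\<Union>(set \<pi>) = \<Union>?A \<union> \<Union>?B" by auto
        moreover have "\<Union>?A \<subseteq> A" "\<Union>?B \<subseteq> B" using B by auto
        ultimately show ?thesis using eq by simp
      qed
      moreover have "disjoint (set \<pi>) \<longleftrightarrow> disjoint ?A \<and> disjoint ?B"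
      proof -
        have "disjnt P Q" if "P \<in> ?A" "Q \<in> ?B" for P Q
          using that B disj by (fastforce simp: disjnt_def)
        then have "disjnt P Q \<or> P \<in> ?A \<and> Q \<in> ?A \<or> P \<in> ?B \<and> Q \<in> ?B"
          if "P \<in> set \<pi>" "Q \<in> set \<pi>" for P Q
          using that by (cases "P \<subseteq> A"; cases "Q \<subseteq> A") (auto simp: disjnt_sym)
        note split = this
        show ?thesis
        proof
          assume "disjoint (set \<pi>)"
          then show "disjoint ?A \<and> disjoint ?B" by (auto intro: pairwise_subset)
        next
          assume AB': "disjoint ?A \<and> disjoint ?B"
          show "disjoint (set \<pi>)"
          proof (rule pairwiseI)
            fix P Q assume PQ: "P \<in> set \<pi>" "Q \<in> set \<pi>" "P \<noteq> Q"
            from split[OF PQ(1,2)] show "disjnt P Q"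
              using pairwiseD[OF conjunct1[OF AB'], of P Q] pairwiseD[OF conjunct2[OF AB'], of P Q] PQ(3)
              by argo
          qed
        qed
      qed
      ultimately show ?thesis using \<pi> unfolding partition_on_def by auto
    qed
    moreover have "noncrossing (set \<pi>) \<longleftrightarrow> noncrossing ?A \<and> noncrossing ?B"
    proof
      show "noncrossing (set \<pi>)" if nc: "noncrossing ?A \<and> noncrossing ?B"
        unfolding noncrossing_iff
      proof (intro ballI impI notI)
        fix P Q assume PQ: "P \<in> set \<pi>" "Q \<in> set \<pi>" "P \<noteq> Q" "crosses P Q"
        then obtain i j k l where 1: "P \<in> set \<pi>" "Q \<in> set \<pi>" "P \<noteq> Q" "i < j" "j < k" "k < l" "i \<in> P" "k \<in> P" "j \<in> Q" "l \<in> Q"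
          unfolding crosses_def by blast
        consider "P \<in> ?A" "Q \<in> ?A" | "P \<in> ?B" "Q \<in> ?B" | "P \<subseteq> A" "Q \<subseteq> B" | "P \<subseteq> B" "Q \<subseteq> A"
          using 1(1,2) sub by blast
        then show False
        proof cases
          case 1 then show False using nc PQ unfolding noncrossing_iff by blast
        next
          case 2 then show False using nc PQ unfolding noncrossing_iff by blast
        next
          case 3 then have "k < j" using AB 1 by blast
          then show False using 1 by simp
        next
          case 4 then have "j < i" using AB 1 by blast
          then show False using 1 by simp
        qed
      qed
    qed (auto simp: noncrossing_iff)
    moreover have "sorted_wrt (\<lambda>P Q. \<not> covers Q P) \<pi> \<longleftrightarrow>
        sorted_wrt (\<lambda>P Q. \<not> covers Q P) (filter (\<lambda>P. P \<subseteq> A) \<pi>) \<and>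
        sorted_wrt (\<lambda>P Q. \<not> covers Q P) (filter (\<lambda>P. \<not> P \<subseteq> A) \<pi>)"
      by (rule sorted_wrt_filters, rule no_cross_covers[OF AB]) (use sub \<pi> in auto)
    moreover have "distinct \<pi> \<longleftrightarrow> distinct (filter (\<lambda>P. P \<subseteq> A) \<pi>) \<and> distinct (filter (\<lambda>P. \<not> P \<subseteq> A) \<pi>)"
      by (rule distinct_filters)
    ultimately show ?thesis
      unfolding monotone_partition_on_def set_filter using sub by satx
  qed
  show ?thesis using * sub by blast
qed

lemma partition_weight_union:
  assumes AB: "\<And>i j. i \<in> A \<Longrightarrow> j \<in> B \<Longrightarrow> i < j"
    and \<pi>1: "monotone_partition_on A \<pi>1" and \<pi>2: "monotone_partition_on B \<pi>2"
    and \<pi>: "set \<pi> = set \<pi>1 \<union> set \<pi>2"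
  shows "partition_weight k \<kappa> r \<pi> = partition_weight k \<kappa> r \<pi>1 * partition_weight k \<kappa> r \<pi>2"
proof -
  have 1: "P \<subseteq> A" "P \<noteq> {}" if "P \<in> set \<pi>1" for P
    using \<pi>1 that by (auto simp: monotone_partition_on_def partition_on_def)
  have 2: "P \<subseteq> B" "P \<noteq> {}" if "P \<in> set \<pi>2" for P
    using \<pi>2 that by (auto simp: monotone_partition_on_def partition_on_def)
  have no: "\<not> covers P Q \<and> \<not> covers Q P" if "P \<in> set \<pi>1" "Q \<in> set \<pi>2" for P Q
  proof
    show "\<not> covers P Q"
      by (rule no_cross_covers[where A = A and B = B, OF AB _ _ disjI1])
        (use 1[OF that(1)] 2[OF that(2)] in simp_all)
    show "\<not> covers Q P"
      by (rule no_cross_covers[where A = A and B = B, OF AB _ _ disjI2])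
        (use 1[OF that(1)] 2[OF that(2)] in simp_all)
  qed
  have disj: "set \<pi>1 \<inter> set \<pi>2 = {}"
  proof (rule equals0I)
    fix P assume "P \<in> set \<pi>1 \<inter> set \<pi>2"
    then have "P \<subseteq> A" "P \<subseteq> B" "P \<noteq> {}" using 1 2 by simp_all
    then obtain x where "x \<in> A" "x \<in> B" by auto
    then show False using AB[of x x] by simp
  qed
  have inner: "inner_blocks (set \<pi>) = inner_blocks (set \<pi>1) \<union> inner_blocks (set \<pi>2)"
    by (auto simp: inner_blocks_def \<pi>) (use no in blast)+
  have outer: "outer_blocks (set \<pi>) = outer_blocks (set \<pi>1) \<union> outer_blocks (set \<pi>2)"
    using disj by (auto simp: outer_blocks_def inner_blocks_def \<pi>) (use no in blast)+
  have sub: "inner_blocks (set \<pi>1) \<inter> inner_blocks (set \<pi>2) = {}"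
    "outer_blocks (set \<pi>1) \<inter> outer_blocks (set \<pi>2) = {}"
    using disj by (auto simp: inner_blocks_def outer_blocks_def)
  have fin: "finite (inner_blocks (set \<rho>))" "finite (outer_blocks (set \<rho>))" for \<rho>
    by (auto simp: inner_blocks_def outer_blocks_def)
  show ?thesis unfolding partition_weight_def inner outer
    by (simp add: prod.union_disjoint sub fin)
qed

section \<open>The generating polynomial of monotone partitions\<close>

definition partition_polynomial ::
  "('a list \<Rightarrow> complex) \<Rightarrow> ('a list \<Rightarrow> complex) \<Rightarrow> 'a list \<Rightarrow> complex poly" where
  "partition_polynomial k \<kappa> as = (\<Sum>\<pi>\<in>monotone_partitions (length as).
     monom (partition_weight k \<kappa> (nths as) \<pi> / fact (length \<pi>)) (length \<pi>))"

text \<open>Partitions respecting the cut are the shuffles of a left and a right partition. The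
  binomial number of shuffles turns the factorial of the total number of blocks into the product of
  the two factorials, so the generating polynomials multiply.\<close>

lemma partition_polynomial_split:
  "(\<Sum>\<pi>\<in>{\<pi> \<in> monotone_partitions (length (u @ x)). \<not> (\<exists>Q\<in>set \<pi>. straddles (length u) Q)}.
      monom (partition_weight k \<kappa> (nths (u @ x)) \<pi> / fact (length \<pi>)) (length \<pi>)) =
    partition_polynomial k \<kappa> u * partition_polynomial k \<kappa> x"
proof -
  let ?A = "{..<length u}" and ?B = "{length u..<length (u @ x)}"
  let ?MA = "monotone_partitions (length u)" and ?MB = "{\<pi>. monotone_partition_on ?B \<pi>}"
  let ?S = "{\<pi> \<in> monotone_partitions (length (u @ x)). \<not> (\<exists>Q\<in>set \<pi>. straddles (length u) Q)}"
  let ?w = "partition_weight k \<kappa> (nths (u @ x))"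
  let ?f = "filter (\<lambda>P. P \<subseteq> ?A)" and ?f' = "filter (\<lambda>P. \<not> P \<subseteq> ?A)"
  let ?T = "SIGMA p:?MA \<times> ?MB. shuffles (fst p) (snd p)"
  have AB: "i < j" if "i \<in> ?A" "j \<in> ?B" for i j using that by auto
  have U: "?A \<union> ?B = {..<length (u @ x)}" by auto
  have str: "(\<not> straddles (length u) Q) = (Q \<subseteq> ?A \<or> Q \<subseteq> ?B)" if "Q \<subseteq> {..<length (u @ x)}" for Q
    using that by (auto simp: straddles_def)
      (metis atLeastLessThan_iff lessThan_iff not_le subsetD)+
  have S: "\<pi> \<in> ?S \<longleftrightarrow> ?f \<pi> \<in> ?MA \<and> ?f' \<pi> \<in> ?MB" if ne: "\<forall>P\<in>set \<pi>. P \<noteq> {}" for \<pi>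
  proof -
    have "\<pi> \<in> ?S \<longleftrightarrow> monotone_partition_on (?A \<union> ?B) \<pi> \<and> (\<forall>P\<in>set \<pi>. P \<subseteq> ?A \<or> P \<subseteq> ?B)"
    proof -
      have "(\<not> (\<exists>Q\<in>set \<pi>. straddles (length u) Q)) = (\<forall>P\<in>set \<pi>. P \<subseteq> ?A \<or> P \<subseteq> ?B)"
        if "monotone_partition_on {..<length (u @ x)} \<pi>"
      proof -
        have "Q \<subseteq> {..<length (u @ x)}" if "Q \<in> set \<pi>" for Q
          using that \<open>monotone_partition_on {..<length (u @ x)} \<pi>\<close>
          by (auto simp: monotone_partition_on_def partition_on_def)
        then have "\<forall>Q\<in>set \<pi>. (\<not> straddles (length u) Q) = (Q \<subseteq> ?A \<or> Q \<subseteq> ?B)"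
          by (intro ballI str)
        then show ?thesis by metis
      qed
      then show ?thesis unfolding U by (auto simp: monotone_partitions_iff simp del: length_append)
    qed
    also have "\<dots> \<longleftrightarrow> ?f \<pi> \<in> ?MA \<and> ?f' \<pi> \<in> ?MB"
      using monotone_partition_on_union[where A = ?A and B = ?B, OF AB ne] by (simp add: monotone_partitions_iff)
    finally show ?thesis .
  qed
  have shuffle: "?f \<pi> = \<pi>1 \<and> ?f' \<pi> = \<pi>2 \<and> (\<forall>P\<in>set \<pi>. P \<noteq> {}) \<and> set \<pi>1 \<inter> set \<pi>2 = {}"
    if "\<pi>1 \<in> ?MA" "\<pi>2 \<in> ?MB" "\<pi> \<in> shuffles \<pi>1 \<pi>2" for \<pi> \<pi>1 \<pi>2
  proof -
    have 1: "P \<subseteq> ?A" "P \<noteq> {}" if "P \<in> set \<pi>1" for P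
      using \<open>\<pi>1 \<in> ?MA\<close> that by (auto simp: monotone_partitions_iff monotone_partition_on_def partition_on_def)
    have 2: "\<not> P \<subseteq> ?A" "P \<noteq> {}" if "P \<in> set \<pi>2" for P
    proof -
      show "P \<noteq> {}" using \<open>\<pi>2 \<in> ?MB\<close> that by (auto simp: monotone_partition_on_def partition_on_def)
      moreover have "P \<subseteq> ?B" using \<open>\<pi>2 \<in> ?MB\<close> that by (auto simp: monotone_partition_on_def partition_on_def)
      ultimately show "\<not> P \<subseteq> ?A" by fastforce
    qed
    have "?f \<pi> \<in> shuffles (?f \<pi>1) (?f \<pi>2)" "?f' \<pi> \<in> shuffles (?f' \<pi>1) (?f' \<pi>2)"
      using that(3) by (auto simp flip: filter_shuffles)
    moreover have "?f \<pi>1 = \<pi>1" "?f' \<pi>2 = \<pi>2" "?f \<pi>2 = []" "?f' \<pi>1 = []"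
      using 1(1) 2(1) by (simp_all add: filter_id_conv filter_empty_conv)
    ultimately have "?f \<pi> = \<pi>1 \<and> ?f' \<pi> = \<pi>2" by simp
    moreover have "\<forall>P\<in>set \<pi>. P \<noteq> {}" unfolding set_shuffles[OF that(3)] using 1(2) 2(2) by blast
    moreover have "set \<pi>1 \<inter> set \<pi>2 = {}" using 1(1) 2(1) by blast
    ultimately show ?thesis by simp
  qed
  \<comment> \<open>Filtering recovers the two parts from their shuffle, so summing over pairs and
    their shuffles counts each partition once.\<close>
  have "(\<Sum>\<pi>\<in>?S. monom (?w \<pi> / fact (length \<pi>)) (length \<pi>)) =
      (\<Sum>t\<in>?T. monom (?w (snd t) / fact (length (snd t))) (length (snd t)))"
  proof (rule sum.reindex_bij_witness[of _ snd "\<lambda>\<pi>. ((?f \<pi>, ?f' \<pi>), \<pi>)"])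
    fix \<pi> assume \<pi>: "\<pi> \<in> ?S"
    then have "\<forall>P\<in>set \<pi>. P \<noteq> {}"
      by (auto simp: monotone_partitions_iff monotone_partition_on_def partition_on_def)
    from \<pi>[unfolded S[OF this]] show "((?f \<pi>, ?f' \<pi>), \<pi>) \<in> ?T"
      by (simp add: partition_in_shuffles)
  next
    fix t assume "t \<in> ?T"
    then obtain \<pi>1 \<pi>2 \<pi> where t: "t = ((\<pi>1, \<pi>2), \<pi>)" "\<pi>1 \<in> ?MA" "\<pi>2 \<in> ?MB" "\<pi> \<in> shuffles \<pi>1 \<pi>2"
      by auto
    note sh = shuffle[OF t(2-4)]
    show "((?f (snd t), ?f' (snd t)), snd t) = t" using sh t(1) by simp
    show "snd t \<in> ?S" using S[of \<pi>] sh t by simp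
  qed simp_all
  also have "\<dots> = (\<Sum>p\<in>?MA \<times> ?MB. \<Sum>\<pi>\<in>shuffles (fst p) (snd p).
      monom (?w \<pi> / fact (length \<pi>)) (length \<pi>))"
    by (subst sum.Sigma)
      (auto simp: monotone_partitions_eq finite_monotone_partition_on case_prod_unfold)
  also have "\<dots> = (\<Sum>p\<in>?MA \<times> ?MB. monom (?w (fst p) / fact (length (fst p))) (length (fst p)) *
      monom (?w (snd p) / fact (length (snd p))) (length (snd p)))"
  proof (rule sum.cong[OF refl])
    fix p assume "p \<in> ?MA \<times> ?MB"
    then obtain \<pi>1 \<pi>2 where p: "p = (\<pi>1, \<pi>2)" "\<pi>1 \<in> ?MA" "\<pi>2 \<in> ?MB" by auto
    let ?n = "length \<pi>1" and ?m = "length \<pi>2"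
    have "(\<Sum>\<pi>\<in>shuffles \<pi>1 \<pi>2. monom (?w \<pi> / fact (length \<pi>)) (length \<pi>)) =
        (\<Sum>\<pi>\<in>shuffles \<pi>1 \<pi>2. monom (?w \<pi>1 * ?w \<pi>2 / fact (?n + ?m)) (?n + ?m))"
    proof (rule sum.cong[OF refl])
      fix \<pi> assume \<pi>: "\<pi> \<in> shuffles \<pi>1 \<pi>2"
      have "?w \<pi> = ?w \<pi>1 * ?w \<pi>2"
        using p set_shuffles[OF \<pi>]
        by (intro partition_weight_union[OF AB]) (auto simp: monotone_partitions_iff)
      then show "monom (?w \<pi> / fact (length \<pi>)) (length \<pi>) =
          monom (?w \<pi>1 * ?w \<pi>2 / fact (?n + ?m)) (?n + ?m)"
        by (simp add: length_shuffles[OF \<pi>])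
    qed
    also have "\<dots> = of_nat ((?n + ?m) choose ?n) * monom (?w \<pi>1 * ?w \<pi>2 / fact (?n + ?m)) (?n + ?m)"
    proof -
      \<comment> \<open>Some shuffle is needed to read off from \<open>shuffle\<close> that the two
        lists are disjoint, as the count requires.\<close>
      have "\<pi>1 @ \<pi>2 \<in> shuffles \<pi>1 \<pi>2"
        by (induction \<pi>1) (auto intro: Cons_in_shuffles_leftI)
      then have "set \<pi>1 \<inter> set \<pi>2 = {}" using shuffle[OF p(2,3)] by blast
      then show ?thesis by (simp add: card_disjoint_shuffles)
    qed
    also have "\<dots> = monom (?w \<pi>1 / fact ?n) ?n * monom (?w \<pi>2 / fact ?m) ?m"
      by (simp add: mult_monom of_nat_monom binomial_fact)
    finally show "(\<Sum>\<pi>\<in>shuffles (fst p) (snd p). monom (?w \<pi> / fact (length \<pi>)) (length \<pi>)) =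
      monom (?w (fst p) / fact (length (fst p))) (length (fst p)) *
      monom (?w (snd p) / fact (length (snd p))) (length (snd p))" by (simp add: p)
  qed
  also have "\<dots> = (\<Sum>\<pi>\<in>?MA. monom (?w \<pi> / fact (length \<pi>)) (length \<pi>)) *
      (\<Sum>\<pi>\<in>?MB. monom (?w \<pi> / fact (length \<pi>)) (length \<pi>))"
    by (simp add: sum_product sum.cartesian_product case_prod_unfold)
  also have "(\<Sum>\<pi>\<in>?MA. monom (?w \<pi> / fact (length \<pi>)) (length \<pi>)) = partition_polynomial k \<kappa> u"
    unfolding partition_polynomial_def
  proof (rule sum.cong[OF refl])
    fix \<pi> assume "\<pi> \<in> ?MA"
    then have "nths (u @ x) P = nths u P" if "P \<in> set \<pi>" for P
      using that by (auto simp: nths_append monotone_partitions_iff monotone_partition_on_def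
          partition_on_def) (metis (mono_tags, lifting) UnionI add.commute empty_iff lessThan_iff mem_Collect_eq not_add_less1 nths_cong nths_empty)
    then have "?w \<pi> = partition_weight k \<kappa> (nths u) \<pi>" by (rule partition_weight_cong)
    then show "monom (?w \<pi> / fact (length \<pi>)) (length \<pi>) =
        monom (partition_weight k \<kappa> (nths u) \<pi> / fact (length \<pi>)) (length \<pi>)" by simp
  qed
  \<comment> \<open>Translation by the length of \<open>u\<close> identifies the partitions of the
    right part with those for \<open>x\<close>.\<close>
  also have "(\<Sum>\<pi>\<in>?MB. monom (?w \<pi> / fact (length \<pi>)) (length \<pi>)) = partition_polynomial k \<kappa> x"
    unfolding partition_polynomial_def
  proof (rule sum.reindex_bij_witness[of _ "map ((`) ((+) (length u)))" "map ((`) (\<lambda>i. i - length u))"])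
    have sm: "strict_mono_on S ((+) (length u))" for S by (auto simp: strict_mono_on_def)
    have sm': "strict_mono_on ?B (\<lambda>i. i - length u)" by (auto simp: strict_mono_on_def)
    have im: "(+) (length u) ` {..<length x} = ?B" by (simp add: lessThan_atLeast0 add.commute)
    have im': "(\<lambda>i. i - length u) ` ?B = {..<length x}" 
      by (subst im[symmetric]) (simp add: image_image)
    {
      fix \<pi> assume \<pi>: "\<pi> \<in> ?MB"
      have Q: "(+) (length u) ` (\<lambda>i. i - length u) ` Q = Q" if "Q \<in> set \<pi>" for Q
      proof -
        have "Q \<subseteq> ?B" using that \<pi> by (auto simp: monotone_partition_on_def partition_on_def)
        then have "(\<lambda>i. length u + (i - length u)) ` Q = (\<lambda>i. i) ` Q" by (intro image_cong) auto
        then show ?thesis by (simp add: image_image)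
      qed
      then show *: "map ((`) ((+) (length u))) (map ((`) (\<lambda>i. i - length u)) \<pi>) = \<pi>"
        by (simp add: map_idI)
      show "map ((`) (\<lambda>i. i - length u)) \<pi> \<in> monotone_partitions (length x)"
        using monotone_partition_on_image[OF sm'] \<pi> by (simp only: im' monotone_partitions_iff mem_Collect_eq)
      have "?w \<pi> = ?w (map ((`) ((+) (length u))) (map ((`) (\<lambda>i. i - length u)) \<pi>))"
        unfolding * ..
      also have "\<dots> = partition_weight k \<kappa> (nths x) (map ((`) (\<lambda>i. i - length u)) \<pi>)"
      proof (rule partition_weight_image[OF sm])
        fix P
        have "nths u ((+) (length u) ` P) = []" by (subst nths_cong[of _ _ "{}"]) auto
        then show "nths (u @ x) ((+) (length u) ` P) = nths x P"
          by (simp add: nths_append image_iff add.commute)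
      qed (rule subset_UNIV)
      finally show "monom (partition_weight k \<kappa> (nths x) (map ((`) (\<lambda>i. i - length u)) \<pi>) /
          fact (length (map ((`) (\<lambda>i. i - length u)) \<pi>))) (length (map ((`) (\<lambda>i. i - length u)) \<pi>)) =
        monom (?w \<pi> / fact (length \<pi>)) (length \<pi>)" by simp
    }
    fix \<pi> assume \<pi>: "\<pi> \<in> monotone_partitions (length x)"
    show "map ((`) (\<lambda>i. i - length u)) (map ((`) ((+) (length u))) \<pi>) = \<pi>"
      by (simp add: image_image comp_def map_idI)
    show "map ((`) ((+) (length u))) \<pi> \<in> ?MB"
      using monotone_partition_on_image[OF sm] \<pi> by (simp only: im[symmetric] monotone_partitions_iff mem_Collect_eq)
  qed
  finally show ?thesis .
qed

lemma smult_sum_right: "smult c (sum f S) = (\<Sum>i\<in>S. smult c (f i))"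
  by (induction S rule: infinite_finite_induct) (auto simp: smult_add_right)

lemma pderiv_sum: "pderiv (sum f S) = (\<Sum>i\<in>S. pderiv (f i))"
  by (induction S rule: infinite_finite_induct) (auto simp: pderiv_add)

text \<open>Differentiation lowers the exponent and the factorial together, which matches deleting
  the last block. That block has weight \<open>\<kappa> p\<close> for every remaining partition,
  plus \<open>k p - \<kappa> p\<close> if no block straddles the cut; the latter sum
  factors.\<close>

theorem pderiv_partition_polynomial:
  "pderiv (partition_polynomial k \<kappa> as) = (\<Sum>l<length as. \<Sum>m<length as - l.
    (let u = take l as; p = take (Suc m) (drop l as); x = drop (l + Suc m) as in
      smult (\<kappa> p) (partition_polynomial k \<kappa> (u @ x)) +
      smult (k p - \<kappa> p) (partition_polynomial k \<kappa> u * partition_polynomial k \<kappa> x)))"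
proof (cases "as = []")
  case True
  then show ?thesis
    by (simp add: partition_polynomial_def monotone_partitions_eq monotone_partition_on_empty pderiv_monom)
next
  case False
  let ?n = "length as"
  let ?w = "\<lambda>as. partition_weight k \<kappa> (nths as)"
  let ?m = "\<lambda>c as \<pi>. monom (c * ?w as \<pi> / fact (length \<pi>)) (length \<pi>)"
  have "pderiv (partition_polynomial k \<kappa> as) =
      (\<Sum>\<pi>\<in>monotone_partitions ?n. monom (of_nat (length \<pi>) * ?w as \<pi> / fact (length \<pi>)) (length \<pi> - 1))"
    by (simp add: partition_polynomial_def pderiv_sum pderiv_monom)
  also have "\<dots> = (\<Sum>l<?n. \<Sum>m<?n - l. \<Sum>\<pi>\<in>monotone_partitions (?n - Suc m).
      monom (of_nat (Suc (length \<pi>)) * ?w as (map ((`) (skip l (Suc m))) \<pi> @ [{l..<l + Suc m}])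
        / fact (Suc (length \<pi>))) (length \<pi>))"
    using False by (subst sum_monotone_partitions_peel) simp_all
  also have "\<dots> = (\<Sum>l<length as. \<Sum>m<length as - l.
    (let u = take l as; p = take (Suc m) (drop l as); x = drop (l + Suc m) as in
      smult (\<kappa> p) (partition_polynomial k \<kappa> (u @ x)) +
      smult (k p - \<kappa> p) (partition_polynomial k \<kappa> u * partition_polynomial k \<kappa> x)))"
  proof (intro sum.cong refl)
    fix l m assume lm: "l \<in> {..<?n}" "m \<in> {..<?n - l}"
    define u where "u = take l as"
    define p where "p = take (Suc m) (drop l as)"
    define x where "x = drop (l + Suc m) as"
    have len: "l + Suc m \<le> ?n" using lm by auto
    then have lens: "length u = l" "length (u @ x) = ?n - Suc m" by (auto simp: u_def x_def)
    let ?S = "{\<pi> \<in> monotone_partitions (?n - Suc m). \<not> (\<exists>Q\<in>set \<pi>. straddles l Q)}"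
    have fin: "finite (monotone_partitions (?n - Suc m))"
      by (simp add: monotone_partitions_eq finite_monotone_partition_on)
    have "(\<Sum>\<pi>\<in>monotone_partitions (?n - Suc m).
      monom (of_nat (Suc (length \<pi>)) * ?w as (map ((`) (skip l (Suc m))) \<pi> @ [{l..<l + Suc m}])
        / fact (Suc (length \<pi>))) (length \<pi>)) =
      (\<Sum>\<pi>\<in>monotone_partitions (?n - Suc m). ?m (\<kappa> p) (u @ x) \<pi> +
        (if \<not> (\<exists>Q\<in>set \<pi>. straddles l Q) then ?m (k p - \<kappa> p) (u @ x) \<pi> else 0))"
    proof (rule sum.cong[OF refl])
      fix \<pi> assume "\<pi> \<in> monotone_partitions (?n - Suc m)"
      then have w: "?w as (map ((`) (skip l (Suc m))) \<pi> @ [{l..<l + Suc m}]) = ?w (u @ x) \<pi> *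
          (if \<exists>Q\<in>set \<pi>. straddles l Q then \<kappa> p else k p)"
        unfolding u_def p_def x_def
        by (intro partition_weight_insert[OF len]) (simp add: monotone_partitions_iff)
      have f: "of_nat (Suc N) * c / fact (Suc N) = (c :: complex) / fact N" for N c
        by (simp del: of_nat_Suc add: divide_simps)
      show "monom (of_nat (Suc (length \<pi>)) * ?w as (map ((`) (skip l (Suc m))) \<pi> @ [{l..<l + Suc m}])
          / fact (Suc (length \<pi>))) (length \<pi>) = ?m (\<kappa> p) (u @ x) \<pi> +
        (if \<not> (\<exists>Q\<in>set \<pi>. straddles l Q) then ?m (k p - \<kappa> p) (u @ x) \<pi> else 0)"
        unfolding w f by (auto simp: add_monom algebra_simps add_divide_distrib diff_divide_distrib)
    qed
    also have "\<dots> = (\<Sum>\<pi>\<in>monotone_partitions (?n - Suc m). ?m (\<kappa> p) (u @ x) \<pi>) +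
        (\<Sum>\<pi>\<in>?S. ?m (k p - \<kappa> p) (u @ x) \<pi>)"
      by (simp add: sum.distrib sum.inter_filter[OF fin])
    also have "(\<Sum>\<pi>\<in>monotone_partitions (?n - Suc m). ?m (\<kappa> p) (u @ x) \<pi>) =
        smult (\<kappa> p) (partition_polynomial k \<kappa> (u @ x))"
      unfolding partition_polynomial_def lens(2) smult_sum_right by (simp add: smult_monom)
    also have "(\<Sum>\<pi>\<in>?S. ?m (k p - \<kappa> p) (u @ x) \<pi>) = smult (k p - \<kappa> p)
        (\<Sum>\<pi>\<in>?S. monom (?w (u @ x) \<pi> / fact (length \<pi>)) (length \<pi>))"
      by (simp add: smult_sum_right smult_monom)
    also have "(\<Sum>\<pi>\<in>?S. monom (?w (u @ x) \<pi> / fact (length \<pi>)) (length \<pi>)) =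
        partition_polynomial k \<kappa> u * partition_polynomial k \<kappa> x"
      using partition_polynomial_split[where u = u and x = x and k = k and \<kappa> = \<kappa>]
      unfolding lens .
    finally show "(\<Sum>\<pi>\<in>monotone_partitions (?n - Suc m).
      monom (of_nat (Suc (length \<pi>)) * ?w as (map ((`) (skip l (Suc m))) \<pi> @ [{l..<l + Suc m}])
        / fact (Suc (length \<pi>))) (length \<pi>)) =
      (let u = take l as; p = take (Suc m) (drop l as); x = drop (l + Suc m) as in
      smult (\<kappa> p) (partition_polynomial k \<kappa> (u @ x)) +
      smult (k p - \<kappa> p) (partition_polynomial k \<kappa> u * partition_polynomial k \<kappa> x))"
      by (simp add: Let_def u_def p_def x_def)
  qed
  finally show ?thesis .
qed

lemma partition_polynomial_Nil: "partition_polynomial k \<kappa> [] = 1"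
  by (simp add: partition_polynomial_def monotone_partitions_eq monotone_partition_on_empty
      partition_weight_def inner_blocks_def outer_blocks_def)

lemma partition_polynomial_0: "as \<noteq> [] \<Longrightarrow> coeff (partition_polynomial k \<kappa> as) 0 = 0"
  unfolding partition_polynomial_def coeff_sum
  by (intro sum.neutral) (auto simp: monotone_partitions_iff monotone_partition_on_def partition_on_def)

section \<open>Moments and cumulants\<close>

lemma poly_eq_of_pderiv:
  assumes "pderiv p = pderiv (q :: complex poly)" "coeff p 0 = coeff q 0"
  shows "p = q"
proof -
  have "pderiv (p - q) = 0" using assms(1) by (simp add: pderiv_diff)
  then obtain c where "p - q = [:c:]" using pderiv_iszero by blast
  moreover from this have "c = 0" using assms(2) by (metis coeff_diff coeff_pCons_0 diff_self)
  ultimately show ?thesis by simp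
qed

context block_system
begin

text \<open>The right-hand sides of the two differential equations involve only shorter tuples, so
  induction on the length makes the derivatives agree. For a nonempty tuple both constant terms are
  0: there are no labellings by zero copies and no partitions with zero blocks.\<close>

theorem GP_eq_partition_polynomial: "GP as = partition_polynomial kg kh as"
proof (induction "length as" arbitrary: as rule: less_induct)
  case less
  show ?case
  proof (cases "as = []")
    case False
    show ?thesis
    proof (rule poly_eq_of_pderiv)
      show "coeff (GP as) 0 = coeff (partition_polynomial kg kh as) 0"
        using False by (simp add: GP_0 partition_polynomial_0)
      show "pderiv (GP as) = pderiv (partition_polynomial kg kh as)"
        unfolding pderiv_GP pderiv_partition_polynomial Let_def
      proof (intro sum.cong refl arg_cong2[where f = "(+)"] arg_cong2[where f = smult]
          arg_cong2[where f = "(*)"])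
        fix l m assume "l \<in> {..<length as}" "m \<in> {..<length as - l}"
        then show "GP (take l as @ drop (l + Suc m) as) =
            partition_polynomial kg kh (take l as @ drop (l + Suc m) as)"
          and "GP (take l as) = partition_polynomial kg kh (take l as)"
          and "GP (drop (l + Suc m) as) = partition_polynomial kg kh (drop (l + Suc m) as)"
          by (auto intro!: less)
      qed
    qed
  qed (simp add: GP_Nil partition_polynomial_Nil)
qed

lemma G_1: "G 1 as = (\<Sum>\<pi>\<in>monotone_partitions (length as).
    1 / fact (length \<pi>) * ((\<Prod>P\<in>outer_blocks (set \<pi>). kg (nths as P)) *
      (\<Prod>P\<in>inner_blocks (set \<pi>). kh (nths as P))))"
  using GP[of 1 as]
  by (simp add: GP_eq_partition_polynomial partition_polynomial_def poly_sum poly_monom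
      partition_weight_def)

end

section \<open>Multilinearity and the moment formulas\<close>

lemma label_sum_linear:
  assumes "compatible f"
  shows "label_sum S f (p @ (x + c *\<^sub>C y) # q) = label_sum S f (p @ x # q) + c * label_sum S f (p @ y # q)"
proof -
  have "label_sum S f (p @ z # q) =
      label_sum S (\<lambda>u. \<Sum>j\<in>S. label_sum S (\<lambda>v. f (u @ (j, z) # v)) q) p" for z
    by (simp add: label_sum_append)
  moreover have "f (u @ (j, x + c *\<^sub>C y) # v) = f (u @ (j, x) # v) + c * f (u @ (j, y) # v)" for u v j
    using assms by (simp add: compatible_def)
  ultimately show ?thesis
    by (simp add: label_sum_add label_sum_cmult label_sum_sum sum.distrib sum_distrib_left)
qed

context
  fixes \<phi> \<psi> :: "'a::complex_algebra \<Rightarrow> complex"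
  assumes lin: "clinear \<phi>" "clinear \<psi>"
begin

lemma block_system_eval:
  "block_system (c_monotone_eval (<) \<phi> \<psi> :: (nat \<times> 'a) list \<Rightarrow> complex) (c_monotone_eval (<) \<psi> \<psi>)"
proof
  interpret C: c_monotone_data "(<) :: nat \<Rightarrow> _" \<phi> \<psi> by (rule c_monotone_data_linorder[OF lin])
  interpret M: c_monotone_data "(<) :: nat \<Rightarrow> _" \<psi> \<psi> by (rule c_monotone_data_linorder[OF lin(2,2)])
  show "c_monotone_eval (<) \<phi> \<psi> ([] :: (nat \<times> 'a) list) = 1"
    "c_monotone_eval (<) \<psi> \<psi> ([] :: (nat \<times> 'a) list) = 1"
    by (rule C.g_Nil M.g_Nil)+
  fix N and u p x :: "(nat \<times> 'a) list"
  assume "fst ` set u \<subseteq> {..<N}" "fst ` set p \<subseteq> {N..}" "x = [] \<or> fst (hd x) < N"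
  then have 1: "u = [] \<or> (\<forall>z\<in>set p. fst (last u) < fst z)" "x = [] \<or> (\<forall>z\<in>set p. fst (hd x) < fst z)"
    by (cases "u = []"; fastforce dest: last_in_set)+
  show "c_monotone_eval (<) \<phi> \<psi> (u @ p @ x) = c_monotone_eval (<) \<psi> \<psi> p * c_monotone_eval (<) \<phi> \<psi> (u @ x) +
      (c_monotone_eval (<) \<phi> \<psi> p - c_monotone_eval (<) \<psi> \<psi> p) * c_monotone_eval (<) \<phi> \<psi> u *
      c_monotone_eval (<) \<phi> \<psi> x"
    by (rule C.g_block[OF 1])
  show "c_monotone_eval (<) \<psi> \<psi> (u @ p @ x) = c_monotone_eval (<) \<psi> \<psi> p * c_monotone_eval (<) \<psi> \<psi> (u @ x)"
    using M.g_block[OF 1] by simp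
next
  fix N :: nat and w :: "(nat \<times> 'a) list"
  show "c_monotone_eval (<) \<phi> \<psi> (map (apfst ((+) N)) w) = c_monotone_eval (<) \<phi> \<psi> w"
    "c_monotone_eval (<) \<psi> \<psi> (map (apfst ((+) N)) w) = c_monotone_eval (<) \<psi> \<psi> w"
    by (rule c_monotone_eval_relabel[where D = UNIV]; simp)+
qed

interpretation block_system "c_monotone_eval (<) \<phi> \<psi> :: (nat \<times> 'a) list \<Rightarrow> complex" "c_monotone_eval (<) \<psi> \<psi>"
  by (rule block_system_eval)

lemma K_CM_kg: "K_CM \<phi> \<psi> as = kg as"
  unfolding K_CM_eq[OF lin] G_def[symmetric] by (simp add: linear_coefficient_G kg_def)

lemma K_M_kh: "K_M \<psi> as = kh as"
  unfolding K_M_eq K_CM_eq[OF lin(2,2)] H_def[symmetric] kh_def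
  by (rule linear_coefficient_eq) (rule HP)

text \<open>The moments of the \<open>N\<close>-fold sums are multilinear for every
  \<open>N\<close>, hence so are the interpolating polynomials and their coefficients.\<close>

lemma multilinear_K_CM: "multilinear_functionals (K_CM \<phi> \<psi>)"
  unfolding multilinear_functionals_def
proof (intro allI impI clinearI)
  fix as :: "'a list" and k x c y assume k: "k < length as"
  interpret C: c_monotone_data "(<) :: nat \<Rightarrow> _" \<phi> \<psi> by (rule c_monotone_data_linorder[OF lin])
  have "GP (as[k := x + c *\<^sub>C y]) = GP (as[k := x]) + smult c (GP (as[k := y]))"
  proof (rule poly_eq_of_nat)
    fix N
    show "poly (GP (as[k := x + c *\<^sub>C y])) (of_nat N) =
        poly (GP (as[k := x]) + smult c (GP (as[k := y]))) (of_nat N)"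
      by (simp add: GP[symmetric] G_def upd_conv_take_nth_drop[OF k] label_sum_linear[OF C.compatible_g])
  qed
  then show "K_CM \<phi> \<psi> (as[k := x + c *\<^sub>C y]) = K_CM \<phi> \<psi> (as[k := x]) + c * K_CM \<phi> \<psi> (as[k := y])"
    by (simp add: K_CM_kg kg_def)
qed

lemma label_sum_one: "label_sum {..<1} f as = f (map (Pair 0) as)"
  by (induction as arbitrary: f) (simp_all add: lessThan_Suc)

theorem moment_c_monotone:
  assumes "as \<noteq> []"
  shows "\<phi> (list_mult as) = (\<Sum>\<pi>\<in>monotone_partitions (length as). 1 / fact (length \<pi>) *
    ((\<Prod>P\<in>outer_blocks (set \<pi>). K_CM \<phi> \<psi> (nths as P)) *
      (\<Prod>P\<in>inner_blocks (set \<pi>). K_M \<psi> (nths as P))))"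
proof -
  interpret C: c_monotone_data "(<) :: nat \<Rightarrow> _" \<phi> \<psi> by (rule c_monotone_data_linorder[OF lin])
  \<comment> \<open>With a single copy all labels agree, so the word merges into one letter, whose
    value is \<phi> of the product.\<close>
  have "G 1 as = C.g ([] @ map (Pair 0) as @ [])" unfolding G_def label_sum_one by simp
  also have "\<dots> = C.g ([] @ (0, list_mult (map snd (map (Pair (0 :: nat)) as))) # [])"
    by (rule compatible_merge[OF C.compatible_g]) (use assms in auto)
  also have "\<dots> = \<phi> (list_mult as)" by (simp add: C.g_single comp_def)
  finally show ?thesis unfolding G_1 K_CM_kg K_M_kh by simp
qed

end

lemma moment_monotone:
  assumes "clinear \<psi>" "as \<noteq> []"
  shows "\<psi> (list_mult as) = (\<Sum>\<pi>\<in>monotone_partitions (length as).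
    1 / fact (length \<pi>) * (\<Prod>P\<in>set \<pi>. K_M \<psi> (nths as P)))"
proof -
  have "(\<Prod>P\<in>outer_blocks (set \<pi>). f P) * (\<Prod>P\<in>inner_blocks (set \<pi>). f P) = (\<Prod>P\<in>set \<pi>. f P)"
    for \<pi> and f :: "nat set \<Rightarrow> complex"
    unfolding outer_blocks_def
    by (rule prod.subset_diff[symmetric]) (auto simp: inner_blocks_def)
  then show ?thesis using moment_c_monotone[OF assms(1,1,2)] by (simp add: K_M_eq)
qed

section \<open>The antimonotone and Boolean formulas\<close>

lemma antimonotone_partitions_eq: "antimonotone_partitions n = rev ` monotone_partitions n"
proof -
  have iff: "\<pi> \<in> antimonotone_partitions n \<longleftrightarrow> rev \<pi> \<in> monotone_partitions n" for \<pi>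
  proof -
    have "(\<forall>i<length \<pi>. \<forall>j<length \<pi>. covers (\<pi> ! i) (\<pi> ! j) \<longrightarrow> j < i) \<longleftrightarrow>
        (\<forall>i<length \<pi>. \<forall>j<length \<pi>. covers (rev \<pi> ! i) (rev \<pi> ! j) \<longrightarrow> i < j)"
    proof (intro iffI allI impI)
      fix i j assume *: "\<forall>i<length \<pi>. \<forall>j<length \<pi>. covers (\<pi> ! i) (\<pi> ! j) \<longrightarrow> j < i"
        "i < length \<pi>" "j < length \<pi>" "covers (rev \<pi> ! i) (rev \<pi> ! j)"
      then have "length \<pi> - Suc j < length \<pi> - Suc i" by (simp add: rev_nth)
      then show "i < j" by simp
    next
      fix i j assume *: "\<forall>i<length \<pi>. \<forall>j<length \<pi>. covers (rev \<pi> ! i) (rev \<pi> ! j) \<longrightarrow> i < j"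
        "i < length \<pi>" "j < length \<pi>" "covers (\<pi> ! i) (\<pi> ! j)"
      have "length \<pi> - Suc i < length \<pi> - Suc j"
        by (rule *(1)[rule_format]) (use *(2-) in \<open>simp_all add: rev_nth\<close>)
      then show "j < i" by simp
    qed
    then show ?thesis
      unfolding antimonotone_partitions_def monotone_partitions_def ordered_set_partition_def
        mem_Collect_eq length_rev set_rev distinct_rev by (rule arg_cong)
  qed
  show ?thesis
  proof (intro equalityI subsetI)
    fix \<pi> assume "\<pi> \<in> antimonotone_partitions n"
    then have "rev (rev \<pi>) \<in> rev ` monotone_partitions n" unfolding iff by (rule imageI)
    then show "\<pi> \<in> rev ` monotone_partitions n" by simp
  qed (auto simp: iff)
qed

text \<open>Reversing the list of blocks exchanges the two order conditions and preserves every
  weight that depends only on the number and the set of blocks.\<close>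

lemma sum_antimonotone_partitions:
  "(\<Sum>\<pi>\<in>antimonotone_partitions n. f (length \<pi>) (set \<pi>)) =
    (\<Sum>\<pi>\<in>monotone_partitions n. f (length \<pi>) (set \<pi>) :: complex)"
  unfolding antimonotone_partitions_eq by (subst sum.reindex) (auto simp: inj_on_def)

text \<open>For \<open>\<psi> = 0\<close> the c-monotone product is the Boolean product and all monotone cumulants vanish,
  so only monotone partitions without inner blocks contribute.\<close>

lemma K_M_0: "as \<noteq> [] \<Longrightarrow> K_M (\<lambda>_. 0) as = 0"
proof -
  assume as: "as \<noteq> []"
  interpret C: c_monotone_data "(<) :: nat \<Rightarrow> _" "\<lambda>_. 0" "\<lambda>_ :: 'a. 0"
    by (rule c_monotone_data_linorder[OF clinear_0 clinear_0])
  \<comment> \<open>By uniqueness, the zero functional is the c-monotone product of zero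
    functionals.\<close>
  have "fst (c_monotone_product (\<lambda>_ :: nat. \<lambda>_ :: 'a. 0) (\<lambda>_ _. 0)) = (\<lambda>_. 0)"
    unfolding c_monotone_product_def C.c_monotone_product_eq
    by (rule C.c_monotone_product_unique[OF C.c_monotone_product_exists]) (simp add: clinear_0)
  then have "c_monotone_cumulant (\<lambda>_. 0) (\<lambda>_ :: 'a. 0) as = 0"
    using linear_coefficient_eq[of "\<lambda>_. 0" 0]
    by (simp add: c_monotone_cumulant_def product_cumulant_def)
  then show ?thesis using c_monotone_cumulant_eq[OF clinear_0 clinear_0 as] by (simp add: K_M_eq)
qed

text \<open>Crossings and inner blocks need a block with a gap; conversely, a gap in a noncrossing
  partition contains a covered block.\<close>

lemma interval_partition_iff:
  assumes "partition_on {..<n} \<sigma>"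
  shows "(\<forall>P\<in>\<sigma>. \<exists>a b. P = {a..b}) \<longleftrightarrow> noncrossing \<sigma> \<and> inner_blocks \<sigma> = {}"
proof
  assume int: "\<forall>P\<in>\<sigma>. \<exists>a b. P = {a..b}"
  have disj: "P \<inter> Q = {}" if "P \<in> \<sigma>" "Q \<in> \<sigma>" "P \<noteq> Q" for P Q
    using assms that by (auto simp: partition_on_def pairwise_def disjnt_def)
  have conv: "z \<in> P" if "P \<in> \<sigma>" "x \<in> P" "y \<in> P" "x < z" "z < y" for P x y z
  proof -
    obtain a b where "P = {a..b}" using int \<open>P \<in> \<sigma>\<close> by blast
    then show ?thesis using that by simp
  qed
  have "\<not> crosses P Q" if PQ: "P \<in> \<sigma>" "Q \<in> \<sigma>" "P \<noteq> Q" for P Q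
  proof
    assume "crosses P Q"
    then obtain i j k where "i < j" "j < k" "i \<in> P" "k \<in> P" "j \<in> Q" unfolding crosses_def by blast
    then show False using conv[OF PQ(1)] disj[OF PQ] by blast
  qed
  moreover have "\<not> covers P' P" if PP: "P \<in> \<sigma>" "P' \<in> \<sigma>" for P P'
  proof
    assume c: "covers P' P"
    then have "P' \<noteq> P" using covers_irrefl by auto
    moreover obtain k where "k \<in> P" using assms PP(1) by (metis all_not_in_conv partition_onD3)
    moreover obtain i j where "i \<in> P'" "j \<in> P'" "\<forall>k\<in>P. i < k \<and> k < j" using c by (auto simp: covers_def)
    ultimately show False using conv[OF PP(2), of i j k] disj[OF PP(2,1)] by blast
  qed
  ultimately show "noncrossing \<sigma> \<and> inner_blocks \<sigma> = {}"
    by (auto simp: noncrossing_iff inner_blocks_def)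
next
  assume nc: "noncrossing \<sigma> \<and> inner_blocks \<sigma> = {}"
  show "\<forall>P\<in>\<sigma>. \<exists>a b. P = {a..b}"
  proof
    fix P assume P: "P \<in> \<sigma>"
    have fin: "finite P" "P \<noteq> {}" using P assms
      by (auto simp: partition_on_def intro: finite_subset[of _ "{..<n}"])
    have "z \<in> P" if xy: "x \<in> P" "y \<in> P" "x < z" "z < y" for x y z
    proof (rule ccontr)
      assume "z \<notin> P"
      moreover have "y \<in> {..<n}" using xy(2) P assms by (auto simp: partition_on_def)
      then have "z \<in> {..<n}" using xy(4) by simp
      ultimately obtain Q where "Q \<in> \<sigma>" "covers P Q"
        using noncrossing_gap_covers[OF assms conjunct1[OF nc] P xy] by blast
      then show False using nc P by (auto simp: inner_blocks_def)
    qed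
    then have "P = {Min P..Max P}" by (rule convex_eq_interval[OF fin])
    then show "\<exists>a b. P = {a..b}" by blast
  qed
qed

text \<open>Without coverings the order of the blocks is unconstrained, so an interval partition
  arises from all orderings of its blocks; their number cancels the factorial in the moment
  formula.\<close>

lemma outer_monotone_partitions_eq:
  "{\<pi> \<in> monotone_partitions n. inner_blocks (set \<pi>) = {}} =
    (\<Union>\<sigma>\<in>interval_partitions n. permutations_of_set \<sigma>)" (is "?L = ?R")
proof (intro equalityI subsetI)
  fix \<pi> assume "\<pi> \<in> ?L"
  then have "set \<pi> \<in> interval_partitions n" "\<pi> \<in> permutations_of_set (set \<pi>)"
    using interval_partition_iff[of n "set \<pi>"]
    by (auto simp: monotone_partitions_iff monotone_partition_on_def interval_partitions_def)
  then show "\<pi> \<in> ?R" by blast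
next
  fix \<pi> assume "\<pi> \<in> ?R"
  then obtain \<sigma> where "\<sigma> \<in> interval_partitions n" "set \<pi> = \<sigma>" "distinct \<pi>"
    by (auto simp: permutations_of_set_def)
  then have 1: "distinct \<pi>" "partition_on {..<n} (set \<pi>)" "noncrossing (set \<pi>)" "inner_blocks (set \<pi>) = {}"
    using interval_partition_iff[of n "set \<pi>"] by (auto simp: interval_partitions_def)
  have "\<not> covers P Q" if "P \<in> set \<pi>" "Q \<in> set \<pi>" for P Q
    using 1(4) that by (auto simp: inner_blocks_def)
  then have "sorted_wrt (\<lambda>P Q. \<not> covers Q P) \<pi>"
    by (intro sorted_wrt_mono_rel[OF _ sorted_wrt_true]) blast
  then show "\<pi> \<in> ?L" using 1 by (simp add: monotone_partitions_iff monotone_partition_on_def)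
qed

theorem moment_boolean:
  assumes "clinear \<phi>" "as \<noteq> []"
  shows "\<phi> (list_mult as) =
    (\<Sum>\<sigma>\<in>interval_partitions (length as). \<Prod>P\<in>\<sigma>. K_B \<phi> (nths as P))"
proof -
  let ?n = "length as"
  let ?K = "\<lambda>P. K_CM \<phi> (\<lambda>_. 0) (nths as P)"
  let ?t = "\<lambda>\<pi>. 1 / fact (length \<pi>) * (\<Prod>P\<in>set \<pi>. ?K P)"
  have fin: "finite (monotone_partitions ?n)"
    by (simp add: monotone_partitions_eq finite_monotone_partition_on)
  \<comment> \<open>The vanishing of the monotone cumulants in \<open>K_M_0\<close> concerns
    nonempty tuples.\<close>
  have ne: "nths as P \<noteq> []" if "P \<in> set \<pi>" "\<pi> \<in> monotone_partitions ?n" for P \<pi>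
  proof -
    have "P \<noteq> {}" "P \<subseteq> {..<?n}" using that
      by (auto simp: monotone_partitions_iff monotone_partition_on_def partition_on_def)
    then obtain i where "i \<in> P" "i < ?n" by auto
    then have "as ! i \<in> set (nths as P)" by (auto simp: set_nths)
    then show ?thesis by auto
  qed
  have "\<phi> (list_mult as) = (\<Sum>\<pi>\<in>monotone_partitions ?n. 1 / fact (length \<pi>) *
    ((\<Prod>P\<in>outer_blocks (set \<pi>). ?K P) * (\<Prod>P\<in>inner_blocks (set \<pi>). K_M (\<lambda>_. 0) (nths as P))))"
    by (rule moment_c_monotone[OF assms(1) clinear_0 assms(2)])
  also have "\<dots> = (\<Sum>\<pi>\<in>monotone_partitions ?n. if inner_blocks (set \<pi>) = {} then ?t \<pi> else 0)"
  proof (rule sum.cong[OF refl])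
    fix \<pi> assume \<pi>: "\<pi> \<in> monotone_partitions ?n"
    show "1 / fact (length \<pi>) * ((\<Prod>P\<in>outer_blocks (set \<pi>). ?K P) *
        (\<Prod>P\<in>inner_blocks (set \<pi>). K_M (\<lambda>_. 0) (nths as P))) =
      (if inner_blocks (set \<pi>) = {} then ?t \<pi> else 0)"
    proof (cases "inner_blocks (set \<pi>) = {}")
      case False
      then obtain P where P: "P \<in> inner_blocks (set \<pi>)" by blast
      then have "K_M (\<lambda>_. 0) (nths as P) = 0"
        using ne[OF _ \<pi>] by (intro K_M_0) (auto simp: inner_blocks_def)
      moreover have "finite (inner_blocks (set \<pi>))" by (simp add: inner_blocks_def)
      ultimately have "(\<Prod>P\<in>inner_blocks (set \<pi>). K_M (\<lambda>_. 0) (nths as P)) = 0"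
        using P by (meson prod_zero)
      then show ?thesis using False by simp
    qed (simp add: outer_blocks_def)
  qed
  also have "\<dots> = (\<Sum>\<pi>\<in>{\<pi> \<in> monotone_partitions ?n. inner_blocks (set \<pi>) = {}}. ?t \<pi>)"
    by (simp only: sum.inter_filter[OF fin])
  also have "\<dots> = (\<Sum>\<sigma>\<in>interval_partitions ?n. \<Sum>\<pi>\<in>permutations_of_set \<sigma>. ?t \<pi>)"
    unfolding outer_monotone_partitions_eq
  proof (rule sum.UNION_disjoint)
    show "finite (interval_partitions ?n)"
      by (rule finite_subset[OF _ finitely_many_partition_on[of "{..<?n}"]])
        (auto simp: interval_partitions_def)
    show "\<forall>\<sigma>\<in>interval_partitions ?n. finite (permutations_of_set \<sigma>)" by simp
  qed (auto simp: permutations_of_set_def)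
  also have "\<dots> = (\<Sum>\<sigma>\<in>interval_partitions ?n. \<Prod>P\<in>\<sigma>. K_B \<phi> (nths as P))"
  proof (rule sum.cong[OF refl])
    fix \<sigma> assume "\<sigma> \<in> interval_partitions ?n"
    then have fin: "finite \<sigma>"
      by (auto simp: interval_partitions_def intro: finite_elements[of "{..<?n}"])
    have "(\<Sum>\<pi>\<in>permutations_of_set \<sigma>. ?t \<pi>) =
        (\<Sum>\<pi>\<in>permutations_of_set \<sigma>. 1 / fact (card \<sigma>) * (\<Prod>P\<in>\<sigma>. ?K P))"
      by (intro sum.cong refl) (auto simp: permutations_of_set_def distinct_card)
    also have "\<dots> = (\<Prod>P\<in>\<sigma>. ?K P)" by (simp add: fin)
    finally show "(\<Sum>\<pi>\<in>permutations_of_set \<sigma>. ?t \<pi>) = (\<Prod>P\<in>\<sigma>. K_B \<phi> (nths as P))"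
      by (simp add: K_B_eq)
  qed
  finally show ?thesis .
qed

theorem corollary4p17:
  fixes \<phi> \<psi> :: "'a::complex_algebra \<Rightarrow> complex"
  assumes "clinear \<phi>" and "clinear \<psi>"
  shows
    "(multilinear_functionals (K_CM \<phi> \<psi>) \<and> multilinear_functionals (K_M \<psi>) \<and>
      (\<forall>as. as \<noteq> [] \<longrightarrow>
        K_CM \<phi> \<psi> as = c_monotone_cumulant \<phi> \<psi> as \<and>
        K_M \<psi> as = monotone_cumulant \<psi> as \<and>
        \<phi> (list_mult as) = (\<Sum>\<pi>\<in>monotone_partitions (length as). 1 / fact (length \<pi>) *
           ((\<Prod>P\<in>outer_blocks (set \<pi>). K_CM \<phi> \<psi> (nths as P)) *
            (\<Prod>P\<in>inner_blocks (set \<pi>). K_M \<psi> (nths as P)))) \<and>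
        \<psi> (list_mult as) = (\<Sum>\<pi>\<in>monotone_partitions (length as). 1 / fact (length \<pi>) *
           (\<Prod>P\<in>set \<pi>. K_M \<psi> (nths as P))))) \<and>
     (\<forall>as. as \<noteq> [] \<longrightarrow>
        K_CAM \<phi> \<psi> as = c_antimonotone_cumulant \<phi> \<psi> as \<and>
        K_AM \<psi> as = antimonotone_cumulant \<psi> as \<and>
        \<phi> (list_mult as) = (\<Sum>\<pi>\<in>antimonotone_partitions (length as). 1 / fact (length \<pi>) *
           ((\<Prod>P\<in>outer_blocks (set \<pi>). K_CAM \<phi> \<psi> (nths as P)) *
            (\<Prod>P\<in>inner_blocks (set \<pi>). K_AM \<psi> (nths as P)))) \<and>
        \<psi> (list_mult as) = (\<Sum>\<pi>\<in>antimonotone_partitions (length as). 1 / fact (length \<pi>) *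
           (\<Prod>P\<in>set \<pi>. K_AM \<psi> (nths as P)))) \<and>
     (\<forall>as. as \<noteq> [] \<longrightarrow>
        K_B \<phi> as = boolean_cumulant \<phi> as \<and>
        \<phi> (list_mult as) = (\<Sum>\<sigma>\<in>interval_partitions (length as).
           \<Prod>P\<in>\<sigma>. K_B \<phi> (nths as P)))"
proof (intro conjI allI impI)
  note lin = assms and lin' = assms(2) assms(2)
  \<comment> \<open>The antimonotone functionals equal the monotone ones, so the formulas of the
    second part differ from the first only by the reversal of the lists of blocks.\<close>
  have KAM: "K_AM \<psi> = K_M \<psi>" "K_CAM \<phi> \<psi> = K_CM \<phi> \<psi>"
    by (simp_all add: fun_eq_iff K_AM_eq K_M_eq K_CAM_eq[OF lin] K_CAM_eq[OF lin'])
  show "multilinear_functionals (K_CM \<phi> \<psi>)" by (rule multilinear_K_CM[OF lin])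
  show "multilinear_functionals (K_M \<psi>)" unfolding K_M_eq by (rule multilinear_K_CM[OF lin'])
  fix as :: "'a list" assume as: "as \<noteq> []"
  show "K_CM \<phi> \<psi> as = c_monotone_cumulant \<phi> \<psi> as"
    by (rule c_monotone_cumulant_eq[OF lin as, symmetric])
  show "K_M \<psi> as = monotone_cumulant \<psi> as"
    by (simp add: K_M_eq monotone_cumulant_eq c_monotone_cumulant_eq[OF lin' as])
  show "K_CAM \<phi> \<psi> as = c_antimonotone_cumulant \<phi> \<psi> as"
    by (simp add: KAM c_antimonotone_cumulant_eq[OF lin as])
  show "K_AM \<psi> as = antimonotone_cumulant \<psi> as"
    by (simp add: KAM K_M_eq antimonotone_cumulant_eq c_antimonotone_cumulant_eq[OF lin' as])
  show "K_B \<phi> as = boolean_cumulant \<phi> as"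
    by (simp add: K_B_eq boolean_cumulant_eq[OF assms(1)] c_monotone_cumulant_eq[OF assms(1) clinear_0 as])
  show "\<phi> (list_mult as) = (\<Sum>\<pi>\<in>monotone_partitions (length as). 1 / fact (length \<pi>) *
           ((\<Prod>P\<in>outer_blocks (set \<pi>). K_CM \<phi> \<psi> (nths as P)) *
            (\<Prod>P\<in>inner_blocks (set \<pi>). K_M \<psi> (nths as P))))"
    by (rule moment_c_monotone[OF lin as])
  then show "\<phi> (list_mult as) = (\<Sum>\<pi>\<in>antimonotone_partitions (length as). 1 / fact (length \<pi>) *
           ((\<Prod>P\<in>outer_blocks (set \<pi>). K_CAM \<phi> \<psi> (nths as P)) *
            (\<Prod>P\<in>inner_blocks (set \<pi>). K_AM \<psi> (nths as P))))"
    unfolding KAM sum_antimonotone_partitions[of "\<lambda>n \<sigma>. 1 / fact n * ((\<Prod>P\<in>outer_blocks \<sigma>. K_CM \<phi> \<psi> (nths as P)) *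
            (\<Prod>P\<in>inner_blocks \<sigma>. K_M \<psi> (nths as P)))"] .
  show "\<psi> (list_mult as) = (\<Sum>\<pi>\<in>monotone_partitions (length as). 1 / fact (length \<pi>) *
           (\<Prod>P\<in>set \<pi>. K_M \<psi> (nths as P)))"
    by (rule moment_monotone[OF assms(2) as])
  then show "\<psi> (list_mult as) = (\<Sum>\<pi>\<in>antimonotone_partitions (length as). 1 / fact (length \<pi>) *
           (\<Prod>P\<in>set \<pi>. K_AM \<psi> (nths as P)))"
    unfolding KAM sum_antimonotone_partitions[of "\<lambda>n \<sigma>. 1 / fact n * (\<Prod>P\<in>\<sigma>. K_M \<psi> (nths as P))"] .
  show "\<phi> (list_mult as) = (\<Sum>\<sigma>\<in>interval_partitions (length as). \<Prod>P\<in>\<sigma>. K_B \<phi> (nths as P))"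
    by (rule moment_boolean[OF assms(1) as])
qed

end
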